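(* Let $1\le s\le k$ be integers, let $J\in\mathbb{R}^{2m\times 2m}$ satisfy $J^T=-J=J^{-1}$, and let $H:\mathbb{R}^{2m}\to\mathbb{R}$. Apply one step, of size $h>0$, of the method HBVM$(k,s)$ based on the $k$ Gauss-Legendre abscissae in $[0,1]$ to the Hamiltonian problem $y'=J\nabla H(y)$, $y(0)=y_0\in\mathbb{R}^{2m}$, and let $y_1$ be the resulting approximation of $y(h)$. If $H$ is a polynomial of degree $\nu\le \frac{2k}{s}$, then $H(y_1)=H(y_0)$. In any other case (with $H$ real-analytic), $H(y_1)-H(y_0)=O(h^{2k+1})$ as $h\to0$, even though the method has order $2s$.
   Context: For $i\ge 0$, $P_i$ denotes the Legendre polynomial shifted to $[0,1]$ and normalized (positive leading coefficient) so that $\deg P_i=i$ and $\int_0^1P_i(x)P_j(x)\,dx=\delta_{ij}$. The Gauss-Legendre abscissae $0<c_1<\dots<c_k<1$ are the roots of $P_k$, with weights $b_i=\int_0^1\prod_{j\ne i}\frac{x-c_j}{c_i-c_j}\,dx$. HBVM$(k,s)$ applied to $y'=f(y)$, $y(0)=y_0$, with stepsize $h>0$: let $u$ be the (vector-valued) polynomial of degree at most $s$ such that $u(0)=y_0$ and $$u'(ch)=\sum_{j=0}^{s-1}P_j(c)\sum_{\ell=1}^k b_\ell P_j(c_\ell)f(u(c_\ell h)),\qquad c\in[0,1];$$ the new approximation is $y_1=u(h)$. For asymptotic statements as $h\to0$, $u$ is the solution (for all sufficiently small $h$) such that $c\mapsto u(ch)$ stays in a fixed small ball around $y_0$. The method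 has order $p$ if $y_1-y(h)=O(h^{p+1})$, where $y$ is the exact solution. *)

theory Defs
  imports
    "HOL-Analysis.Analysis"
    "HOL-Computational_Algebra.Polynomial"
    "HOL-Library.Landau_Symbols"
begin

section \<open>Orthonormal Legendre polynomials on the unit interval\<close>

definition inner01 :: "real poly \<Rightarrow> real poly \<Rightarrow> real" where
  "inner01 p q = integral {0..1} (\<lambda>x. poly p x * poly q x)"

definition orthonormal_legendre_family :: "(nat \<Rightarrow> real poly) \<Rightarrow> bool" where
  "orthonormal_legendre_family P \<longleftrightarrow>
     (\<forall>i. degree (P i) = i \<and> lead_coeff (P i) > 0) \<and>
     (\<forall>i j. inner01 (P i) (P j) = (if i = j then 1 else 0))"

text \<open>Well-defined by lemma \<open>legendre01\<close> below.\<close>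

definition legendre01 :: "nat \<Rightarrow> real poly" where
  "legendre01 = (THE P. orthonormal_legendre_family P)"

lemma integrable_poly_mult:
  fixes p q :: "real poly"
  shows "(\<lambda>x. poly p x * poly q x) integrable_on {0..1}"
  by (intro integrable_continuous_real continuous_intros)

lemma inner01_commute: "inner01 p q = inner01 q p"
  by (simp add: inner01_def mult.commute)

lemma inner01_add_left: "inner01 (p + q) r = inner01 p r + inner01 q r"
  unfolding inner01_def
  by (simp add: distrib_right integral_add[OF integrable_poly_mult integrable_poly_mult])

lemma inner01_smult_left: "inner01 (smult a p) r = a * inner01 p r"
  unfolding inner01_def by (simp add: mult.assoc)

lemma inner01_diff_left: "inner01 (p - q) r = inner01 p r - inner01 q r"
  using inner01_add_left[of p "smult (-1) q" r] inner01_smult_left[of "-1" q r] by simp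

lemma inner01_sum_left: "inner01 (\<Sum>j\<in>A. f j) r = (\<Sum>j\<in>A. inner01 (f j) r)"
proof (induction A rule: infinite_finite_induct)
  case (insert x F)
  then show ?case by (simp add: inner01_add_left)
qed (simp_all add: inner01_def)

lemma inner01_self_nonneg: "inner01 p p \<ge> 0"
  unfolding inner01_def by (intro integral_nonneg integrable_poly_mult) simp

lemma inner01_self_eq_0_iff: "inner01 p p = 0 \<longleftrightarrow> p = 0"
proof
  assume "inner01 p p = 0"
  then have "\<forall>x\<in>{0..1}. poly p x * poly p x = 0"
    unfolding inner01_def
    by (subst (asm) integral_eq_0_iff) (auto intro!: continuous_intros)
  then have "{0..1} \<subseteq> {x. poly p x = 0}" by auto
  then have "infinite {x. poly p x = 0}"
    using infinite_Icc[of "0::real" 1] finite_subset by (metis zero_less_one)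
  then show "p = 0" using poly_roots_finite by blast
qed (simp add: inner01_def)

function gram_schmidt01 :: "nat \<Rightarrow> real poly" where
  "gram_schmidt01 n =
     (let q = monom 1 n - (\<Sum>j\<in>{..<n}. smult (inner01 (monom 1 n) (gram_schmidt01 j)) (gram_schmidt01 j))
      in smult (1 / sqrt (inner01 q q)) q)"
  by auto
termination by (relation less_than) auto

declare gram_schmidt01.simps [simp del]

lemma gram_schmidt01_family: "orthonormal_legendre_family gram_schmidt01"
proof -
  have main: "degree (gram_schmidt01 n) = n \<and> lead_coeff (gram_schmidt01 n) > 0 \<and>
      inner01 (gram_schmidt01 n) (gram_schmidt01 n) = 1 \<and>
      (\<forall>i<n. inner01 (gram_schmidt01 n) (gram_schmidt01 i) = 0)" for n
  proof (induction n rule: less_induct)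
    case (less n)
    let ?G = gram_schmidt01
    define r where "r = (\<Sum>j<n. smult (inner01 (monom 1 n) (?G j)) (?G j))"
    define q where "q = monom 1 n - r"
    have G: "?G n = smult (1 / sqrt (inner01 q q)) q"
      by (subst gram_schmidt01.simps) (simp add: q_def r_def Let_def)
    have r0: "coeff r i = 0" if "i \<ge> n" for i
      unfolding r_def coeff_sum using less that by (intro sum.neutral) (auto simp: coeff_eq_0)
    have "coeff q n = 1" by (simp add: q_def r0)
    moreover have "degree q \<le> n"
      by (rule degree_le) (auto simp: q_def r0)
    ultimately have deg: "degree q = n" and lc: "lead_coeff q = 1"
      using le_degree[of q n] by auto
    have "q \<noteq> 0" using lc by auto
    then have pos: "inner01 q q > 0"
      using inner01_self_nonneg[of q] inner01_self_eq_0_iff[of q] by linarith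
    have orth: "inner01 q (?G i) = 0" if "i < n" for i
    proof -
      have *: "inner01 (?G j) (?G i) = (if j = i then 1 else 0)" if "j < n" for j
        using less.IH \<open>i < n\<close> that inner01_commute by (metis nat_neq_iff)
      have "inner01 r (?G i) = (\<Sum>j<n. inner01 (monom 1 n) (?G j) * inner01 (?G j) (?G i))"
        by (simp add: r_def inner01_sum_left inner01_smult_left)
      also have "\<dots> = (\<Sum>j<n. if j = i then inner01 (monom 1 n) (?G j) else 0)"
        by (rule sum.cong) (auto simp: *)
      also have "\<dots> = inner01 (monom 1 n) (?G i)" using that by simp
      finally show ?thesis by (simp add: q_def inner01_diff_left)
    qed
    have "inner01 (?G n) (?G n) = (1 / sqrt (inner01 q q)) * ((1 / sqrt (inner01 q q)) * inner01 q q)"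
      unfolding G inner01_smult_left by (subst inner01_commute) (simp only: inner01_smult_left)
    also have "\<dots> = 1" using pos by (simp add: field_simps)
    finally have "inner01 (?G n) (?G n) = 1" .
    moreover have "degree (?G n) = n" "lead_coeff (?G n) > 0"
      using pos deg lc by (simp_all add: G)
    moreover have "\<forall>i<n. inner01 (?G n) (?G i) = 0"
      using orth by (subst G) (simp add: inner01_smult_left)
    ultimately show ?case by simp
  qed
  have "inner01 (gram_schmidt01 i) (gram_schmidt01 j) = (if i = j then 1 else 0)" for i j
    using main inner01_commute by (metis nat_neq_iff)
  then show ?thesis using main unfolding orthonormal_legendre_family_def by blast
qed

lemma orthonormal_legendre_family_orthogonal_lower:
  assumes P: "orthonormal_legendre_family P" and "\<forall>i\<ge>n. coeff q i = 0"
  shows "inner01 q (P n) = 0"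
proof -
  have "\<forall>q. (\<forall>i\<ge>m. coeff q i = 0) \<longrightarrow> inner01 q (P n) = 0" if "m \<le> n" for m
    using that
  proof (induction m)
    case 0
    have "q = 0" if "\<forall>i. coeff q i = 0" for q :: "real poly"
      using that by (simp add: poly_eq_iff)
    then show ?case by (metis inner01_smult_left mult_zero_left smult_0_left zero_le)
  next
    case (Suc m)
    show ?case
    proof (intro allI impI)
      fix q :: "real poly" assume q: "\<forall>i\<ge>Suc m. coeff q i = 0"
      have dm: "degree (P m) = m" and lc: "coeff (P m) m > 0"
        using P unfolding orthonormal_legendre_family_def by (auto, metis)
      define a where "a = coeff q m / coeff (P m) m"
      have "\<forall>i\<ge>m. coeff (q - smult a (P m)) i = 0"
      proof (intro allI impI)
        fix i assume "m \<le> i"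
        then show "coeff (q - smult a (P m)) i = 0"
          using q lc dm by (cases "i = m") (auto simp: a_def coeff_eq_0)
      qed
      then have "inner01 (q - smult a (P m)) (P n) = 0" using Suc by auto
      moreover have "inner01 (P m) (P n) = 0"
        using P Suc.prems unfolding orthonormal_legendre_family_def by auto
      ultimately show "inner01 q (P n) = 0" by (simp add: inner01_diff_left inner01_smult_left)
    qed
  qed
  then show ?thesis using assms(2) by blast
qed

lemma orthonormal_legendre_family_unique:
  assumes P: "orthonormal_legendre_family P" and Q: "orthonormal_legendre_family Q"
  shows "P = Q"
proof
  fix n
  define a where "a = coeff (P n) n"
  define b where "b = coeff (Q n) n"
  have ab: "a > 0" "b > 0" and deg: "degree (P n) = n" "degree (Q n) = n"
    and nrm: "inner01 (P n) (P n) = 1" "inner01 (Q n) (Q n) = 1"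
    using P Q unfolding orthonormal_legendre_family_def a_def b_def by (simp_all, metis+)
  define d where "d = smult b (P n) - smult a (Q n)"
  have d0: "\<forall>i\<ge>n. coeff d i = 0"
  proof (intro allI impI)
    fix i assume "n \<le> i"
    then show "coeff d i = 0"
      using deg by (cases "i = n") (auto simp: d_def a_def b_def coeff_eq_0)
  qed
  have "inner01 d d = b * inner01 (P n) d - a * inner01 (Q n) d"
    by (subst (1) d_def) (simp add: inner01_diff_left inner01_smult_left)
  also have "\<dots> = 0"
    using orthonormal_legendre_family_orthogonal_lower[OF P d0]
      orthonormal_legendre_family_orthogonal_lower[OF Q d0] by (simp add: inner01_commute)
  finally have eq: "smult b (P n) = smult a (Q n)" by (simp add: inner01_self_eq_0_iff d_def)
  have sq: "inner01 (smult c p) (smult c p) = c\<^sup>2 * inner01 p p" for c p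
    using inner01_smult_left inner01_commute by (metis mult.assoc power2_eq_square)
  have "b\<^sup>2 = a\<^sup>2" using sq[of b "P n"] sq[of a "Q n"] eq nrm by simp
  then have "a = b" using ab by (simp add: power2_eq_iff_nonneg)
  then show "P n = Q n" using eq ab by (simp add: poly_eq_iff)
qed

lemma legendre01: "orthonormal_legendre_family legendre01"
  unfolding legendre01_def
  by (rule theI[where P = orthonormal_legendre_family and a = gram_schmidt01])
    (auto intro: gram_schmidt01_family orthonormal_legendre_family_unique)

section \<open>Gauss--Legendre quadrature and the HBVM step\<close>

text \<open>Abscissae and weights are indexed from \<open>1\<close> to \<open>k\<close>; the abscissae increase.\<close>

definition gauss_node :: "nat \<Rightarrow> nat \<Rightarrow> real" where
  "gauss_node k i = sorted_list_of_set {x. poly (legendre01 k) x = 0} ! (i - 1)"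

definition gauss_weight :: "nat \<Rightarrow> nat \<Rightarrow> real" where
  "gauss_weight k i =
     integral {0..1} (\<lambda>x. \<Prod>j\<in>{1..k} - {i}. (x - gauss_node k j) / (gauss_node k i - gauss_node k j))"

definition hbvm_solution ::
  "nat \<Rightarrow> nat \<Rightarrow> ('a::euclidean_space \<Rightarrow> 'a) \<Rightarrow> 'a \<Rightarrow> real \<Rightarrow> (real \<Rightarrow> 'a) \<Rightarrow> bool" where
  "hbvm_solution k s f y0 h u \<longleftrightarrow>
     (\<exists>a. \<forall>t. u t = (\<Sum>i\<le>s. t ^ i *\<^sub>R a i)) \<and>
     u 0 = y0 \<and>
     (\<forall>c\<in>{0..1}. (u has_vector_derivative
        (\<Sum>j<s. poly (legendre01 j) c *\<^sub>R
           (\<Sum>l=1..k. (gauss_weight k l * poly (legendre01 j) (gauss_node k l)) *\<^sub>R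
              f (u (gauss_node k l * h))))) (at (c * h)))"

text \<open>The method is implicit and may have spurious solutions; a ball around \<open>y0\<close> of radius
  \<open>r\<close>, independent of \<open>h\<close>, selects the relevant one.\<close>

definition hbvm_solution_in_ball ::
  "nat \<Rightarrow> nat \<Rightarrow> ('a::euclidean_space \<Rightarrow> 'a) \<Rightarrow> 'a \<Rightarrow> real \<Rightarrow> real \<Rightarrow> (real \<Rightarrow> 'a) \<Rightarrow> bool" where
  "hbvm_solution_in_ball k s f y0 r h u \<longleftrightarrow>
     hbvm_solution k s f y0 h u \<and> (\<forall>c\<in>{0..1}. u (c * h) \<in> ball y0 r)"

definition hbvm_step ::
  "nat \<Rightarrow> nat \<Rightarrow> ('a::euclidean_space \<Rightarrow> 'a) \<Rightarrow> 'a \<Rightarrow> real \<Rightarrow> real \<Rightarrow> 'a" where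
  "hbvm_step k s f y0 r h = (THE u. hbvm_solution_in_ball k s f y0 r h u) h"

definition exact_solution ::
  "('a::euclidean_space \<Rightarrow> 'a) \<Rightarrow> 'a \<Rightarrow> real \<Rightarrow> (real \<Rightarrow> 'a) \<Rightarrow> bool" where
  "exact_solution f y0 T y \<longleftrightarrow>
     y 0 = y0 \<and> (\<forall>t\<in>{0..T}. (y has_vector_derivative f (y t)) (at t within {0..T}))"

section \<open>Hamiltonian systems; polynomial and real-analytic Hamiltonians\<close>

definition grad :: "('a::real_inner \<Rightarrow> real) \<Rightarrow> 'a \<Rightarrow> 'a" where
  "grad H x = (THE D. GDERIV H x :> D)"

definition hamiltonian_field :: "real^'n^'n \<Rightarrow> (real^'n \<Rightarrow> real) \<Rightarrow> real^'n \<Rightarrow> real^'n" where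
  "hamiltonian_field J H y = J *v grad H y"

text \<open>Multi-indices are functions \<open>'n \<Rightarrow> nat\<close>.\<close>

definition monomial :: "real^'n \<Rightarrow> ('n \<Rightarrow> nat) \<Rightarrow> real" where
  "monomial x \<alpha> = (\<Prod>i\<in>UNIV. (x $ i) ^ \<alpha> i)"

text \<open>Total degree, with degree \<open>0\<close> for the zero polynomial.\<close>

definition polynomial_of_degree :: "(real^'n \<Rightarrow> real) \<Rightarrow> nat \<Rightarrow> bool" where
  "polynomial_of_degree H \<nu> \<longleftrightarrow>
     (\<exists>a :: ('n \<Rightarrow> nat) \<Rightarrow> real.
        finite {\<alpha>. a \<alpha> \<noteq> 0} \<and>
        (\<forall>x. H x = (\<Sum>\<alpha> | a \<alpha> \<noteq> 0. a \<alpha> * monomial x \<alpha>)) \<and>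
        \<nu> = Max (insert 0 ((\<lambda>\<alpha>. \<Sum>i\<in>UNIV. \<alpha> i) ` {\<alpha>. a \<alpha> \<noteq> 0})))"

definition real_analytic :: "(real^'n \<Rightarrow> real) \<Rightarrow> bool" where
  "real_analytic H \<longleftrightarrow>
     (\<forall>x0. \<exists>r>0. \<exists>a :: ('n \<Rightarrow> nat) \<Rightarrow> real. \<forall>x\<in>ball x0 r.
        ((\<lambda>\<alpha>. a \<alpha> * monomial (x - x0) \<alpha>) has_sum H x) UNIV)"

end

theory Submission
  imports Defs
begin

text \<open>Project the vector field along the numerical trajectory \<open>c \<mapsto> u(ch)\<close> by
  \<open>\<Pi> F = \<Sum>j<s. Q[P\<^sub>j F] P\<^sub>j\<close>, where \<open>Q\<close> is the Gauss quadrature, exact below degree \<open>2k\<close>; then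
  \<open>d/dc u(ch) = h \<Pi> f(u)\<close>. Since \<open>J\<close> is skew, \<open>H(u(h)) - H(y0)\<close> is a sum of products of a quadrature
  error of \<open>P\<^sub>j \<nabla>H(u)\<close> with a coefficient \<open>Q[P\<^sub>j \<nabla>H(u)]\<close>, times \<open>h\<close>. For polynomial \<open>H\<close> of small degree
  the errors vanish. In general, call a family of functions of \<open>c\<close> graded if the coefficient of
  \<open>c^i\<close> in a polynomial approximation is \<open>O(h^i)\<close>. Such families are closed under products,
  \<open>h \<integral>\<close> and \<open>\<Pi>\<close>, so by bootstrapping every smooth function of \<open>u(ch)\<close> is graded to all
  orders, and a bilinear form vanishing on \<open>(c^m, c^n)\<close> for \<open>m + n < M\<close> is \<open>O(h^M)\<close> on graded
  families. This applies with \<open>M = 2k\<close> to the energy and with \<open>M = 2s\<close> to the pairing of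
  \<open>f(u) - \<Pi> f(u)\<close> with the gradient of the truncated Lie series of the flow, which gives the order.\<close>

section \<open>Gauss quadrature\<close>

text \<open>A Taylor expansion of u in h is awkward to get: u comes from a separate fixed point for
  each h, so no regularity in h is at hand. Grading asks only for bounds uniform in h, with the
  approximating polynomial chosen afresh for each h. Two facts make it work. Integration followed by
  a factor h turns h^i c^i into a multiple of h^(i+1) c^(i+1), so the O(1) bound supplied by the
  fixed ball improves by one order at a time. And \<Pi> never raises degree: for n < j < k the
  quadrature of P_j c^n is exact, hence zero, and this is where s \<le> k enters. The two exponents
  come from Q as well. In the energy, n < j kills the second factor, while j \<le> n gives m + j <
  2k and an exact quadrature, so the first factor vanishes. In the order estimate, \<Pi> is the
  identity below degree s, while for n \<ge> s the inequality m + n < 2s leaves m < s, and the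
  defect of c^n is orthogonal to c^m. The factor h in front turns 2k and 2s into 2k + 1 and 2s +
  1.\<close>

lemma degree_legendre01 [simp]: "degree (legendre01 n) = n"
  and inner01_legendre01: "inner01 (legendre01 i) (legendre01 j) = (if i = j then 1 else 0)"
  using legendre01 by (auto simp: orthonormal_legendre_family_def)

lemma legendre01_nonzero [simp]: "legendre01 n \<noteq> 0"
  using inner01_legendre01[of n n] by (auto simp: inner01_def)

lemma inner01_legendre01_lower:
  assumes "degree q < n"
  shows "inner01 q (legendre01 n) = 0"
  using assms by (intro orthonormal_legendre_family_orthogonal_lower[OF legendre01]) (auto intro: coeff_eq_0)

section \<open>Roots of the Legendre polynomials\<close>

lemma poly_no_root_sign:
  fixes p :: "real poly"
  assumes "\<And>x. x \<in> {0<..<1} \<Longrightarrow> poly p x \<noteq> 0"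
  shows "(\<forall>x\<in>{0..1}. poly p x \<ge> 0) \<or> (\<forall>x\<in>{0..1}. poly p x \<le> 0)"
proof (rule ccontr)
  assume "\<not> ?thesis"
  then obtain x y where xy: "x \<in> {0..1}" "poly p x < 0" "y \<in> {0..1}" "poly p y > 0"
    by (auto simp: not_le)
  then have "x \<noteq> y" by auto
  then consider "x < y" | "y < x" by linarith
  then show False
  proof cases
    case 1
    then show False using poly_IVT_pos[of x y p] xy assms by fastforce
  next
    case 2
    then show False using poly_IVT_neg[of y x p] xy assms by fastforce
  qed
qed

text \<open>The witness is the set of roots of odd multiplicity in (0,1): one further factor for
  each makes every interior multiplicity even, so the product no longer changes sign. The induction
  divides out one root at a time. This flips the parity of that root, which is therefore removed
  from \<open>S\<close> if present and added otherwise.\<close>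

lemma poly_sign_correction:
  fixes p :: "real poly"
  assumes "p \<noteq> 0"
  shows "\<exists>S. finite S \<and> S \<subseteq> {0<..<1} \<and> (\<forall>z\<in>S. poly p z = 0) \<and>
     ((\<forall>x\<in>{0..1}. poly (p * (\<Prod>z\<in>S. [:-z, 1:])) x \<ge> 0) \<or>
      (\<forall>x\<in>{0..1}. poly (p * (\<Prod>z\<in>S. [:-z, 1:])) x \<le> 0))"
  using assms
proof (induction "degree p" arbitrary: p rule: less_induct)
  case less
  show ?case
  proof (cases "\<exists>z\<in>{0<..<1}. poly p z = 0")
    case False
    then show ?thesis using poly_no_root_sign[of p] by (intro exI[of _ "{}"]) auto
  next
    case True
    then obtain z q where z: "z \<in> {0<..<1}" "poly p z = 0" and pq: "p = [:-z, 1:] * q"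
      by (auto simp: poly_eq_0_iff_dvd)
    have q0: "q \<noteq> 0" using pq less.prems by auto
    then have "degree q < degree p" unfolding pq by (subst degree_mult_eq) auto
    from less.hyps[OF this q0] obtain S where S: "finite S" "S \<subseteq> {0<..<1}" "\<forall>z\<in>S. poly q z = 0"
      and sg: "(\<forall>x\<in>{0..1}. poly (q * (\<Prod>z\<in>S. [:-z, 1:])) x \<ge> 0) \<or>
        (\<forall>x\<in>{0..1}. poly (q * (\<Prod>z\<in>S. [:-z, 1:])) x \<le> 0)" by blast
    show ?thesis
    proof (cases "z \<in> S")
      case True
      have "p * (\<Prod>z\<in>S-{z}. [:-z, 1:]) = q * (\<Prod>z\<in>S. [:-z, 1:])"
        unfolding pq prod.remove[OF S(1) True] by (simp only: mult_ac)
      then show ?thesis using S sg pq by (intro exI[of _ "S - {z}"]) auto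
    next
      case False
      have "p * (\<Prod>z\<in>insert z S. [:-z, 1:]) = [:-z, 1:]\<^sup>2 * (q * (\<Prod>z\<in>S. [:-z, 1:]))"
        unfolding pq prod.insert[OF S(1) False] by (simp only: mult_ac power2_eq_square)
      then have "poly (p * (\<Prod>z\<in>insert z S. [:-z, 1:])) x =
          (x - z)\<^sup>2 * poly (q * (\<Prod>z\<in>S. [:-z, 1:])) x" for x
        by (simp add: poly_power)
      then have "(\<forall>x\<in>{0..1}. poly (p * (\<Prod>z\<in>insert z S. [:-z, 1:])) x \<ge> 0) \<or>
        (\<forall>x\<in>{0..1}. poly (p * (\<Prod>z\<in>insert z S. [:-z, 1:])) x \<le> 0)"
        using sg by (metis mult_nonneg_nonneg mult_nonneg_nonpos zero_le_power2)
      then show ?thesis using S z pq by (intro exI[of _ "insert z S"]) auto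
    qed
  qed
qed

text \<open>With fewer than \<open>k\<close> sign changes in (0,1), the product \<open>?Q\<close> of
  the linear factors at them would have degree below \<open>k\<close> and be orthogonal to
  \<open>legendre01 k\<close>. But \<open>legendre01 k * ?Q\<close> has constant sign on the
  interval, so a zero integral would make it vanish. Hence the interior sign changes already exhaust
  the at most \<open>k\<close> roots.\<close>

lemma legendre01_roots:
  "card {x. poly (legendre01 k) x = 0} = k" "{x. poly (legendre01 k) x = 0} \<subseteq> {0<..<1}"
proof -
  let ?R = "{x. poly (legendre01 k) x = 0}"
  obtain S where S: "finite S" "S \<subseteq> {0<..<1}" "S \<subseteq> ?R"
    and sg: "(\<forall>x\<in>{0..1}. poly (legendre01 k * (\<Prod>z\<in>S. [:-z, 1:])) x \<ge> 0) \<or>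
      (\<forall>x\<in>{0..1}. poly (legendre01 k * (\<Prod>z\<in>S. [:-z, 1:])) x \<le> 0)"
    using poly_sign_correction[OF legendre01_nonzero[of k]] by blast
  let ?Q = "\<Prod>z\<in>S. [:-z, 1:]"
  have Q0: "?Q \<noteq> 0" using S(1) by (simp add: prod_zero_iff)
  have R: "finite ?R" "card ?R \<le> k"
    using poly_roots_finite[OF legendre01_nonzero[of k]] card_poly_roots_bound[OF legendre01_nonzero[of k]] by simp_all
  have "k \<le> card S"
  proof (rule ccontr)
    assume "\<not> k \<le> card S"
    moreover have "degree ?Q \<le> card S"
      by (rule order.trans[OF degree_prod_sum_le]) (use S(1) in auto)
    ultimately have "inner01 (legendre01 k) ?Q = 0"
      by (subst inner01_commute) (intro inner01_legendre01_lower, linarith)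
    then have I: "integral {0..1} (poly (legendre01 k * ?Q)) = 0"
      by (simp add: inner01_def poly_mult[abs_def])
    have "\<forall>x\<in>{0..1}. poly (legendre01 k * ?Q) x = 0"
    proof (cases "\<forall>x\<in>{0..1}. poly (legendre01 k * ?Q) x \<ge> 0")
      case True
      then show ?thesis using I
        by (subst (asm) integral_eq_0_iff) (auto intro!: continuous_intros simp del: poly_mult)
    next
      case False
      have "integral {0..1} (\<lambda>x. - poly (legendre01 k * ?Q) x) = 0"
        using I by (simp only: integral_neg)
      then show ?thesis using sg False
        by (subst (asm) integral_eq_0_iff) (auto intro!: continuous_intros simp del: poly_mult)
    qed
    then have "{0..1} \<subseteq> {x. poly (legendre01 k * ?Q) x = 0}" by blast
    then have "infinite {x. poly (legendre01 k * ?Q) x = 0}"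
      using infinite_Icc[of "0::real" 1] finite_subset by (metis zero_less_one)
    then have "legendre01 k * ?Q = 0" using poly_roots_finite by blast
    then show False using Q0 by (simp only: mult_eq_0_iff) simp
  qed
  then have "S = ?R" using S R by (metis card_seteq order.trans)
  then show "card ?R = k" "?R \<subseteq> {0<..<1}"
    using S(2) R(2) \<open>k \<le> card S\<close> by auto
qed

lemma bij_betw_gauss_node: "bij_betw (gauss_node k) {1..k} {x. poly (legendre01 k) x = 0}"
proof -
  let ?R = "{x. poly (legendre01 k) x = 0}" and ?L = "sorted_list_of_set {x. poly (legendre01 k) x = 0}"
  have fin: "finite ?R" by (intro poly_roots_finite) simp
  have "bij_betw ((!) ?L) {..<k} ?R"
    using fin legendre01_roots(1)[of k] by (intro bij_betw_nth) auto
  moreover have "bij_betw (\<lambda>i. i - 1) {1..k} {..<k}"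
    by (rule bij_betw_byWitness[where f' = Suc]) auto
  ultimately show ?thesis
    using bij_betw_trans[of "\<lambda>i. i - 1" "{1..k}" "{..<k}" "(!) ?L" ?R]
    by (simp add: gauss_node_def[abs_def] comp_def)
qed

lemma gauss_node_root: "l \<in> {1..k} \<Longrightarrow> poly (legendre01 k) (gauss_node k l) = 0"
  using bij_betw_gauss_node[of k] by (auto simp: bij_betw_def)

lemma gauss_node_bounds: "l \<in> {1..k} \<Longrightarrow> gauss_node k l \<in> {0<..<1}"
  using gauss_node_root[of l k] legendre01_roots(2)[of k] by blast

lemma inj_on_gauss_node: "inj_on (gauss_node k) {1..k}"
  using bij_betw_gauss_node[of k] by (auto simp: bij_betw_def)

section \<open>The quadrature rule and its exactness\<close>

definition gauss_quadrature :: "nat \<Rightarrow> (real \<Rightarrow> real) \<Rightarrow> real" where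
  "gauss_quadrature k F = (\<Sum>l=1..k. gauss_weight k l * F (gauss_node k l))"

lemma gauss_quadrature_cmult: "gauss_quadrature k (\<lambda>x. a * F x) = a * gauss_quadrature k F"
  by (simp add: gauss_quadrature_def sum_distrib_left mult_ac)

lemma gauss_quadrature_add:
  "gauss_quadrature k (\<lambda>x. F x + G x) = gauss_quadrature k F + gauss_quadrature k G"
  by (simp add: gauss_quadrature_def sum.distrib distrib_left)

text \<open>The weights are by definition the integrals of the Lagrange basis polynomials
  \<open>L l\<close>, and a polynomial of degree below \<open>k\<close> equals its interpolant
  \<open>q\<close>, since their difference has \<open>k\<close> roots and too small a
  degree.\<close>

lemma gauss_quadrature_exact_interpolation:
  fixes p :: "real poly"
  assumes "degree p < k"
  shows "gauss_quadrature k (poly p) = integral {0..1} (poly p)"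
proof -
  let ?c = "gauss_node k"
  define L where "L l = (\<Prod>j\<in>{1..k} - {l}. smult (1 / (?c l - ?c j)) [:- ?c j, 1:])" for l
  have pL: "poly (L l) x = (\<Prod>j\<in>{1..k} - {l}. (x - ?c j) / (?c l - ?c j))" for l x
    unfolding L_def poly_prod by (intro prod.cong) (simp_all add: diff_divide_distrib)
  have Lc: "poly (L l) (?c i) = (if i = l then 1 else 0)" if "l \<in> {1..k}" "i \<in> {1..k}" for l i
  proof (cases "i = l")
    case True
    have "(?c l - ?c j) / (?c l - ?c j) = 1" if "j \<in> {1..k} - {l}" for j
      using inj_on_eq_iff[OF inj_on_gauss_node[of k], of l j] that \<open>l \<in> {1..k}\<close> by simp
    then show ?thesis unfolding pL True by (simp add: prod.neutral)
  next
    case False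
    then have "(\<Prod>j\<in>{1..k} - {l}. (?c i - ?c j) / (?c l - ?c j)) = 0"
      using that by (intro prod_zero) auto
    then show ?thesis using False by (simp only: pL if_False)
  qed
  define q where "q = (\<Sum>l=1..k. smult (poly p (?c l)) (L l))"
  have dL: "degree (L l) < k" if "l \<in> {1..k}" for l
  proof -
    have "degree (L l) \<le> (\<Sum>j\<in>{1..k} - {l}. 1)"
      unfolding L_def
      by (rule order.trans[OF degree_prod_sum_le], simp, unfold comp_def, intro sum_mono)
        (rule order.trans[OF degree_smult_le], simp)
    then show ?thesis using that by (auto simp: card_Diff_singleton)
  qed
  have "degree q < k"
    unfolding q_def using assms dL
    by (intro degree_sum_less) (auto intro: le_less_trans[OF degree_smult_le])
  then have deg: "degree (p - q) < k" using assms degree_diff_less by blast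
  have "p - q = 0"
  proof (rule ccontr)
    assume nz: "p - q \<noteq> 0"
    have "poly (p - q) (?c i) = 0" if "i \<in> {1..k}" for i
      using that by (simp add: q_def poly_sum Lc if_distrib cong: if_cong)
    then have "?c ` {1..k} \<subseteq> {x. poly (p - q) x = 0}" by blast
    then have "card (?c ` {1..k}) \<le> card {x. poly (p - q) x = 0}"
      by (rule card_mono[OF poly_roots_finite[OF nz]])
    then have "k \<le> card {x. poly (p - q) x = 0}"
      by (simp only: card_image[OF inj_on_gauss_node[of k]] card_atLeastAtMost)
    then show False using card_poly_roots_bound[OF nz] deg by linarith
  qed
  then have "integral {0..1} (poly p) = integral {0..1} (poly q)" by simp
  also have "\<dots> = (\<Sum>l=1..k. poly p (?c l) * integral {0..1} (poly (L l)))"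
    unfolding q_def poly_sum poly_smult
    by (subst integral_sum) (auto intro!: integrable_continuous_real continuous_intros)
  also have "\<dots> = gauss_quadrature k (poly p)"
    unfolding gauss_quadrature_def gauss_weight_def pL[abs_def] by (simp add: mult.commute)
  finally show ?thesis by simp
qed

text \<open>Division by \<open>legendre01 k\<close> doubles the range of exactness: the multiple of
  \<open>legendre01 k\<close> integrates to zero by orthogonality, its quotient having degree below
  \<open>k\<close>, and it vanishes at all nodes. Both sides see only the remainder.\<close>

lemma gauss_quadrature_exact:
  fixes p :: "real poly"
  assumes "degree p < 2 * k"
  shows "gauss_quadrature k (poly p) = integral {0..1} (poly p)"
proof -
  define q r where "q = p div legendre01 k" and "r = p mod legendre01 k"
  have k: "k > 0" using assms by auto
  have p: "p = q * legendre01 k + r" by (simp add: q_def r_def)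
  have dr: "degree r < k"
    using degree_mod_less[of "legendre01 k" p] k by (auto simp: r_def)
  have dq: "degree q < k"
  proof (cases "q = 0")
    case False
    have "degree (q * legendre01 k) = degree q + k"
      using False by (subst degree_mult_eq) auto
    moreover have "degree (q * legendre01 k) \<le> max (degree p) (degree r)"
      using degree_diff_le_max[of p r] p by simp
    ultimately show ?thesis using assms dr by linarith
  qed (use k in simp)
  have "integral {0..1} (poly p) = inner01 q (legendre01 k) + integral {0..1} (poly r)"
    unfolding p inner01_def
    by (simp add: poly_mult[abs_def] poly_add[abs_def] integral_add[OF integrable_poly_mult]
        integrable_continuous_real continuous_intros)
  also have "\<dots> = gauss_quadrature k (poly r)"
    using inner01_legendre01_lower[OF dq] gauss_quadrature_exact_interpolation[OF dr] by simp
  also have "\<dots> = gauss_quadrature k (poly p)"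
    unfolding gauss_quadrature_def by (intro sum.cong) (auto simp: p gauss_node_root)
  finally show ?thesis by simp
qed

section \<open>Projection and graded families\<close>

definition hbvm_proj :: "nat \<Rightarrow> nat \<Rightarrow> (real \<Rightarrow> real) \<Rightarrow> real \<Rightarrow> real" where
  "hbvm_proj k s F x =
     (\<Sum>j<s. poly (legendre01 j) x * gauss_quadrature k (\<lambda>y. poly (legendre01 j) y * F y))"

text \<open>The operator \<open>hbvm_proj\<close> kept as a formal polynomial, so that degree and
  coefficients make sense.\<close>

definition hbvm_proj_poly :: "nat \<Rightarrow> nat \<Rightarrow> real poly \<Rightarrow> real poly" where
  "hbvm_proj_poly k s p =
     (\<Sum>j<s. smult (gauss_quadrature k (\<lambda>y. poly (legendre01 j) y * poly p y)) (legendre01 j))"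

lemma poly_hbvm_proj_poly: "poly (hbvm_proj_poly k s p) x = hbvm_proj k s (poly p) x"
  by (simp add: hbvm_proj_poly_def hbvm_proj_def poly_sum mult.commute)

lemma hbvm_proj_add: "hbvm_proj k s (\<lambda>x. F x + G x) x = hbvm_proj k s F x + hbvm_proj k s G x"
  by (simp add: hbvm_proj_def distrib_left gauss_quadrature_add sum.distrib)

lemma hbvm_proj_cmult: "hbvm_proj k s (\<lambda>x. a * F x) x = a * hbvm_proj k s F x"
proof -
  have *: "gauss_quadrature k (\<lambda>y. p y * (a * F y)) = a * gauss_quadrature k (\<lambda>y. p y * F y)" for p
    by (subst gauss_quadrature_cmult[symmetric]) (simp add: mult.left_commute)
  show ?thesis unfolding hbvm_proj_def * sum_distrib_left by (simp only: mult.left_commute)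
qed

lemma hbvm_proj_sum:
  "hbvm_proj k s (\<lambda>x. \<Sum>i\<in>I. F i x) x = (\<Sum>i\<in>I. hbvm_proj k s (F i) x)"
proof (induction I rule: infinite_finite_induct)
  case (insert i I)
  then show ?case by (simp add: hbvm_proj_add)
qed (simp_all add: hbvm_proj_def gauss_quadrature_def)

lemma continuous_on_hbvm_proj: "continuous_on S (hbvm_proj k s F)"
  unfolding hbvm_proj_def[abs_def] by (intro continuous_intros)

lemma gauss_quadrature_legendre01_exact:
  assumes "degree p + j < 2 * k"
  shows "gauss_quadrature k (\<lambda>x. poly (legendre01 j) x * poly p x) = inner01 (legendre01 j) p"
proof -
  have "degree (legendre01 j * p) < 2 * k"
    using assms by (intro le_less_trans[OF degree_mult_le]) simp
  from gauss_quadrature_exact[OF this] show ?thesis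
    by (simp add: inner01_def poly_mult[abs_def])
qed

text \<open>Since n + j < 2k the quadrature is exact, so the orthogonality of the Legendre
  polynomials to lower degrees survives discretisation.\<close>

lemma gauss_quadrature_legendre01_lower:
  assumes "n < j" "j < k"
  shows "gauss_quadrature k (\<lambda>x. poly (legendre01 j) x * x ^ n) = 0"
  using gauss_quadrature_legendre01_exact[of "monom 1 n" j k] assms
    inner01_legendre01_lower[of "monom 1 n" j]
  by (simp add: degree_monom_eq poly_monom inner01_commute)

text \<open>The terms with j > n have coefficient zero. This is the stability of grading under
  projection: a power of c above n would call for more factors h than c^n carries.\<close>

lemma degree_hbvm_proj_poly_monom:
  assumes "s \<le> k"
  shows "degree (hbvm_proj_poly k s (monom 1 n)) \<le> n"
  unfolding hbvm_proj_poly_def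
proof (rule degree_sum_le)
  fix j assume "j \<in> {..<s}"
  then show "degree (smult (gauss_quadrature k (\<lambda>y. poly (legendre01 j) y * poly (monom 1 n) y))
      (legendre01 j)) \<le> n"
    using gauss_quadrature_legendre01_lower[of n j k] assms
    by (cases "n < j") (auto simp: poly_monom)
qed simp

text \<open>The first t Legendre polynomials span the polynomials of degree below t; each step
  cancels the leading term. The condition on coefficients also covers t = 0, where it says p =
  0.\<close>

lemma inner01_eq_0_if_legendre01:
  assumes "\<And>j. j < t \<Longrightarrow> inner01 r (legendre01 j) = 0" and "\<forall>i\<ge>t. coeff p i = 0"
  shows "inner01 r p = 0"
  using assms
proof (induction t arbitrary: p)
  case 0
  then have "p = 0" by (simp add: poly_eq_iff)
  then show ?case by (simp add: inner01_def)
next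
  case (Suc t)
  define a where "a = coeff p t / coeff (legendre01 t) t"
  have lc: "coeff (legendre01 t) t \<noteq> 0"
    using leading_coeff_0_iff[of "legendre01 t"] by simp
  have "coeff (p - smult a (legendre01 t)) i = 0" if "i \<ge> t" for i
    using that lc Suc.prems(2) by (cases "i = t") (auto simp: a_def coeff_eq_0)
  then have "\<forall>i\<ge>t. coeff (p - smult a (legendre01 t)) i = 0" by blast
  then have "inner01 r (p - smult a (legendre01 t)) = 0"
    by (rule Suc.IH[rotated]) (use Suc.prems(1) in auto)
  then have "inner01 p r - a * inner01 (legendre01 t) r = 0"
    by (simp only: inner01_commute[of r] inner01_diff_left inner01_smult_left)
  then show ?case using Suc.prems(1)[of t] by (simp add: inner01_commute)
qed

lemma inner01_hbvm_proj_poly: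
  assumes "j < s"
  shows "inner01 (hbvm_proj_poly k s p) (legendre01 j) =
    gauss_quadrature k (\<lambda>y. poly (legendre01 j) y * poly p y)"
  using assms
  by (simp add: hbvm_proj_poly_def inner01_sum_left inner01_smult_left inner01_legendre01
      if_distrib cong: if_cong)

text \<open>The defect \<open>?r\<close> is orthogonal to P_j whenever j < s and n + j < 2k, because
  there the discrete coefficient is the exact one. If n < s, then \<open>?r\<close> has degree below
  s and is orthogonal to itself, hence zero. If n \<ge> s, then m < s, and every j \<le> m satisfies
  n + j \<le> n + m < 2s \<le> 2k.\<close>

lemma hbvm_proj_poly_defect_orthogonal:
  assumes "s \<le> k" "m + n < 2 * s"
  shows "inner01 (monom 1 m) (monom 1 n - hbvm_proj_poly k s (monom 1 n)) = 0"
proof -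
  let ?r = "monom 1 n - hbvm_proj_poly k s (monom 1 n)"
  have r: "inner01 ?r (legendre01 j) = 0" if "j < s" "n + j < 2 * k" for j
    unfolding inner01_diff_left inner01_hbvm_proj_poly[OF that(1)]
    using that gauss_quadrature_legendre01_exact[of "monom 1 n" j k]
    by (simp add: degree_monom_eq inner01_commute)
  show ?thesis
  proof (cases "n < s")
    case True
    have deg: "degree ?r \<le> n"
      using degree_hbvm_proj_poly_monom[OF assms(1), of n]
      by (intro order.trans[OF degree_diff_le_max]) (simp add: degree_monom_eq)
    have "inner01 ?r ?r = 0"
      by (rule inner01_eq_0_if_legendre01[of s], rule r)
        (use True assms deg in \<open>auto simp del: coeff_diff intro!: coeff_eq_0\<close>)
    then have "?r = 0" by (simp add: inner01_self_eq_0_iff)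
    then show ?thesis by (simp add: inner01_def)
  next
    case False
    have "inner01 ?r (monom 1 m) = 0"
      by (rule inner01_eq_0_if_legendre01[of "Suc m"]) (use False assms r in auto)
    then show ?thesis by (simp add: inner01_commute)
  qed
qed

section \<open>Sup-norm bounds for quadrature and projection; graded families\<close>

lemma poly_bounded_01: "\<exists>B\<ge>0. \<forall>x\<in>{0..1}. \<bar>poly p x\<bar> \<le> (B::real)"
proof -
  have "bounded (poly p ` {0..1})"
    by (intro compact_imp_bounded compact_continuous_image continuous_intros) auto
  then obtain B where "\<forall>x\<in>{0..1}. \<bar>poly p x\<bar> \<le> B" by (auto simp: bounded_iff)
  then show ?thesis by (intro exI[of _ "\<bar>B\<bar>"]) fastforce
qed

lemma gauss_quadrature_mult_bound:
  "\<exists>C\<ge>0. \<forall>F B. (\<forall>x\<in>{0..1}. \<bar>F x\<bar> \<le> B) \<longrightarrow>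
     \<bar>gauss_quadrature k (\<lambda>x. poly p x * F x)\<bar> \<le> C * B"
proof (intro exI conjI allI impI)
  let ?C = "\<Sum>l=1..k. \<bar>gauss_weight k l * poly p (gauss_node k l)\<bar>"
  show "0 \<le> ?C" by (intro sum_nonneg) auto
  fix F :: "real \<Rightarrow> real" and B assume F: "\<forall>x\<in>{0..1}. \<bar>F x\<bar> \<le> B"
  show "\<bar>gauss_quadrature k (\<lambda>x. poly p x * F x)\<bar> \<le> ?C * B"
    unfolding gauss_quadrature_def sum_distrib_right
  proof (intro order.trans[OF sum_abs] sum_mono)
    fix l assume "l \<in> {1..k}"
    then have "\<bar>F (gauss_node k l)\<bar> \<le> B" using F gauss_node_bounds[of l k] by auto
    then have "\<bar>gauss_weight k l * poly p (gauss_node k l)\<bar> * \<bar>F (gauss_node k l)\<bar>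
        \<le> \<bar>gauss_weight k l * poly p (gauss_node k l)\<bar> * B"
      by (intro mult_left_mono) auto
    then show "\<bar>gauss_weight k l * (poly p (gauss_node k l) * F (gauss_node k l))\<bar>
        \<le> \<bar>gauss_weight k l * poly p (gauss_node k l)\<bar> * B"
      by (simp add: abs_mult mult.assoc)
  qed
qed

lemma hbvm_proj_bound:
  "\<exists>C\<ge>0. \<forall>F B. (\<forall>x\<in>{0..1}. \<bar>F x\<bar> \<le> B) \<longrightarrow> (\<forall>x\<in>{0..1}. \<bar>hbvm_proj k s F x\<bar> \<le> C * B)"
proof -
  have "\<forall>j. \<exists>B\<ge>0. \<forall>x\<in>{0..1}. \<bar>poly (legendre01 j) x\<bar> \<le> B"
    using poly_bounded_01 by blast
  then obtain b where b: "\<And>j. b j \<ge> 0" "\<And>j. \<forall>x\<in>{0..1}. \<bar>poly (legendre01 j) x\<bar> \<le> b j"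
    by metis
  have "\<forall>j. \<exists>C\<ge>0. \<forall>F B. (\<forall>x\<in>{0..1}. \<bar>F x\<bar> \<le> B) \<longrightarrow>
     \<bar>gauss_quadrature k (\<lambda>x. poly (legendre01 j) x * F x)\<bar> \<le> C * B"
    using gauss_quadrature_mult_bound by blast
  then obtain C where C: "\<And>j. C j \<ge> 0" "\<And>j F B. (\<forall>x\<in>{0..1}. \<bar>F x\<bar> \<le> B) \<Longrightarrow>
     \<bar>gauss_quadrature k (\<lambda>x. poly (legendre01 j) x * F x)\<bar> \<le> C j * B"
    by metis
  show ?thesis
  proof (intro exI conjI allI impI ballI)
    show "(\<Sum>j<s. b j * C j) \<ge> 0" using b C by (intro sum_nonneg mult_nonneg_nonneg) auto
    fix F :: "real \<Rightarrow> real" and B x :: real assume F: "\<forall>x\<in>{0..1}. \<bar>F x\<bar> \<le> B" and x: "x \<in> {0..1}"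
    show "\<bar>hbvm_proj k s F x\<bar> \<le> (\<Sum>j<s. b j * C j) * B"
      unfolding hbvm_proj_def sum_distrib_right mult.assoc
      using b x C(2)[OF F]
      by (intro order.trans[OF sum_abs] sum_mono) (auto simp: abs_mult intro!: mult_mono)
  qed
qed

text \<open>The polynomial may change with h; only \<open>K\<close> and \<open>D\<close> are
  uniform. The bounded degree keeps the number of terms in later sums independent of h, and
  coefficients of index beyond N are allowed, so products need no truncation.\<close>

definition graded :: "nat \<Rightarrow> (real \<Rightarrow> real \<Rightarrow> real) \<Rightarrow> bool" where
  "graded N F \<longleftrightarrow> (\<exists>K D. \<forall>\<^sub>F h in at_right 0. continuous_on {0..1} (F h) \<and>
     (\<exists>p. degree p \<le> D \<and> (\<forall>i. \<bar>coeff p i\<bar> \<le> K * h ^ i) \<and>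
        (\<forall>x\<in>{0..1}. \<bar>F h x - poly p x\<bar> \<le> K * h ^ N)))"

lemma poly_sum_le:
  fixes p :: "real poly"
  shows "degree p \<le> D \<Longrightarrow> poly p x = (\<Sum>i\<le>D. coeff p i * x ^ i)"
  unfolding poly_altdef by (rule sum.mono_neutral_left) (auto simp: coeff_eq_0)

lemma eventually_small: "\<forall>\<^sub>F h in at_right 0. 0 < h \<and> h < (1::real)"
  by (auto simp: eventually_at_right_field intro!: exI[of _ 1])

lemma gradedI:
  assumes "\<forall>\<^sub>F h in at_right 0. continuous_on {0..1} (F h) \<and>
     (\<exists>p. degree p \<le> D \<and> (\<forall>i. \<bar>coeff p i\<bar> \<le> K1 * h ^ i) \<and>
        (\<forall>x\<in>{0..1}. \<bar>F h x - poly p x\<bar> \<le> K2 * h ^ N))"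
  shows "graded N F"
  unfolding graded_def
proof (intro exI)
  show "\<forall>\<^sub>F h in at_right 0. continuous_on {0..1} (F h) \<and>
     (\<exists>p. degree p \<le> D \<and> (\<forall>i. \<bar>coeff p i\<bar> \<le> max K1 K2 * h ^ i) \<and>
        (\<forall>x\<in>{0..1}. \<bar>F h x - poly p x\<bar> \<le> max K1 K2 * h ^ N))"
    using assms eventually_small
  proof eventually_elim
    case (elim h)
    then obtain p where p: "degree p \<le> D" "\<forall>i. \<bar>coeff p i\<bar> \<le> K1 * h ^ i"
      "\<forall>x\<in>{0..1}. \<bar>F h x - poly p x\<bar> \<le> K2 * h ^ N" by blast
    have "K1 * h ^ i \<le> max K1 K2 * h ^ i" "K2 * h ^ i \<le> max K1 K2 * h ^ i" for i
      using elim by (auto intro!: mult_right_mono)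
    then show ?case using elim p by (meson order.trans)
  qed
qed

lemma gradedE:
  assumes "graded N F"
  obtains K D where "K \<ge> 0" "\<forall>\<^sub>F h in at_right 0. 0 < h \<and> h < 1 \<and> continuous_on {0..1} (F h) \<and>
     (\<exists>p. degree p \<le> D \<and> (\<forall>i. \<bar>coeff p i\<bar> \<le> K * h ^ i) \<and>
        (\<forall>x\<in>{0..1}. \<bar>F h x - poly p x\<bar> \<le> K * h ^ N))"
proof -
  obtain K D where *: "\<forall>\<^sub>F h in at_right 0. continuous_on {0..1} (F h) \<and>
     (\<exists>p. degree p \<le> D \<and> (\<forall>i. \<bar>coeff p i\<bar> \<le> K * h ^ i) \<and>
        (\<forall>x\<in>{0..1}. \<bar>F h x - poly p x\<bar> \<le> K * h ^ N))"
    using assms unfolding graded_def by blast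
  \<comment> \<open>Nonnegativity of \<open>K\<close> is hidden in the coefficient of index 0, whose
    bound is \<open>K * h ^ 0 = K\<close>; a single admissible h suffices to read it off.\<close>
  obtain h where "0 < h" "\<exists>p. \<forall>i. \<bar>coeff p i\<bar> \<le> K * h ^ i"
    using eventually_happens'[OF _ eventually_conj[OF * eventually_small]] by auto
  then obtain p where "\<bar>coeff p 0\<bar> \<le> K * h ^ 0" by blast
  then have "K \<ge> 0" by simp
  moreover have "\<forall>\<^sub>F h in at_right 0. 0 < h \<and> h < 1 \<and> continuous_on {0..1} (F h) \<and>
     (\<exists>p. degree p \<le> D \<and> (\<forall>i. \<bar>coeff p i\<bar> \<le> K * h ^ i) \<and>
        (\<forall>x\<in>{0..1}. \<bar>F h x - poly p x\<bar> \<le> K * h ^ N))"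
    using * eventually_small by eventually_elim auto
  ultimately show ?thesis using that by blast
qed

lemma graded_bounded:
  assumes "graded N F"
  shows "\<exists>B\<ge>0. \<forall>\<^sub>F h in at_right 0. \<forall>x\<in>{0..1}. \<bar>F h x\<bar> \<le> B"
proof -
  obtain K D where K: "K \<ge> 0" and ev: "\<forall>\<^sub>F h in at_right 0. 0 < h \<and> h < 1 \<and> continuous_on {0..1} (F h) \<and>
     (\<exists>p. degree p \<le> D \<and> (\<forall>i. \<bar>coeff p i\<bar> \<le> K * h ^ i) \<and>
        (\<forall>x\<in>{0..1}. \<bar>F h x - poly p x\<bar> \<le> K * h ^ N))"
    using gradedE[OF assms] by blast
  have "\<forall>\<^sub>F h in at_right 0. \<forall>x\<in>{0..1}. \<bar>F h x\<bar> \<le> (\<Sum>i\<le>D. K) + K"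
    using ev
  proof eventually_elim
    case (elim h)
    then obtain p where p: "degree p \<le> D" "\<And>i. \<bar>coeff p i\<bar> \<le> K * h ^ i"
      "\<And>x. x\<in>{0..1} \<Longrightarrow> \<bar>F h x - poly p x\<bar> \<le> K * h ^ N" by blast
    have le: "K * h ^ i \<le> K" for i
      using elim K by (intro mult_left_le power_le_one) auto
    show ?case
    proof
      fix x :: real assume x: "x \<in> {0..1}"
      have "\<bar>poly p x\<bar> \<le> (\<Sum>i\<le>D. K)"
        unfolding poly_sum_le[OF p(1)]
      proof (intro order.trans[OF sum_abs] sum_mono)
        fix i
        have "\<bar>coeff p i\<bar> * \<bar>x ^ i\<bar> \<le> K * 1"
          using p(2)[of i] le[of i] x K by (intro mult_mono) (auto simp: power_le_one)
        then show "\<bar>coeff p i * x ^ i\<bar> \<le> K" by (simp add: abs_mult)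
      qed
      then show "\<bar>F h x\<bar> \<le> (\<Sum>i\<le>D. K) + K"
        using p(3)[OF x] le[of N] by linarith
    qed
  qed
  then show ?thesis using K by (intro exI[of _ "(\<Sum>i\<le>D. K) + K"]) (auto intro!: sum_nonneg add_nonneg_nonneg)
qed

section \<open>Closure properties of graded families\<close>

lemma graded_cong:
  assumes "graded N F" "\<forall>\<^sub>F h in at_right 0. \<forall>x\<in>{0..1}. G h x = F h x"
  shows "graded N G"
proof -
  from gradedE[OF assms(1)] obtain K D where ev: "\<forall>\<^sub>F h in at_right 0. 0 < h \<and> h < 1 \<and> continuous_on {0..1} (F h) \<and>
     (\<exists>p. degree p \<le> D \<and> (\<forall>i. \<bar>coeff p i\<bar> \<le> K * h ^ i) \<and>
        (\<forall>x\<in>{0..1}. \<bar>F h x - poly p x\<bar> \<le> K * h ^ N))" by blast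
  show ?thesis
  proof (rule gradedI[of _ D K K], use ev assms(2) in eventually_elim)
    case (elim h)
    moreover have "continuous_on {0..1} (G h)"
      using elim continuous_on_cong[of "{0..1}" "{0..1}" "G h" "F h"] by auto
    ultimately show ?case by auto
  qed
qed

text \<open>For N = 0 the remainder may be a mere constant, so the zero polynomial approximates any
  bounded family. This is the start of the bootstrapping.\<close>

lemma graded_0I:
  assumes "\<forall>\<^sub>F h in at_right 0. continuous_on {0..1} (F h) \<and> (\<forall>x\<in>{0..1}. \<bar>F h x\<bar> \<le> B)"
  shows "graded 0 F"
  by (rule gradedI[of _ 0 0 B], use assms in eventually_elim) (auto intro!: exI[of _ 0])

lemma graded_poly:
  assumes "\<forall>\<^sub>F h in at_right 0. \<forall>i. \<bar>coeff (p h) i\<bar> \<le> K * h ^ i"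
    and "\<forall>\<^sub>F h in at_right 0. degree (p h) \<le> D"
  shows "graded N (\<lambda>h. poly (p h))"
  by (rule gradedI[of _ D K 0], use assms in eventually_elim)
    (auto intro!: continuous_intros)

lemma graded_const: "graded N (\<lambda>h x. a)"
proof -
  have "graded N (\<lambda>h. poly [:a:])"
    by (rule graded_poly[of _ "\<bar>a\<bar>" 0])
      (use eventually_small in eventually_elim, auto simp: coeff_pCons split: nat.splits)
  then show ?thesis by (rule graded_cong) simp
qed

text \<open>The argument of the Lie series at parameter c. As the polynomial h - h c it is graded
  because the constant coefficient only has to be bounded.\<close>

lemma graded_remaining_time: "graded N (\<lambda>h x. h * (1 - x))"
proof -
  have "graded N (\<lambda>h. poly [:h, -h:])"
    by (rule graded_poly[of _ "1" 1])
      (use eventually_small in eventually_elim, auto simp: coeff_pCons split: nat.splits)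
  then show ?thesis by (rule graded_cong) (simp add: algebra_simps)
qed

lemma graded_add:
  assumes "graded N F" "graded N G"
  shows "graded N (\<lambda>h x. F h x + G h x)"
proof -
  obtain K1 D1 where F: "\<forall>\<^sub>F h in at_right 0. 0 < h \<and> h < 1 \<and> continuous_on {0..1} (F h) \<and>
     (\<exists>p. degree p \<le> D1 \<and> (\<forall>i. \<bar>coeff p i\<bar> \<le> K1 * h ^ i) \<and>
        (\<forall>x\<in>{0..1}. \<bar>F h x - poly p x\<bar> \<le> K1 * h ^ N))" using gradedE[OF assms(1)] by blast
  obtain K2 D2 where G: "\<forall>\<^sub>F h in at_right 0. 0 < h \<and> h < 1 \<and> continuous_on {0..1} (G h) \<and>
     (\<exists>p. degree p \<le> D2 \<and> (\<forall>i. \<bar>coeff p i\<bar> \<le> K2 * h ^ i) \<and>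
        (\<forall>x\<in>{0..1}. \<bar>G h x - poly p x\<bar> \<le> K2 * h ^ N))" using gradedE[OF assms(2)] by blast
  show ?thesis
  proof (rule gradedI[of _ "max D1 D2" "K1 + K2" "K1 + K2"], use F G in eventually_elim)
    case (elim h)
    then obtain p q where p: "degree p \<le> D1" "\<And>i. \<bar>coeff p i\<bar> \<le> K1 * h ^ i"
      "\<And>x. x\<in>{0..1} \<Longrightarrow> \<bar>F h x - poly p x\<bar> \<le> K1 * h ^ N"
      and q: "degree q \<le> D2" "\<And>i. \<bar>coeff q i\<bar> \<le> K2 * h ^ i"
      "\<And>x. x\<in>{0..1} \<Longrightarrow> \<bar>G h x - poly q x\<bar> \<le> K2 * h ^ N" by metis
    show ?case
    proof (intro conjI exI[of _ "p + q"] allI ballI)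
      show "continuous_on {0..1} (\<lambda>x. F h x + G h x)"
        using elim by (auto intro!: continuous_intros)
      show "degree (p + q) \<le> max D1 D2"
        using p q by (intro order.trans[OF degree_add_le_max]) auto
      show "\<bar>coeff (p + q) i\<bar> \<le> (K1 + K2) * h ^ i" for i
        using p(2)[of i] q(2)[of i] by (simp add: distrib_right)
      show "\<bar>F h x + G h x - poly (p + q) x\<bar> \<le> (K1 + K2) * h ^ N" if "x \<in> {0..1}" for x
        using p(3)[OF that] q(3)[OF that] by (simp add: distrib_right)
    qed
  qed
qed

lemma graded_sum:
  assumes "\<And>i. i \<in> I \<Longrightarrow> graded N (F i)"
  shows "graded N (\<lambda>h x. \<Sum>i\<in>I. F i h x)"
  using assms by (induction I rule: infinite_finite_induct) (auto intro: graded_const graded_add)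

lemma graded_mult:
  assumes "graded N F" "graded N G"
  shows "graded N (\<lambda>h x. F h x * G h x)"
proof -
  obtain K1 D1 where K1: "K1 \<ge> 0" and F: "\<forall>\<^sub>F h in at_right 0. 0 < h \<and> h < 1 \<and> continuous_on {0..1} (F h) \<and>
     (\<exists>p. degree p \<le> D1 \<and> (\<forall>i. \<bar>coeff p i\<bar> \<le> K1 * h ^ i) \<and>
        (\<forall>x\<in>{0..1}. \<bar>F h x - poly p x\<bar> \<le> K1 * h ^ N))" using gradedE[OF assms(1)] by blast
  obtain K2 D2 where K2: "K2 \<ge> 0" and G: "\<forall>\<^sub>F h in at_right 0. 0 < h \<and> h < 1 \<and> continuous_on {0..1} (G h) \<and>
     (\<exists>p. degree p \<le> D2 \<and> (\<forall>i. \<bar>coeff p i\<bar> \<le> K2 * h ^ i) \<and>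
        (\<forall>x\<in>{0..1}. \<bar>G h x - poly p x\<bar> \<le> K2 * h ^ N))" using gradedE[OF assms(2)] by blast
  obtain B where B: "B \<ge> 0" "\<forall>\<^sub>F h in at_right 0. \<forall>x\<in>{0..1}. \<bar>F h x\<bar> \<le> B"
    using graded_bounded[OF assms(1)] by blast
  obtain C where C: "C \<ge> 0" "\<forall>\<^sub>F h in at_right 0. \<forall>x\<in>{0..1}. \<bar>G h x\<bar> \<le> C"
    using graded_bounded[OF assms(2)] by blast
  show ?thesis
  \<comment> \<open>A coefficient of \<open>p * q\<close> of index i \<le> D1 + D2 is a sum of i + 1
    products, each at most \<open>K1 * K2 * h ^ i\<close>. The second constant comes from F G - p q
    = F (G - q) + (F - p) q, with \<open>B\<close> bounding F and \<open>C + K2\<close> bounding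
    q.\<close>
  proof (rule gradedI[of _ "D1 + D2" "(D1 + D2 + 1) * (K1 * K2)" "B * K2 + K1 * (C + K2)"],
      use F G B(2) C(2) in eventually_elim)
    case (elim h)
    then obtain p q where p: "degree p \<le> D1" "\<And>i. \<bar>coeff p i\<bar> \<le> K1 * h ^ i"
      "\<And>x. x\<in>{0..1} \<Longrightarrow> \<bar>F h x - poly p x\<bar> \<le> K1 * h ^ N"
      and q: "degree q \<le> D2" "\<And>i. \<bar>coeff q i\<bar> \<le> K2 * h ^ i"
      "\<And>x. x\<in>{0..1} \<Longrightarrow> \<bar>G h x - poly q x\<bar> \<le> K2 * h ^ N" by metis
    have h: "0 < h" "h < 1" using elim by auto
    have deg: "degree (p * q) \<le> D1 + D2"
      using p q by (intro order.trans[OF degree_mult_le]) auto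
    show ?case
    proof (intro conjI exI[of _ "p * q"] allI ballI)
      show "continuous_on {0..1} (\<lambda>x. F h x * G h x)"
        using elim by (auto intro!: continuous_intros)
      show "degree (p * q) \<le> D1 + D2" by fact
      show "\<bar>coeff (p * q) i\<bar> \<le> (D1 + D2 + 1) * (K1 * K2) * h ^ i" for i
      proof (cases "i \<le> D1 + D2")
        case True
        have "\<bar>coeff (p * q) i\<bar> \<le> (\<Sum>j\<le>i. K1 * K2 * h ^ i)"
          unfolding coeff_mult
        proof (intro order.trans[OF sum_abs] sum_mono)
          fix j assume "j \<in> {..i}"
          then have "h ^ i = h ^ j * h ^ (i - j)" by (simp flip: power_add)
          moreover have "\<bar>coeff p j\<bar> * \<bar>coeff q (i - j)\<bar> \<le> (K1 * h ^ j) * (K2 * h ^ (i - j))"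
            using p q h K1 by (intro mult_mono) auto
          ultimately show "\<bar>coeff p j * coeff q (i - j)\<bar> \<le> K1 * K2 * h ^ i"
            by (simp add: abs_mult mult_ac)
        qed
        also have "\<dots> = (i + 1) * (K1 * K2 * h ^ i)" by simp
        also have "\<dots> \<le> (D1 + D2 + 1) * (K1 * K2 * h ^ i)"
          using True K1 K2 h by (intro mult_right_mono) auto
        finally show ?thesis by (simp add: mult_ac)
      next
        case False
        then have "coeff (p * q) i = 0" using deg by (intro coeff_eq_0) auto
        then show ?thesis using K1 K2 h by auto
      qed
      fix x :: real assume x: "x \<in> {0..1}"
      have "\<bar>poly q x\<bar> \<le> \<bar>G h x\<bar> + K2 * h ^ N" using q(3)[OF x] by linarith
      also have "\<dots> \<le> C + K2"
        using elim x h K2 by (intro add_mono mult_left_le power_le_one) auto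
      finally have qb: "\<bar>poly q x\<bar> \<le> C + K2" .
      have "F h x * G h x - poly (p * q) x = F h x * (G h x - poly q x) + (F h x - poly p x) * poly q x"
        by (simp add: algebra_simps)
      also have "\<bar>\<dots>\<bar> \<le> B * (K2 * h ^ N) + (K1 * h ^ N) * (C + K2)"
        unfolding abs_mult[symmetric]
        by (intro order.trans[OF abs_triangle_ineq] add_mono, unfold abs_mult)
          (use elim x p(3)[OF x] q(3)[OF x] qb B(1) K1 h in \<open>auto intro!: mult_mono\<close>)
      finally show "\<bar>F h x * G h x - poly (p * q) x\<bar> \<le> (B * K2 + K1 * (C + K2)) * h ^ N"
        by (simp add: algebra_simps)
    qed
  qed
qed

lemma graded_power: "graded N F \<Longrightarrow> graded N (\<lambda>h x. F h x ^ n)"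
  by (induction n) (auto intro: graded_const graded_mult)

text \<open>The escape \<open>x < 0\<close> is there because {0..x} is then empty and its integral
  is 0, whatever the value of q.\<close>

lemma poly_antiderivative:
  fixes p :: "real poly"
  obtains q where "degree q \<le> Suc (degree p)" "\<And>i. coeff q (Suc i) = coeff p i / (i + 1)"
    "coeff q 0 = 0" "pderiv q = p" "\<And>x. poly q x = integral {0..x} (poly p) \<or> x < 0"
proof -
  define q where "q = (\<Sum>i\<le>degree p. monom (coeff p i / (i + 1)) (Suc i))"
  have c: "coeff q (Suc i) = coeff p i / (i + 1)" for i
    by (auto simp: q_def coeff_sum coeff_eq_0)
  have c0: "coeff q 0 = 0" by (simp add: q_def coeff_sum)
  have d: "pderiv q = p"
    by (rule poly_eqI) (simp add: coeff_pderiv c)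
  have "degree q \<le> Suc (degree p)"
    unfolding q_def by (intro degree_sum_le order.trans[OF degree_monom_le]) auto
  moreover have "poly q x = integral {0..x} (poly p) \<or> x < 0" for x
  proof -
    have "(poly p has_integral (poly q x - poly q 0)) {0..x}" if "0 \<le> x"
      using that poly_DERIV[of q, unfolded d]
      by (intro fundamental_theorem_of_calculus)
        (auto simp flip: has_real_derivative_iff_has_vector_derivative
          intro: has_field_derivative_at_within)
    then show ?thesis using c0 by (force simp: poly_0_coeff_0 dest: integral_unique)
  qed
  ultimately show ?thesis using that c c0 d by blast
qed

text \<open>The coefficient of c^i moves to c^(i+1) and picks up the factor h that the higher power
  demands, while the division by i + 1 only helps. The remainder also gains h, hence the order
  \<open>Suc N\<close>.\<close>

lemma graded_integral:
  assumes "graded N F"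
  shows "graded (Suc N) (\<lambda>h x. h * integral {0..x} (F h))"
proof -
  obtain K D where K: "K \<ge> 0" and F: "\<forall>\<^sub>F h in at_right 0. 0 < h \<and> h < 1 \<and> continuous_on {0..1} (F h) \<and>
     (\<exists>p. degree p \<le> D \<and> (\<forall>i. \<bar>coeff p i\<bar> \<le> K * h ^ i) \<and>
        (\<forall>x\<in>{0..1}. \<bar>F h x - poly p x\<bar> \<le> K * h ^ N))" using gradedE[OF assms(1)] by blast
  show ?thesis
  proof (rule gradedI[of _ "Suc D" K K], use F in eventually_elim)
    case (elim h)
    then obtain p where p: "degree p \<le> D" "\<And>i. \<bar>coeff p i\<bar> \<le> K * h ^ i"
      "\<And>x. x\<in>{0..1} \<Longrightarrow> \<bar>F h x - poly p x\<bar> \<le> K * h ^ N" by metis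
    have h: "0 < h" "h < 1" and cont: "continuous_on {0..1} (F h)" using elim by auto
    obtain q where q: "degree q \<le> Suc (degree p)" "\<And>i. coeff q (Suc i) = coeff p i / (i + 1)"
      "coeff q 0 = 0" "\<And>x. poly q x = integral {0..x} (poly p) \<or> x < 0"
      using poly_antiderivative[of p] by metis
    show ?case
    proof (intro conjI exI[of _ "smult h q"] allI ballI)
      show "continuous_on {0..1} (\<lambda>x. h * integral {0..x} (F h))"
        by (intro continuous_intros indefinite_integral_continuous_1 integrable_continuous_real cont)
      show "degree (smult h q) \<le> Suc D" using q p by (intro order.trans[OF degree_smult_le]) simp
      show "\<bar>coeff (smult h q) i\<bar> \<le> K * h ^ i" for i
      proof (cases i)
        case 0
        then show ?thesis using q K by simp
      next
        case (Suc j)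
        have "\<bar>coeff p j\<bar> / (j + 1) \<le> \<bar>coeff p j\<bar> / 1" by (intro divide_left_mono) auto
        also have "\<dots> = \<bar>coeff p j\<bar>" by simp
        also have "\<dots> \<le> K * h ^ j" by (rule p)
        finally have "h * (\<bar>coeff p j\<bar> / (j + 1)) \<le> h * (K * h ^ j)"
          using h by (intro mult_left_mono) auto
        then show ?thesis using Suc q h by (simp add: abs_mult mult_ac)
      qed
      fix x :: real assume x: "x \<in> {0..1}"
      have i1: "F h integrable_on {0..x}" "poly p integrable_on {0..x}"
        using x by (auto intro!: integrable_continuous_real continuous_intros continuous_on_subset[OF cont])
      have "norm (integral {0..x} (\<lambda>t. F h t - poly p t)) \<le> (K * h ^ N) * (x - 0)"
        using x i1 p(3) by (intro integral_bound)
          (auto intro!: continuous_intros continuous_on_subset[OF cont])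
      also have "\<dots> \<le> K * h ^ N" using x K h by (intro mult_left_le) auto
      finally have "h * \<bar>integral {0..x} (F h) - integral {0..x} (poly p)\<bar> \<le> h * (K * h ^ N)"
        using h by (intro mult_left_mono) (auto simp: integral_diff[OF i1])
      then have "\<bar>h * (integral {0..x} (F h) - integral {0..x} (poly p))\<bar> \<le> h * (K * h ^ N)"
        using h by (simp add: abs_mult)
      then show "\<bar>h * integral {0..x} (F h) - poly (smult h q) x\<bar> \<le> K * h ^ Suc N"
        using q(4)[of x] x by (simp add: algebra_simps)
    qed
  qed
qed

text \<open>Projecting the approximating polynomial p term by term, c^i receives contributions only
  from c^n with n \<ge> i, as degrees do not grow, and there h^n \<le> h^i. The remainder stays of
  order N because the projection is bounded in the sup norm.\<close>

lemma graded_hbvm_proj: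
  assumes "graded N F" "s \<le> k"
  shows "graded N (\<lambda>h. hbvm_proj k s (F h))"
proof -
  obtain K D where K: "K \<ge> 0" and F: "\<forall>\<^sub>F h in at_right 0. 0 < h \<and> h < 1 \<and> continuous_on {0..1} (F h) \<and>
     (\<exists>p. degree p \<le> D \<and> (\<forall>i. \<bar>coeff p i\<bar> \<le> K * h ^ i) \<and>
        (\<forall>x\<in>{0..1}. \<bar>F h x - poly p x\<bar> \<le> K * h ^ N))" using gradedE[OF assms(1)] by blast
  obtain C where C: "C \<ge> 0" "\<And>F B x. (\<forall>x\<in>{0..1}. \<bar>F x\<bar> \<le> B) \<Longrightarrow> x\<in>{0..1} \<Longrightarrow> \<bar>hbvm_proj k s F x\<bar> \<le> C * B"
    using hbvm_proj_bound by metis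
  define R where "R n = hbvm_proj_poly k s (monom 1 n)" for n
  have dR: "degree (R n) \<le> n" for n
    unfolding R_def by (rule degree_hbvm_proj_poly_monom[OF assms(2)])
  define M where "M = (\<Sum>n\<le>D. \<Sum>i\<le>D. \<bar>coeff (R n) i\<bar>)"
  show ?thesis
  proof (rule gradedI[of _ D "K * M" "C * K"], use F in eventually_elim)
    case (elim h)
    then obtain p where p: "degree p \<le> D" "\<And>i. \<bar>coeff p i\<bar> \<le> K * h ^ i"
      "\<And>x. x\<in>{0..1} \<Longrightarrow> \<bar>F h x - poly p x\<bar> \<le> K * h ^ N" by metis
    have h: "0 < h" "h < 1" using elim by auto
    define q where "q = (\<Sum>n\<le>D. smult (coeff p n) (R n))"
    have dq: "degree q \<le> D"
      unfolding q_def
      by (intro degree_sum_le order.trans[OF degree_smult_le] order.trans[OF dR]) auto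
    have pq: "poly q x = hbvm_proj k s (poly p) x" for x
    proof -
      have "poly q x = (\<Sum>n\<le>D. coeff p n * hbvm_proj k s (\<lambda>y. y ^ n) x)"
        by (simp add: q_def R_def poly_sum poly_hbvm_proj_poly poly_monom[abs_def])
      also have "\<dots> = hbvm_proj k s (\<lambda>y. \<Sum>n\<le>D. coeff p n * y ^ n) x"
        by (simp add: hbvm_proj_sum hbvm_proj_cmult)
      finally show ?thesis by (simp add: poly_sum_le[OF p(1), abs_def])
    qed
    show ?case
    proof (intro conjI exI[of _ q] allI ballI)
      show "continuous_on {0..1} (hbvm_proj k s (F h))" by (rule continuous_on_hbvm_proj)
      show "degree q \<le> D" by fact
      show "\<bar>coeff q i\<bar> \<le> K * M * h ^ i" for i
      proof (cases "i \<le> D")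
        case True
        have "\<bar>coeff q i\<bar> \<le> (\<Sum>n\<le>D. K * h ^ i * \<bar>coeff (R n) i\<bar>)"
          unfolding q_def coeff_sum coeff_smult
        proof (intro order.trans[OF sum_abs] sum_mono)
          fix n
          show "\<bar>coeff p n * coeff (R n) i\<bar> \<le> K * h ^ i * \<bar>coeff (R n) i\<bar>"
          proof (cases "i \<le> n")
            case True
            then have "h ^ n \<le> h ^ i" using h by (intro power_decreasing) auto
            then have "\<bar>coeff p n\<bar> \<le> K * h ^ i"
              using p(2)[of n] K by (meson mult_left_mono order.trans)
            then show ?thesis unfolding abs_mult by (intro mult_right_mono) auto
          next
            case False
            then have "coeff (R n) i = 0" using dR[of n] by (intro coeff_eq_0) auto
            then show ?thesis by simp
          qed
        qed
        also have "\<dots> = K * h ^ i * (\<Sum>n\<le>D. \<bar>coeff (R n) i\<bar>)" by (simp add: sum_distrib_left)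
        also have "\<dots> \<le> K * h ^ i * M"
          unfolding M_def using True K h
          by (intro mult_left_mono sum_mono) (auto intro!: member_le_sum)
        finally show ?thesis by (simp add: mult_ac)
      next
        case False
        then have "coeff q i = 0" using dq by (intro coeff_eq_0) auto
        moreover have "M \<ge> 0" unfolding M_def by (intro sum_nonneg) auto
        ultimately show ?thesis using K h by simp
      qed
      fix x :: real assume x: "x \<in> {0..1}"
      have "hbvm_proj k s (F h) x = hbvm_proj k s (\<lambda>y. (F h y - poly p y) + poly p y) x" by simp
      also have "\<dots> = hbvm_proj k s (\<lambda>y. F h y - poly p y) x + poly q x"
        unfolding hbvm_proj_add pq ..
      finally have "\<bar>hbvm_proj k s (F h) x - poly q x\<bar> = \<bar>hbvm_proj k s (\<lambda>y. F h y - poly p y) x\<bar>" by simp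
      also have "\<dots> \<le> C * (K * h ^ N)" using p(3) x by (intro C) auto
      finally show "\<bar>hbvm_proj k s (F h) x - poly q x\<bar> \<le> C * K * h ^ N" by simp
    qed
  qed
qed

section \<open>Bilinear forms on graded families\<close>

text \<open>With approximants p and q, \<Phi>(F,G) = \<Phi>(p,q) + \<Phi>(p, G - q) + \<Phi>(F - p,
  G). The last two terms carry a remainder h^N. In the first, the pair (c^i, c^j) either vanishes or
  has coefficients of size h^(i+j) with i + j \<ge> M. Bilinearity and bound are demanded for
  continuous functions only, since the forms in use contain integrals.\<close>

lemma graded_bilinear:
  fixes \<Phi> :: "(real \<Rightarrow> real) \<Rightarrow> (real \<Rightarrow> real) \<Rightarrow> real"
  defines "cont \<equiv> continuous_on {0..1::real}"
  assumes add_left: "\<And>F1 F2 G. cont F1 \<Longrightarrow> cont F2 \<Longrightarrow> cont G \<Longrightarrow>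
      \<Phi> (\<lambda>x. F1 x + F2 x) G = \<Phi> F1 G + \<Phi> F2 G"
    and cmult_left: "\<And>a F G. cont F \<Longrightarrow> cont G \<Longrightarrow> \<Phi> (\<lambda>x. a * F x) G = a * \<Phi> F G"
    and add_right: "\<And>F G1 G2. cont F \<Longrightarrow> cont G1 \<Longrightarrow> cont G2 \<Longrightarrow>
      \<Phi> F (\<lambda>x. G1 x + G2 x) = \<Phi> F G1 + \<Phi> F G2"
    and cmult_right: "\<And>a F G. cont F \<Longrightarrow> cont G \<Longrightarrow> \<Phi> F (\<lambda>x. a * G x) = a * \<Phi> F G"
    and bound: "\<And>F G A B. cont F \<Longrightarrow> cont G \<Longrightarrow> \<forall>x\<in>{0..1}. \<bar>F x\<bar> \<le> A \<Longrightarrow>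
      \<forall>x\<in>{0..1}. \<bar>G x\<bar> \<le> B \<Longrightarrow> \<bar>\<Phi> F G\<bar> \<le> C * A * B"
    and C: "C \<ge> 0"
    and monomials: "\<And>m n. m + n < M \<Longrightarrow> \<Phi> (\<lambda>x. x ^ m) (\<lambda>x. x ^ n) = 0"
    and FG: "graded N F" "graded N G" and N: "M \<le> N"
  shows "\<exists>K. \<forall>\<^sub>F h in at_right 0. \<bar>\<Phi> (F h) (G h)\<bar> \<le> K * h ^ M"
proof -
  have cont_poly: "cont (poly p)" and cont_power: "cont (\<lambda>x. x ^ n)"
    and cont_0: "cont (\<lambda>x. 0)" for p n
    unfolding cont_def by (intro continuous_intros)+
  have cont_sum: "cont (\<lambda>x. \<Sum>i\<in>I. a i * x ^ i)" for a :: "nat \<Rightarrow> real" and I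
    unfolding cont_def by (intro continuous_intros)
  have cont_term: "cont (\<lambda>x. a * x ^ i)" for a :: real and i
    unfolding cont_def by (intro continuous_intros)
  have sum_left: "\<Phi> (\<lambda>x. \<Sum>i\<in>I. a i * x ^ i) G = (\<Sum>i\<in>I. a i * \<Phi> (\<lambda>x. x ^ i) G)"
    if "cont G" "finite I" for I a G
    using that(2)
  proof (induction I)
    case empty
    show ?case using cmult_left[OF cont_0 that(1), of 0] by simp
  next
    case (insert i I)
    then show ?case
      by (simp add: add_left[OF cont_term cont_sum that(1)] cmult_left[OF cont_power that(1)])
  qed
  have sum_right: "\<Phi> F (\<lambda>x. \<Sum>i\<in>I. a i * x ^ i) = (\<Sum>i\<in>I. a i * \<Phi> F (\<lambda>x. x ^ i))"
    if "cont F" "finite I" for I a F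
    using that(2)
  proof (induction I)
    case empty
    show ?case using cmult_right[OF that(1) cont_0, of 0] by simp
  next
    case (insert i I)
    then show ?case
      by (simp add: add_right[OF that(1) cont_term cont_sum] cmult_right[OF that(1) cont_power])
  qed
  obtain K1 D1 where K1: "K1 \<ge> 0" and F: "\<forall>\<^sub>F h in at_right 0. 0 < h \<and> h < 1 \<and> continuous_on {0..1} (F h) \<and>
     (\<exists>p. degree p \<le> D1 \<and> (\<forall>i. \<bar>coeff p i\<bar> \<le> K1 * h ^ i) \<and>
        (\<forall>x\<in>{0..1}. \<bar>F h x - poly p x\<bar> \<le> K1 * h ^ N))" using gradedE[OF FG(1)] by blast
  obtain K2 D2 where K2: "K2 \<ge> 0" and G: "\<forall>\<^sub>F h in at_right 0. 0 < h \<and> h < 1 \<and> continuous_on {0..1} (G h) \<and>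
     (\<exists>p. degree p \<le> D2 \<and> (\<forall>i. \<bar>coeff p i\<bar> \<le> K2 * h ^ i) \<and>
        (\<forall>x\<in>{0..1}. \<bar>G h x - poly p x\<bar> \<le> K2 * h ^ N))" using gradedE[OF FG(2)] by blast
  obtain B where B: "B \<ge> 0" "\<forall>\<^sub>F h in at_right 0. \<forall>x\<in>{0..1}. \<bar>F h x\<bar> \<le> B"
    using graded_bounded[OF FG(1)] by blast
  obtain B' where B': "B' \<ge> 0" "\<forall>\<^sub>F h in at_right 0. \<forall>x\<in>{0..1}. \<bar>G h x\<bar> \<le> B'"
    using graded_bounded[OF FG(2)] by blast
  \<comment> \<open>One summand per term of the splitting: (D1 + 1)(D2 + 1) pairs of monomials, then
    the two remainders, where \<open>B + K1\<close> bounds p and \<open>B'\<close> bounds G.\<close>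
  let ?K = "(D1 + 1) * ((D2 + 1) * (K1 * K2 * C)) + C * (B + K1) * K2 + C * K1 * B'"
  have "\<forall>\<^sub>F h in at_right 0. \<bar>\<Phi> (F h) (G h)\<bar> \<le> ?K * h ^ M"
    using F G B(2) B'(2)
  proof eventually_elim
    case (elim h)
    then obtain p q where p: "degree p \<le> D1" "\<And>i. \<bar>coeff p i\<bar> \<le> K1 * h ^ i"
      "\<And>x. x\<in>{0..1} \<Longrightarrow> \<bar>F h x - poly p x\<bar> \<le> K1 * h ^ N"
      and q: "degree q \<le> D2" "\<And>i. \<bar>coeff q i\<bar> \<le> K2 * h ^ i"
      "\<And>x. x\<in>{0..1} \<Longrightarrow> \<bar>G h x - poly q x\<bar> \<le> K2 * h ^ N" by metis
    have h: "0 < h" "h < 1" using elim by auto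
    have cF: "cont (F h)" and cG: "cont (G h)"
      and cFp: "cont (\<lambda>x. F h x - poly p x)" and cGq: "cont (\<lambda>x. G h x - poly q x)"
      using elim by (auto simp: cont_def intro!: continuous_intros)
    have pow: "h ^ i \<le> h ^ M" if "M \<le> i" for i
      using h that by (intro power_decreasing) auto
    have "\<Phi> (F h) (G h) = \<Phi> (\<lambda>x. poly p x + (F h x - poly p x)) (G h)" by simp
    also have "\<dots> = \<Phi> (poly p) (G h) + \<Phi> (\<lambda>x. F h x - poly p x) (G h)"
      by (rule add_left[OF cont_poly cFp cG])
    also have "\<Phi> (poly p) (G h) = \<Phi> (poly p) (\<lambda>x. poly q x + (G h x - poly q x))" by simp
    also have "\<dots> = \<Phi> (poly p) (poly q) + \<Phi> (poly p) (\<lambda>x. G h x - poly q x)"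
      by (rule add_right[OF cont_poly cont_poly cGq])
    finally have eq: "\<Phi> (F h) (G h) = \<Phi> (poly p) (poly q) + \<Phi> (poly p) (\<lambda>x. G h x - poly q x)
        + \<Phi> (\<lambda>x. F h x - poly p x) (G h)" .
    have "\<Phi> (poly p) (poly q) =
        (\<Sum>i\<le>D1. coeff p i * (\<Sum>j\<le>D2. coeff q j * \<Phi> (\<lambda>x. x ^ i) (\<lambda>x. x ^ j)))"
      unfolding poly_sum_le[OF p(1), abs_def] poly_sum_le[OF q(1), abs_def]
      by (simp add: sum_left[OF cont_sum] sum_right[OF cont_power])
    also have "\<bar>\<dots>\<bar> \<le> (\<Sum>i\<le>D1. \<Sum>j\<le>D2. K1 * K2 * C * h ^ M)"
      unfolding sum_distrib_left
    proof (intro order.trans[OF sum_abs] sum_mono)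
      fix i j
      show "\<bar>coeff p i * (coeff q j * \<Phi> (\<lambda>x. x ^ i) (\<lambda>x. x ^ j))\<bar> \<le> K1 * K2 * C * h ^ M"
      proof (cases "i + j < M")
        case True
        then show ?thesis using monomials K1 K2 C h by simp
      next
        case False
        have "\<bar>\<Phi> (\<lambda>x. x ^ i) (\<lambda>x. x ^ j)\<bar> \<le> C * 1 * 1"
          by (rule bound[OF cont_power cont_power]) (auto simp: power_le_one)
        then have "\<bar>coeff p i\<bar> * (\<bar>coeff q j\<bar> * \<bar>\<Phi> (\<lambda>x. x ^ i) (\<lambda>x. x ^ j)\<bar>)
            \<le> (K1 * h ^ i) * ((K2 * h ^ j) * C)"
          using p(2) q(2) K1 K2 C h by (intro mult_mono) auto
        also have "\<dots> = K1 * K2 * C * h ^ (i + j)" by (simp add: power_add mult_ac)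
        also have "\<dots> \<le> K1 * K2 * C * h ^ M"
          using False K1 K2 C by (intro mult_left_mono pow) auto
        finally show ?thesis by (simp add: abs_mult)
      qed
    qed
    finally have 1: "\<bar>\<Phi> (poly p) (poly q)\<bar> \<le> (D1 + 1) * ((D2 + 1) * (K1 * K2 * C)) * h ^ M" by (simp add: mult_ac)
    have "\<bar>poly p x\<bar> \<le> B + K1" if "x \<in> {0..1}" for x
    proof -
      have "K1 * h ^ N \<le> K1" using h K1 by (intro mult_left_le power_le_one) auto
      moreover have "\<bar>F h x\<bar> \<le> B" using elim that by blast
      ultimately show ?thesis using p(3)[OF that] by linarith
    qed
    then have "\<bar>\<Phi> (poly p) (\<lambda>x. G h x - poly q x)\<bar> \<le> C * (B + K1) * (K2 * h ^ N)"
      using q(3) by (intro bound[OF cont_poly cGq]) auto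
    also have "\<dots> \<le> C * (B + K1) * (K2 * h ^ M)"
      using C B(1) K1 K2 by (intro mult_left_mono pow N) auto
    finally have 2: "\<bar>\<Phi> (poly p) (\<lambda>x. G h x - poly q x)\<bar> \<le> C * (B + K1) * K2 * h ^ M"
      by (simp add: mult_ac)
    have "\<bar>\<Phi> (\<lambda>x. F h x - poly p x) (G h)\<bar> \<le> C * (K1 * h ^ N) * B'"
      using p(3) elim by (intro bound[OF cFp cG]) auto
    also have "\<dots> \<le> C * (K1 * h ^ M) * B'"
      using C B'(1) K1 by (intro mult_left_mono mult_right_mono pow N) auto
    finally have 3: "\<bar>\<Phi> (\<lambda>x. F h x - poly p x) (G h)\<bar> \<le> C * K1 * B' * h ^ M"
      by (simp add: mult_ac)
    show ?case using 1 2 3 unfolding eq by (simp add: distrib_right)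
  qed
  then show ?thesis by blast
qed

text \<open>What is left of the integral of \<open>hbvm_proj k s G\<close> times F once the sum over
  j of the products of the quadratures of P_j F and P_j G is removed. That sum is symmetric in F and
  G, so a skew matrix cancels it.\<close>

definition energy_form :: "nat \<Rightarrow> nat \<Rightarrow> (real \<Rightarrow> real) \<Rightarrow> (real \<Rightarrow> real) \<Rightarrow> real" where
  "energy_form k s F G =
     (\<Sum>j<s. (integral {0..1} (\<lambda>x. poly (legendre01 j) x * F x) -
               gauss_quadrature k (\<lambda>x. poly (legendre01 j) x * F x)) *
            gauss_quadrature k (\<lambda>x. poly (legendre01 j) x * G x))"

text \<open>Each j is handled alone. If n < j the second factor is zero, as j < s \<le> k. If j
  \<le> n then m + j \<le> m + n < 2k, so the quadrature of P_j c^m is exact and the first factor is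
  zero.\<close>

lemma energy_form_monomials:
  assumes "s \<le> k" "m + n < 2 * k"
  shows "energy_form k s (\<lambda>x. x ^ m) (\<lambda>x. x ^ n) = 0"
  unfolding energy_form_def
proof (intro sum.neutral ballI)
  fix j assume "j \<in> {..<s}"
  show "(integral {0..1} (\<lambda>x. poly (legendre01 j) x * x ^ m) -
       gauss_quadrature k (\<lambda>x. poly (legendre01 j) x * x ^ m)) *
      gauss_quadrature k (\<lambda>x. poly (legendre01 j) x * x ^ n) = 0"
  proof (cases "n < j")
    case True
    then show ?thesis
      using gauss_quadrature_legendre01_lower[of n j k] assms \<open>j \<in> {..<s}\<close> by simp
  next
    case False
    then show ?thesis
      using gauss_quadrature_legendre01_exact[of "monom 1 m" j k] assms
      by (simp add: inner01_def poly_monom degree_monom_eq)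
  qed
qed

lemma integral_mult_bound:
  assumes "continuous_on {0..1::real} F" "continuous_on {0..1} G"
    and "\<forall>x\<in>{0..1}. \<bar>F x\<bar> \<le> A" "\<forall>x\<in>{0..1}. \<bar>G x\<bar> \<le> B"
  shows "\<bar>integral {0..1} (\<lambda>x. F x * G x)\<bar> \<le> A * (B::real)"
proof -
  have "A \<ge> 0" using assms(3)[rule_format, of 0] by auto
  then have "norm (integral {0..1} (\<lambda>x. F x * G x)) \<le> (A * B) * (1 - 0)"
    using assms
    by (intro integral_bound) (auto intro!: continuous_intros mult_mono simp: abs_mult)
  then show ?thesis by simp
qed

lemma gauss_quadrature_legendre01_add:
  "gauss_quadrature k (\<lambda>x. poly (legendre01 j) x * (F x + G x)) =
   gauss_quadrature k (\<lambda>x. poly (legendre01 j) x * F x) +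
   gauss_quadrature k (\<lambda>x. poly (legendre01 j) x * G x)"
  by (simp add: distrib_left gauss_quadrature_add)

lemma gauss_quadrature_legendre01_cmult:
  "gauss_quadrature k (\<lambda>x. poly (legendre01 j) x * (a * F x)) =
   a * gauss_quadrature k (\<lambda>x. poly (legendre01 j) x * F x)"
  by (simp add: mult.left_commute[of _ a] gauss_quadrature_cmult)

lemma energy_form_bound:
  "\<exists>C\<ge>0. \<forall>F G A B. continuous_on {0..1} F \<longrightarrow> continuous_on {0..1} G \<longrightarrow>
     (\<forall>x\<in>{0..1}. \<bar>F x\<bar> \<le> A) \<longrightarrow> (\<forall>x\<in>{0..1}. \<bar>G x\<bar> \<le> B) \<longrightarrow>
     \<bar>energy_form k s F G\<bar> \<le> C * A * B"
proof -
  have "\<forall>j. \<exists>B\<ge>0. \<forall>x\<in>{0..1}. \<bar>poly (legendre01 j) x\<bar> \<le> B"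
    using poly_bounded_01 by blast
  then obtain b where b: "\<And>j. b j \<ge> 0" "\<And>j. \<forall>x\<in>{0..1}. \<bar>poly (legendre01 j) x\<bar> \<le> b j"
    by metis
  have "\<forall>j. \<exists>C\<ge>0. \<forall>F B. (\<forall>x\<in>{0..1}. \<bar>F x\<bar> \<le> B) \<longrightarrow>
     \<bar>gauss_quadrature k (\<lambda>x. poly (legendre01 j) x * F x)\<bar> \<le> C * B"
    using gauss_quadrature_mult_bound by blast
  then obtain C where C: "\<And>j. C j \<ge> 0" "\<And>j F B. (\<forall>x\<in>{0..1}. \<bar>F x\<bar> \<le> B) \<Longrightarrow>
     \<bar>gauss_quadrature k (\<lambda>x. poly (legendre01 j) x * F x)\<bar> \<le> C j * B"
    by metis
  show ?thesis
  proof (intro exI conjI allI impI)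
    show "(\<Sum>j<s. (b j + C j) * C j) \<ge> 0"
      using b C by (intro sum_nonneg mult_nonneg_nonneg add_nonneg_nonneg) auto
    fix F G :: "real \<Rightarrow> real" and A B :: real
    assume F: "continuous_on {0..1} F" and G: "continuous_on {0..1} G"
      and A: "\<forall>x\<in>{0..1}. \<bar>F x\<bar> \<le> A" and B: "\<forall>x\<in>{0..1}. \<bar>G x\<bar> \<le> B"
    have A0: "A \<ge> 0" using A[rule_format, of 0] by auto
    show "\<bar>energy_form k s F G\<bar> \<le> (\<Sum>j<s. (b j + C j) * C j) * A * B"
      unfolding energy_form_def sum_distrib_right
    proof (intro order.trans[OF sum_abs] sum_mono)
      fix j
      let ?I = "integral {0..1} (\<lambda>x. poly (legendre01 j) x * F x)"
      let ?Q = "\<lambda>F. gauss_quadrature k (\<lambda>x. poly (legendre01 j) x * F x)"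
      have "\<bar>?I\<bar> \<le> b j * A"
        by (intro integral_mult_bound F A b continuous_intros)
      then have "\<bar>?I - ?Q F\<bar> \<le> (b j + C j) * A"
        using C(2)[OF A, of j] by (simp add: distrib_right)
      then have "\<bar>?I - ?Q F\<bar> * \<bar>?Q G\<bar> \<le> ((b j + C j) * A) * (C j * B)"
        using C b A0 B by (intro mult_mono) auto
      then show "\<bar>(?I - ?Q F) * ?Q G\<bar> \<le> (b j + C j) * C j * A * B"
        by (simp add: abs_mult mult_ac)
    qed
  qed
qed

lemma energy_form_graded:
  assumes "s \<le> k" "graded (2 * k) F" "graded (2 * k) G"
  shows "\<exists>K. \<forall>\<^sub>F h in at_right 0. \<bar>energy_form k s (F h) (G h)\<bar> \<le> K * h ^ (2 * k)"
proof -
  obtain C where C: "C \<ge> 0" "\<And>F G A B. continuous_on {0..1} F \<Longrightarrow> continuous_on {0..1} G \<Longrightarrow>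
     \<forall>x\<in>{0..1}. \<bar>F x\<bar> \<le> A \<Longrightarrow> \<forall>x\<in>{0..1}. \<bar>G x\<bar> \<le> B \<Longrightarrow> \<bar>energy_form k s F G\<bar> \<le> C * A * B"
    using energy_form_bound[of k s] by blast
  have int: "(\<lambda>x. poly (legendre01 j) x * F x) integrable_on {0..1}"
    if "continuous_on {0..1} F" for j F
    by (intro integrable_continuous_real continuous_intros that)
  show ?thesis
  proof (rule graded_bilinear[of "energy_form k s" C, OF _ _ _ _ _ C(1) _ assms(2,3) order.refl])
    fix F1 F2 G :: "real \<Rightarrow> real" assume F: "continuous_on {0..1} F1" "continuous_on {0..1::real} F2"
    have "integral {0..1} (\<lambda>x. poly (legendre01 j) x * (F1 x + F2 x)) =
        integral {0..1} (\<lambda>x. poly (legendre01 j) x * F1 x) +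
        integral {0..1} (\<lambda>x. poly (legendre01 j) x * F2 x)" for j
      using F by (simp add: distrib_left integral_add int)
    then show "energy_form k s (\<lambda>x. F1 x + F2 x) G = energy_form k s F1 G + energy_form k s F2 G"
      unfolding energy_form_def gauss_quadrature_legendre01_add
      by (simp add: algebra_simps sum.distrib sum_subtractf)
  next
    fix a :: real and F G :: "real \<Rightarrow> real"
    have "integral {0..1} (\<lambda>x. poly (legendre01 j) x * (a * F x)) =
        a * integral {0..1} (\<lambda>x. poly (legendre01 j) x * F x)" for j
      by (simp add: mult.left_commute[of _ a])
    then show "energy_form k s (\<lambda>x. a * F x) G = a * energy_form k s F G"
      unfolding energy_form_def gauss_quadrature_legendre01_cmult
      by (simp add: sum_distrib_left algebra_simps)
  next
    fix F G1 G2 :: "real \<Rightarrow> real"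
    show "energy_form k s F (\<lambda>x. G1 x + G2 x) = energy_form k s F G1 + energy_form k s F G2"
      unfolding energy_form_def gauss_quadrature_legendre01_add
      by (simp add: distrib_left sum.distrib)
  next
    fix a :: real and F G :: "real \<Rightarrow> real"
    show "energy_form k s F (\<lambda>x. a * G x) = a * energy_form k s F G"
      unfolding energy_form_def gauss_quadrature_legendre01_cmult
      by (simp add: sum_distrib_left mult_ac)
  qed (use C(2) energy_form_monomials[OF assms(1)] in auto)
qed

lemma integral_mult_defect_graded:
  assumes "s \<le> k" "graded (2 * s) W" "graded (2 * s) F"
  shows "\<exists>K. \<forall>\<^sub>F h in at_right 0.
    \<bar>integral {0..1} (\<lambda>x. W h x * (F h x - hbvm_proj k s (F h) x))\<bar> \<le> K * h ^ (2 * s)"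
proof -
  obtain C where C: "C \<ge> 0"
    "\<And>F B x. (\<forall>x\<in>{0..1}. \<bar>F x\<bar> \<le> B) \<Longrightarrow> x\<in>{0..1} \<Longrightarrow> \<bar>hbvm_proj k s F x\<bar> \<le> C * B"
    using hbvm_proj_bound by metis
  let ?\<Phi> = "\<lambda>W F. integral {0..1} (\<lambda>x. W x * (F x - hbvm_proj k s F x))"
  have int: "(\<lambda>x. W x * (F x - hbvm_proj k s F x)) integrable_on {0..1}"
    if "continuous_on {0..1} W" "continuous_on {0..1} F" for W F
    by (intro integrable_continuous_real continuous_intros that continuous_on_hbvm_proj)
  show ?thesis
  proof (rule graded_bilinear[of ?\<Phi> "1 + C", OF _ _ _ _ _ _ _ assms(2,3) order.refl])
    fix F1 F2 G :: "real \<Rightarrow> real" assume "continuous_on {0..1} F1" "continuous_on {0..1} F2" "continuous_on {0..1} G"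
    then show "?\<Phi> (\<lambda>x. F1 x + F2 x) G = ?\<Phi> F1 G + ?\<Phi> F2 G"
      by (simp add: distrib_right integral_add int)
  next
    fix F G1 G2 :: "real \<Rightarrow> real" assume "continuous_on {0..1} F" "continuous_on {0..1} G1" "continuous_on {0..1} G2"
    then have "integral {0..1} (\<lambda>x. F x * (G1 x - hbvm_proj k s G1 x) + F x * (G2 x - hbvm_proj k s G2 x))
        = ?\<Phi> F G1 + ?\<Phi> F G2"
      by (intro integral_add int)
    then show "?\<Phi> F (\<lambda>x. G1 x + G2 x) = ?\<Phi> F G1 + ?\<Phi> F G2"
      by (simp add: hbvm_proj_add algebra_simps)
  next
    fix a :: real and F G :: "real \<Rightarrow> real"
    show "?\<Phi> (\<lambda>x. a * F x) G = a * ?\<Phi> F G"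
      by (simp add: mult.assoc)
  next
    fix a :: real and F G :: "real \<Rightarrow> real"
    have "(\<lambda>x. F x * (a * G x - a * hbvm_proj k s G x)) = (\<lambda>x. a * (F x * (G x - hbvm_proj k s G x)))"
      by (simp add: fun_eq_iff algebra_simps)
    then show "?\<Phi> F (\<lambda>x. a * G x) = a * ?\<Phi> F G"
      by (simp add: hbvm_proj_cmult)
  next
    fix F G :: "real \<Rightarrow> real" and A B :: real assume F: "continuous_on {0..1} F" and G: "continuous_on {0..1} G"
      and A: "\<forall>x\<in>{0..1}. \<bar>F x\<bar> \<le> A" and B: "\<forall>x\<in>{0..1}. \<bar>G x\<bar> \<le> (B::real)"
    have "\<forall>x\<in>{0..1}. \<bar>G x - hbvm_proj k s G x\<bar> \<le> (1 + C) * B"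
    proof
      fix x :: real assume "x \<in> {0..1}"
      then show "\<bar>G x - hbvm_proj k s G x\<bar> \<le> (1 + C) * B"
        using C(2)[OF B, of x] B[rule_format, of x] by (simp add: distrib_right)
    qed
    then have "\<bar>?\<Phi> F G\<bar> \<le> A * ((1 + C) * B)"
      by (intro integral_mult_bound F A continuous_intros G continuous_on_hbvm_proj)
    then show "\<bar>?\<Phi> F G\<bar> \<le> (1 + C) * A * B" by (simp add: mult_ac)
  next
    fix m n :: nat assume "m + n < 2 * s"
    from hbvm_proj_poly_defect_orthogonal[OF assms(1) this]
    show "?\<Phi> (\<lambda>x. x ^ m) (\<lambda>x. x ^ n) = 0"
      by (simp add: inner01_def poly_monom poly_hbvm_proj_poly poly_monom[abs_def])
  qed (use C in auto)
qed

section \<open>Gradients of real-analytic functions\<close>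

text \<open>The subtraction is truncated: for \<open>\<alpha> i = 0\<close> the exponent stays 0,
  and the factor \<open>real (\<alpha> i)\<close> makes the component vanish.\<close>

lemma GDERIV_monomial:
  fixes x :: "real^'n"
  shows "GDERIV (\<lambda>x. monomial x \<alpha>) x :> (\<chi> i. real (\<alpha> i) * monomial x (\<alpha>(i := \<alpha> i - 1)))"
proof -
  have "((\<lambda>x. \<Prod>i\<in>UNIV. (x $ i) ^ \<alpha> i) has_derivative
     (\<lambda>y. \<Sum>i\<in>UNIV. (real (\<alpha> i) * (y $ i) * (x $ i) ^ (\<alpha> i - 1)) * (\<Prod>j\<in>UNIV - {i}. (x $ j) ^ \<alpha> j))) (at x)"
    by (auto intro!: derivative_eq_intros bounded_linear_imp_has_derivative bounded_linear_vec_nth)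
  moreover have "monomial x (\<alpha>(i := \<alpha> i - 1)) = (x $ i) ^ (\<alpha> i - 1) * (\<Prod>j\<in>UNIV - {i}. (x $ j) ^ \<alpha> j)" for i
  proof -
    have "monomial x (\<alpha>(i := \<alpha> i - 1)) =
      (x $ i) ^ ((\<alpha>(i := \<alpha> i - 1)) i) * (\<Prod>j\<in>UNIV - {i}. (x $ j) ^ (\<alpha>(i := \<alpha> i - 1)) j)"
      unfolding monomial_def by (rule prod.remove) auto
    also have "(\<Prod>j\<in>UNIV - {i}. (x $ j) ^ (\<alpha>(i := \<alpha> i - 1)) j) = (\<Prod>j\<in>UNIV - {i}. (x $ j) ^ \<alpha> j)"
      by (rule prod.cong) auto
    finally show ?thesis by (simp only: fun_upd_same)
  qed
  ultimately show ?thesis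
    by (simp add: gderiv_def monomial_def[abs_def] inner_vec_def mult_ac)
qed

lemma sum_multi_index_decrement:
  fixes \<alpha> :: "'n::finite \<Rightarrow> nat"
  assumes "\<alpha> i > 0"
  shows "(\<Sum>j\<in>UNIV. (\<alpha>(i := \<alpha> i - 1)) j) = (\<Sum>j\<in>UNIV. \<alpha> j) - 1"
proof -
  have "(\<Sum>j\<in>UNIV. (\<alpha>(i := \<alpha> i - 1)) j) =
      (\<alpha>(i := \<alpha> i - 1)) i + (\<Sum>j\<in>UNIV - {i}. (\<alpha>(i := \<alpha> i - 1)) j)"
    by (rule sum.remove) auto
  also have "(\<Sum>j\<in>UNIV - {i}. (\<alpha>(i := \<alpha> i - 1)) j) = (\<Sum>j\<in>UNIV - {i}. \<alpha> j)"
    by (rule sum.cong) auto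
  also have "(\<alpha>(i := \<alpha> i - 1)) i + \<dots> = \<alpha> i + (\<Sum>j\<in>UNIV - {i}. \<alpha> j) - 1"
    using assms by simp
  also have "\<alpha> i + (\<Sum>j\<in>UNIV - {i}. \<alpha> j) = (\<Sum>j\<in>UNIV. \<alpha> j)"
    by (rule sum.remove[symmetric]) auto
  finally show ?thesis .
qed

lemma abs_monomial_le:
  fixes v :: "real^'n"
  assumes "norm v \<le> \<rho>"
  shows "\<bar>monomial v \<alpha>\<bar> \<le> \<rho> ^ (\<Sum>i\<in>UNIV. \<alpha> i)"
proof -
  have "\<bar>v $ i\<bar> \<le> \<rho>" for i using component_le_norm_cart[of v i] assms by linarith
  then have "(\<Prod>i\<in>UNIV. \<bar>v $ i\<bar> ^ \<alpha> i) \<le> (\<Prod>i\<in>UNIV. \<rho> ^ \<alpha> i)"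
    by (intro prod_mono) (auto intro: power_mono)
  then show ?thesis by (simp add: monomial_def abs_prod power_abs power_sum)
qed

lemma norm_vec_le_card:
  fixes v :: "real^'n" and b :: real
  assumes "\<And>i. \<bar>v $ i\<bar> \<le> b"
  shows "norm v \<le> CARD('n) * b"
  using norm_le_l1_cart[of v] sum_mono[of UNIV "\<lambda>i. \<bar>v $ i\<bar>" "\<lambda>_. b"] assms by simp

lemma GDERIV_unique: "GDERIV f x :> D \<Longrightarrow> GDERIV f x :> D' \<Longrightarrow> D = D'"
  unfolding gderiv_def using has_derivative_unique[of f]
  by (metis inner_eq_zero_iff inner_right_distrib inner_commute vector_eq_ldot)

lemma grad_eqI: "GDERIV f x :> D \<Longrightarrow> grad f x = D"
  unfolding grad_def using GDERIV_unique by (intro the_equality)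

text \<open>Together with countability this yields a bijection with \<open>nat\<close>, hence an
  enumeration of the monomials. The constant multi-indices already form an infinite family.\<close>

lemma infinite_multi_indices: "infinite (UNIV :: ('n \<Rightarrow> nat) set)"
proof -
  have "inj (\<lambda>k::nat. (\<lambda>_::'n. k))" by (auto simp: inj_on_def fun_eq_iff)
  then show ?thesis using finite_subset[OF subset_UNIV] range_inj_infinite by blast
qed

text \<open>On half the polyradius of absolute convergence the differentiated series is dominated by a
  multiple of the original one, as \<open>n \<le> 2 ^ n\<close>.\<close>

lemma power_series_has_gradient:
  fixes g :: "real^'n \<Rightarrow> real" and a :: "('n \<Rightarrow> nat) \<Rightarrow> real"
  assumes r: "r > 0" and g: "\<And>x. x \<in> ball x0 r \<Longrightarrow> ((\<lambda>\<alpha>. a \<alpha> * monomial (x - x0) \<alpha>) has_sum g x) UNIV"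
  shows "\<exists>\<rho>>0. \<forall>x\<in>ball x0 \<rho>. \<exists>D. GDERIV g x :> D \<and>
    (\<forall>i. ((\<lambda>\<alpha>. a \<alpha> * (real (\<alpha> i) * monomial (x - x0) (\<alpha>(i := \<alpha> i - 1)))) has_sum D $ i) UNIV)"
proof -
  \<comment> \<open>The vector with all entries \<sigma> has norm at most r / 2, so the series
    converges, hence converges absolutely, at that point. The radius \<rho> is half of this common
    polyradius.\<close>
  define \<sigma> where "\<sigma> = r / (2 * CARD('n))"
  define \<rho> where "\<rho> = \<sigma> / 2"
  have pos: "\<sigma> > 0" "\<rho> > 0" using r by (simp_all add: \<sigma>_def \<rho>_def)
  have "\<sigma> \<le> r / 2" unfolding \<sigma>_def using r by (intro divide_left_mono) auto
  then have sub: "ball x0 \<rho> \<subseteq> ball x0 r" using r pos unfolding \<rho>_def by (intro subset_ball) auto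
  define L where "L \<alpha> = (\<Sum>i\<in>UNIV. \<alpha> i)" for \<alpha> :: "'n \<Rightarrow> nat"
  define M where "M \<alpha> = \<bar>a \<alpha>\<bar> * \<sigma> ^ L \<alpha> / \<rho>" for \<alpha>
  have M: "M summable_on UNIV"
  proof -
    define v :: "real^'n" where "v = (\<chi> i. \<sigma>)"
    have "norm v \<le> CARD('n) * \<sigma>" by (rule norm_vec_le_card) (use pos in \<open>simp add: v_def\<close>)
    also have "\<dots> < r" using r by (simp add: \<sigma>_def)
    finally have "x0 + v \<in> ball x0 r" by (simp add: dist_norm)
    from g[OF this] have "(\<lambda>\<alpha>. a \<alpha> * monomial v \<alpha>) summable_on UNIV"
      by (auto simp: summable_on_def)
    then have "(\<lambda>\<alpha>. norm (a \<alpha> * monomial v \<alpha>)) summable_on UNIV"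
      by (rule summable_on_iff_abs_summable_on_real[THEN iffD1])
    moreover have "monomial v \<alpha> = \<sigma> ^ L \<alpha>" for \<alpha>
      by (simp add: monomial_def v_def L_def power_sum)
    ultimately have "(\<lambda>\<alpha>. \<bar>a \<alpha>\<bar> * \<sigma> ^ L \<alpha> * (1 / \<rho>)) summable_on UNIV"
      using pos by (intro summable_on_cmult_left) (simp add: abs_mult)
    then show ?thesis by (simp add: M_def[abs_def])
  qed
  define d where "d \<alpha> i x = a \<alpha> * (real (\<alpha> i) * monomial (x - x0) (\<alpha>(i := \<alpha> i - 1)))"
    for \<alpha> :: "'n \<Rightarrow> nat" and i x
  have d_le: "\<bar>d \<alpha> i x\<bar> \<le> M \<alpha>" if "x \<in> ball x0 \<rho>" for \<alpha> i x
  proof (cases "\<alpha> i = 0")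
    case True
    then show ?thesis using pos by (simp add: d_def M_def)
  next
    case False
    have "\<alpha> i \<le> L \<alpha>" unfolding L_def by (rule member_le_sum) auto
    then have L: "L \<alpha> = Suc (\<Sum>j\<in>UNIV. (\<alpha>(i := \<alpha> i - 1)) j)"
      using False by (subst sum_multi_index_decrement) (auto simp: L_def)
    have "real (\<alpha> i) \<le> 2 ^ L \<alpha>"
    proof -
      have "\<alpha> i \<le> L \<alpha>" unfolding L_def by (rule member_le_sum) auto
      also have "\<dots> < 2 ^ L \<alpha>" by (rule less_exp)
      finally show ?thesis by (metis of_nat_le_numeral_power_cancel_iff less_imp_le)
    qed
    moreover have "\<bar>monomial (x - x0) (\<alpha>(i := \<alpha> i - 1))\<bar> \<le> \<rho> ^ (L \<alpha> - 1)"
      using that abs_monomial_le[of "x - x0" \<rho> "\<alpha>(i := \<alpha> i - 1)"] L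
      by (simp add: dist_norm norm_minus_commute)
    ultimately have "real (\<alpha> i) * \<bar>monomial (x - x0) (\<alpha>(i := \<alpha> i - 1))\<bar> \<le> 2 ^ L \<alpha> * \<rho> ^ (L \<alpha> - 1)"
      by (intro mult_mono) auto
    \<comment> \<open>2^L (\<sigma>/2)^(L-1) = 2 \<sigma>^(L-1), and 2 = \<sigma>/\<rho>. This is
      the origin of the division by \<rho> in \<open>M\<close>.\<close>
    also have "\<dots> = \<sigma> ^ L \<alpha> / \<rho>"
      using pos unfolding L \<rho>_def by (simp only: diff_Suc_1 power_Suc power_divide) (simp add: field_simps)
    finally show ?thesis
      unfolding d_def M_def abs_mult times_divide_eq_right[symmetric]
      by (intro mult_left_mono) auto
  qed
  have norm_d_sum: "(\<lambda>\<alpha>. norm (d \<alpha> i x)) summable_on UNIV" if "x \<in> ball x0 \<rho>" for i x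
    by (rule Infinite_Sum.abs_summable_on_comparison_test'[OF M]) (unfold real_norm_def, rule d_le[OF that])
  have d_sum: "(\<lambda>\<alpha>. d \<alpha> i x) summable_on UNIV" if "x \<in> ball x0 \<rho>" for i x
    by (rule Infinite_Sum.abs_summable_summable[OF norm_d_sum[OF that]])
  define D where "D x = (\<chi> i. infsum (\<lambda>\<alpha>. d \<alpha> i x) UNIV)" for x
  have D: "((\<lambda>\<alpha>. d \<alpha> i x) has_sum D x $ i) UNIV" if "x \<in> ball x0 \<rho>" for i x
    unfolding D_def vec_lambda_beta using d_sum[OF that] by (rule has_sum_infsum)
  \<comment> \<open>Termwise differentiation is applied to a series indexed by \<open>nat\<close>.
    Absolute convergence makes the choice of enumeration harmless.\<close>
  obtain e :: "nat \<Rightarrow> ('n \<Rightarrow> nat)" where e: "bij e"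
    using bij_betw_from_nat_into[OF countableI_type infinite_multi_indices] by (rule that)
  have lim: "uniform_limit (ball x0 \<rho>) (\<lambda>n x. \<Sum>j<n. d (e j) i x) (\<lambda>x. D x $ i) sequentially" for i
  proof -
    have "uniform_limit (ball x0 \<rho>) (\<lambda>X x. \<Sum>j\<in>X. d (e j) i x) (\<lambda>x. D x $ i)
        (finite_subsets_at_top UNIV)"
    proof (rule Weierstrass_m_test_general')
      show "((\<lambda>j. d (e j) i x) has_sum D x $ i) UNIV" if "x \<in> ball x0 \<rho>" for x
        using D[OF that] has_sum_reindex_bij_betw[OF e, of "\<lambda>\<alpha>. d \<alpha> i x"] by simp
      show "(\<lambda>j. M (e j)) summable_on UNIV"
        using M summable_on_reindex_bij_betw[OF e, of M] by simp
    qed (use d_le in auto)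
    then show ?thesis by (rule filterlim_compose[OF _ filterlim_lessThan_at_top])
  qed
  define f where "f n x = a (e n) * monomial (x - x0) (e n)" for n x
  have f_sums: "(\<lambda>n. f n x) sums g x" if "x \<in> ball x0 \<rho>" for x
    unfolding f_def
    using g[of x] that sub has_sum_reindex_bij_betw[OF e, of "\<lambda>\<alpha>. a \<alpha> * monomial (x - x0) \<alpha>" "g x"]
    by (intro has_sum_imp_sums) blast
  have "\<exists>g'. \<forall>x\<in>ball x0 \<rho>. (\<lambda>n. f n x) sums g' x \<and>
      (g' has_derivative (\<lambda>h. h \<bullet> D x)) (at x within ball x0 \<rho>)"
  proof (rule has_derivative_series)
    fix n x
    let ?\<alpha> = "e n"
    have "((\<lambda>x. monomial (x - x0) ?\<alpha>) has_derivative
        (\<lambda>h. h \<bullet> (\<chi> i. real (?\<alpha> i) * monomial (x - x0) (?\<alpha>(i := ?\<alpha> i - 1))))) (at x)"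
      by (rule has_derivative_compose[OF _ GDERIV_monomial[unfolded gderiv_def]])
        (auto intro!: derivative_eq_intros)
    then have "(f n has_derivative
        (\<lambda>h. a ?\<alpha> * (h \<bullet> (\<chi> i. real (?\<alpha> i) * monomial (x - x0) (?\<alpha>(i := ?\<alpha> i - 1)))))) (at x)"
      unfolding f_def[abs_def] by (rule has_derivative_mult_right)
    moreover have "(\<lambda>h. a ?\<alpha> * (h \<bullet> (\<chi> i. real (?\<alpha> i) * monomial (x - x0) (?\<alpha>(i := ?\<alpha> i - 1)))))
        = (\<lambda>h. \<Sum>i\<in>UNIV. h $ i * d (e n) i x)"
      by (simp add: inner_vec_def d_def sum_distrib_left mult_ac)
    ultimately show "(f n has_derivative (\<lambda>h. \<Sum>i\<in>UNIV. h $ i * d (e n) i x)) (at x within ball x0 \<rho>)"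
      by (simp add: has_derivative_at_withinI)
  next
    fix \<epsilon> :: real assume \<epsilon>: "\<epsilon> > 0"
    \<comment> \<open>Each coordinate gets an equal share of \<epsilon>, because the bound |h $ i|
      \<le> norm h is summed over all coordinates.\<close>
    have "\<forall>i\<in>UNIV. \<forall>\<^sub>F n in sequentially. \<forall>x\<in>ball x0 \<rho>.
        dist (\<Sum>j<n. d (e j) i x) (D x $ i) < \<epsilon> / CARD('n)"
      using lim \<epsilon> by (auto simp: uniform_limit_iff)
    then have "\<forall>\<^sub>F n in sequentially. \<forall>i\<in>UNIV. \<forall>x\<in>ball x0 \<rho>.
        dist (\<Sum>j<n. d (e j) i x) (D x $ i) < \<epsilon> / CARD('n)"
      by (intro eventually_ball_finite) auto
    then show "\<forall>\<^sub>F n in sequentially. \<forall>x\<in>ball x0 \<rho>. \<forall>h.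
        norm ((\<Sum>j<n. \<Sum>i\<in>UNIV. h $ i * d (e j) i x) - h \<bullet> D x) \<le> \<epsilon> * norm h"
    proof (eventually_elim, intro ballI allI)
      fix n x and h :: "real^'n"
      assume elim: "\<forall>i\<in>UNIV. \<forall>x\<in>ball x0 \<rho>. dist (\<Sum>j<n. d (e j) i x) (D x $ i) < \<epsilon> / CARD('n)"
        and x: "x \<in> ball x0 \<rho>"
      have "(\<Sum>j<n. \<Sum>i\<in>UNIV. h $ i * d (e j) i x) - h \<bullet> D x =
          (\<Sum>i\<in>UNIV. h $ i * ((\<Sum>j<n. d (e j) i x) - D x $ i))"
        by (subst sum.swap) (simp add: inner_vec_def sum_distrib_left right_diff_distrib sum_subtractf)
      also have "norm \<dots> \<le> (\<Sum>i\<in>(UNIV::'n set). norm h * (\<epsilon> / CARD('n)))"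
        unfolding real_norm_def
      proof (intro order.trans[OF sum_abs] sum_mono)
        fix i
        have "\<bar>(\<Sum>j<n. d (e j) i x) - D x $ i\<bar> \<le> \<epsilon> / CARD('n)"
          using elim x by (simp add: dist_real_def less_imp_le)
        then show "\<bar>h $ i * ((\<Sum>j<n. d (e j) i x) - D x $ i)\<bar> \<le> norm h * (\<epsilon> / CARD('n))"
          unfolding abs_mult using component_le_norm_cart[of h i] by (intro mult_mono) auto
      qed
      also have "\<dots> = \<epsilon> * norm h" by simp
      finally show "norm ((\<Sum>j<n. \<Sum>i\<in>UNIV. h $ i * d (e j) i x) - h \<bullet> D x) \<le> \<epsilon> * norm h" .
    qed
  next
    show "x0 \<in> ball x0 \<rho>" using pos by simp
    then show "(\<lambda>n. f n x0) sums g x0" using f_sums by blast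
  qed simp
  then obtain g' where g': "\<And>x. x \<in> ball x0 \<rho> \<Longrightarrow> (\<lambda>n. f n x) sums g' x"
    "\<And>x. x \<in> ball x0 \<rho> \<Longrightarrow> (g' has_derivative (\<lambda>h. h \<bullet> D x)) (at x within ball x0 \<rho>)"
    by blast
  \<comment> \<open>The series theorem provides some limit function \<open>g'\<close>; uniqueness of
    sums identifies it with g on the ball, and openness turns the derivative within the ball into an
    unrestricted one.\<close>
  have "GDERIV g x :> D x" if x: "x \<in> ball x0 \<rho>" for x
  proof -
    have eq: "g' y = g y" if "y \<in> ball x0 \<rho>" for y
      using sums_unique2[OF g'(1) f_sums] that by blast
    have "(g' has_derivative (\<lambda>h. h \<bullet> D x)) (at x)"
      using g'(2)[OF x] x by (simp add: at_within_open[OF _ open_ball])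
    then show ?thesis
      unfolding gderiv_def
      by (rule has_derivative_transform_within_open[of g' _ x UNIV "ball x0 \<rho>"]) (use x eq in auto)
  qed
  then have "\<forall>x\<in>ball x0 \<rho>. GDERIV g x :> D x \<and> (\<forall>i. ((\<lambda>\<alpha>. d \<alpha> i x) has_sum D x $ i) UNIV)"
    using D by simp
  then show ?thesis using pos(2) unfolding d_def by meson
qed

lemma real_analytic_has_gradient:
  fixes g :: "real^'n \<Rightarrow> real"
  assumes "real_analytic g"
  shows "\<exists>D. (\<forall>x. GDERIV g x :> D x) \<and> (\<forall>i. real_analytic (\<lambda>x. D x $ i))"
proof -
  define t where "t a x0 i x \<alpha> = a \<alpha> * (real (\<alpha> i) * monomial (x - x0) (\<alpha>(i := \<alpha> i - 1)))"
    for a :: "('n \<Rightarrow> nat) \<Rightarrow> real" and x0 i x \<alpha>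
  have loc: "\<exists>\<rho> a. \<rho> > 0 \<and> (\<forall>x\<in>ball x0 \<rho>. \<exists>D. GDERIV g x :> D \<and>
    (\<forall>i. (t a x0 i x has_sum D $ i) UNIV))" for x0
  proof -
    obtain r a where r: "r > 0" "\<forall>x\<in>ball x0 r. ((\<lambda>\<alpha>. a \<alpha> * monomial (x - x0) \<alpha>) has_sum g x) UNIV"
      using assms unfolding real_analytic_def by blast
    have "\<exists>\<rho>>0. \<forall>x\<in>ball x0 \<rho>. \<exists>D. GDERIV g x :> D \<and> (\<forall>i. (t a x0 i x has_sum D $ i) UNIV)"
      unfolding t_def[abs_def] by (rule power_series_has_gradient[OF r(1)]) (use r(2) in blast)
    then show ?thesis by blast
  qed
  have GD: "GDERIV g x :> grad g x" for x
  proof -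
    obtain D where "GDERIV g x :> D" using loc[of x] centre_in_ball by blast
    then show ?thesis using grad_eqI[of g x D] by simp
  qed
  have "real_analytic (\<lambda>x. grad g x $ i)" for i
    unfolding real_analytic_def
  proof
    fix x0
    obtain \<rho> a where \<rho>: "\<rho> > 0" and a: "\<And>x. x\<in>ball x0 \<rho> \<Longrightarrow> \<exists>D. GDERIV g x :> D \<and>
      (\<forall>i. (t a x0 i x has_sum D $ i) UNIV)"
      using loc[of x0] by blast
    \<comment> \<open>The multi-index is shifted: the monomial \<beta> of the i-th partial
      derivative stems from \<beta> raised by one in position i, whose exponent there is the factor
      \<open>Suc (\<beta> i)\<close>. Multi-indices with \<open>\<alpha> i = 0\<close> contribute
      nothing and are dropped before reindexing.\<close>
    define b where "b \<beta> = a (\<beta>(i := Suc (\<beta> i))) * real (Suc (\<beta> i))" for \<beta>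
    have "((\<lambda>\<beta>. b \<beta> * monomial (x - x0) \<beta>) has_sum grad g x $ i) UNIV" if x: "x \<in> ball x0 \<rho>" for x
    proof -
      obtain D where D: "GDERIV g x :> D" "(t a x0 i x has_sum D $ i) UNIV"
        using a[OF x] by blast
      have "(t a x0 i x has_sum D $ i) UNIV \<longleftrightarrow> (t a x0 i x has_sum D $ i) {\<alpha>. \<alpha> i > 0}"
        by (rule has_sum_cong_neutral) (auto simp: t_def)
      also have "\<dots> \<longleftrightarrow> ((\<lambda>\<beta>. b \<beta> * monomial (x - x0) \<beta>) has_sum D $ i) UNIV"
        by (rule has_sum_reindex_bij_witness[of _ "\<lambda>\<beta>. \<beta>(i := Suc (\<beta> i))" "\<lambda>\<alpha>. \<alpha>(i := \<alpha> i - 1)"])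
          (auto simp: b_def t_def)
      finally show ?thesis using D grad_eqI[OF D(1)] by simp
    qed
    then show "\<exists>r>0. \<exists>a. \<forall>x\<in>ball x0 r.
        ((\<lambda>\<alpha>. a \<alpha> * monomial (x - x0) \<alpha>) has_sum grad g x $ i) UNIV"
      using \<rho> by blast
  qed
  then show ?thesis using GD by blast
qed

text \<open>The algebra generated by the real-analytic functions and the coordinates; it is closed under
  partial derivatives and spares us the Cauchy product of multivariate power series.\<close>

inductive smooth :: "(real^'n \<Rightarrow> real) \<Rightarrow> bool" where
  analytic: "real_analytic g \<Longrightarrow> smooth g"
| const: "smooth (\<lambda>x. c)"
| coordinate: "smooth (\<lambda>x. x $ i)"
| add: "smooth f \<Longrightarrow> smooth g \<Longrightarrow> smooth (\<lambda>x. f x + g x)"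
| mult: "smooth f \<Longrightarrow> smooth g \<Longrightarrow> smooth (\<lambda>x. f x * g x)"

lemma smooth_sum: "(\<And>i. i \<in> I \<Longrightarrow> smooth (f i)) \<Longrightarrow> smooth (\<lambda>x. \<Sum>i\<in>I. f i x)"
  by (induction I rule: infinite_finite_induct) (auto intro: smooth.intros)

lemma smooth_has_gradient:
  fixes g :: "real^'n \<Rightarrow> real"
  assumes "smooth g"
  shows "\<exists>D. (\<forall>x. GDERIV g x :> D x) \<and> (\<forall>i. smooth (\<lambda>x. D x $ i))"
  using assms
proof induction
  case (analytic g)
  then show ?case using real_analytic_has_gradient smooth.analytic by blast
next
  case (const c)
  show ?case by (intro exI[of _ "\<lambda>x. 0"]) (auto intro: GDERIV_const smooth.const)
next
  case (coordinate i)
  have "GDERIV (\<lambda>x. x $ i) x :> axis i 1" for x :: "real^'n"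
    by (simp add: gderiv_def inner_axis bounded_linear_imp_has_derivative bounded_linear_vec_nth)
  then show ?case by (intro exI[of _ "\<lambda>x. axis i 1"]) (auto intro: smooth.const)
next
  case (add f g)
  then obtain D E where "\<forall>x. GDERIV f x :> D x" "\<forall>i. smooth (\<lambda>x. D x $ i)"
    "\<forall>x. GDERIV g x :> E x" "\<forall>i. smooth (\<lambda>x. E x $ i)" by blast
  then show ?case
    by (intro exI[of _ "\<lambda>x. D x + E x"]) (auto intro: GDERIV_add smooth.add)
next
  case (mult f g)
  then obtain D E where "\<forall>x. GDERIV f x :> D x" "\<forall>i. smooth (\<lambda>x. D x $ i)"
    "\<forall>x. GDERIV g x :> E x" "\<forall>i. smooth (\<lambda>x. E x $ i)" by blast
  moreover from this mult.hyps have "smooth (\<lambda>x. f x * E x $ i + g x * D x $ i)" for i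
    by (intro smooth.add smooth.mult) auto
  ultimately show ?case
    by (intro exI[of _ "\<lambda>x. f x *\<^sub>R E x + g x *\<^sub>R D x"]) (auto intro: GDERIV_mult)
qed

lemma smooth_grad:
  assumes "smooth g"
  shows "GDERIV g x :> grad g x" "smooth (\<lambda>x. grad g x $ i)"
proof -
  obtain D where D: "\<forall>x. GDERIV g x :> D x" "\<forall>i. smooth (\<lambda>x. D x $ i)"
    using smooth_has_gradient[OF assms] by blast
  then have "grad g = D" by (auto intro: grad_eqI)
  then show "GDERIV g x :> grad g x" "smooth (\<lambda>x. grad g x $ i)" using D by auto
qed

lemma smooth_continuous_on: "smooth g \<Longrightarrow> continuous_on S g"
  using smooth_grad(1)[unfolded gderiv_def] has_derivative_continuous
  by (blast intro: continuous_at_imp_continuous_on)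

lemma smooth_lipschitz_on_compact_convex:
  assumes "smooth g" "compact S" "convex S"
  shows "\<exists>L\<ge>0. \<forall>x\<in>S. \<forall>y\<in>S. \<bar>g x - g y\<bar> \<le> L * dist x y"
proof -
  have "continuous_on S (grad g)"
    using continuous_on_vec_lambda[of S "\<lambda>i x. grad g x $ i"]
      smooth_continuous_on[OF smooth_grad(2)[OF assms(1)]] by simp
  then have "bounded (grad g ` S)"
    by (intro compact_imp_bounded compact_continuous_image assms)
  then obtain B where B: "B > 0" "\<forall>x\<in>S. norm (grad g x) \<le> B" by (auto simp: bounded_pos)
  have "norm (g x - g y) \<le> B * norm (x - y)" if "x \<in> S" "y \<in> S" for x y
  proof (rule differentiable_bound[OF assms(3) _ _ that])
    fix x assume "x \<in> S"
    show "(g has_derivative (\<lambda>h. h \<bullet> grad g x)) (at x within S)"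
      using smooth_grad(1)[OF assms(1)] by (simp add: gderiv_def has_derivative_at_withinI)
    show "onorm (\<lambda>h. h \<bullet> grad g x) \<le> B"
    proof (rule onorm_bound)
      fix h
      show "norm (h \<bullet> grad g x) \<le> B * norm h"
        using Cauchy_Schwarz_ineq2[of h "grad g x"] B(2) \<open>x \<in> S\<close>
        by (metis mult.commute mult_left_mono norm_ge_zero order.trans real_norm_def)
    qed (use B in simp)
  qed
  then show ?thesis using B by (intro exI[of _ B]) (auto simp: dist_norm)
qed

section \<open>Solvability of the method\<close>

lemma norm_sum_scaleR_le:
  fixes g :: "'i \<Rightarrow> 'a::real_normed_vector"
  assumes "\<And>l. l \<in> I \<Longrightarrow> norm (g l) \<le> B" "(\<Sum>l\<in>I. \<bar>\<kappa> l\<bar>) \<le> A" "B \<ge> 0"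
  shows "norm (\<Sum>l\<in>I. \<kappa> l *\<^sub>R g l) \<le> A * B"
proof -
  have "norm (\<Sum>l\<in>I. \<kappa> l *\<^sub>R g l) \<le> (\<Sum>l\<in>I. \<bar>\<kappa> l\<bar> * B)"
    using assms(1) by (intro order.trans[OF norm_sum] sum_mono) (simp add: mult_left_mono)
  also have "\<dots> = (\<Sum>l\<in>I. \<bar>\<kappa> l\<bar>) * B" by (simp add: sum_distrib_right)
  also have "\<dots> \<le> A * B" using assms by (intro mult_right_mono) auto
  finally show ?thesis .
qed

text \<open>The fixed point is sought among the continuous functions on \<open>[0,1]\<close>, extended constantly to
  the real line, so that the type of bounded continuous functions applies.\<close>

lemma stage_equations_solvable:
  fixes f :: "'a::euclidean_space \<Rightarrow> 'a" and \<kappa> :: "real \<Rightarrow> 'i \<Rightarrow> real" and c :: "'i \<Rightarrow> real"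
  assumes \<kappa>: "\<And>l. continuous_on {0..1} (\<lambda>t. \<kappa> t l)" and c: "\<And>l. l \<in> I \<Longrightarrow> c l \<in> {0..1}"
    and A: "\<And>t. t \<in> {0..1} \<Longrightarrow> (\<Sum>l\<in>I. \<bar>\<kappa> t l\<bar>) \<le> A" "A \<ge> 0"
    and L: "\<And>x y. x \<in> cball y0 \<rho> \<Longrightarrow> y \<in> cball y0 \<rho> \<Longrightarrow> dist (f x) (f y) \<le> L * dist x y" "L \<ge> 0"
    and B: "\<And>x. x \<in> cball y0 \<rho> \<Longrightarrow> norm (f x) \<le> B" "B \<ge> 0"
    and h: "h \<ge> 0" "h * (A * B) \<le> \<rho>" "h * (A * L) < 1"
  shows "\<exists>Y. \<forall>l\<in>I. Y l \<in> cball y0 \<rho> \<and> Y l = y0 + h *\<^sub>R (\<Sum>l'\<in>I. \<kappa> (c l) l' *\<^sub>R f (Y l'))"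
proof -
  have \<rho>: "\<rho> \<ge> 0" using order.trans[OF mult_nonneg_nonneg[OF h(1) mult_nonneg_nonneg[OF A(2) B(2)]] h(2)] .
  define cl where "cl t = max 0 (min 1 t)" for t :: real
  have cl: "cl t \<in> {0..1}" "t \<in> {0..1} \<Longrightarrow> cl t = t" for t by (auto simp: cl_def)
  have cont_cl: "continuous_on UNIV cl" unfolding cl_def by (intro continuous_intros)
  define F where "F Y t = y0 + h *\<^sub>R (\<Sum>l\<in>I. \<kappa> (cl t) l *\<^sub>R f (Y (c l)))"
    for Y :: "real \<Rightarrow> 'a" and t
  have F: "F Y \<in> bcontfun" for Y
  proof -
    let ?G = "\<lambda>t. y0 + h *\<^sub>R (\<Sum>l\<in>I. \<kappa> t l *\<^sub>R f (Y (c l)))"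
    have G: "continuous_on {0..1} ?G" by (intro continuous_intros \<kappa>)
    then have "continuous_on UNIV (F Y)"
      unfolding F_def[abs_def] by (rule continuous_on_compose2[OF _ cont_cl]) (use cl(1) in blast)
    moreover have "bounded (?G ` {0..1})"
      by (intro compact_imp_bounded compact_continuous_image G) simp
    then have "bounded (range (F Y))"
      by (rule bounded_subset) (use cl(1) in \<open>auto simp: F_def\<close>)
    ultimately show ?thesis by (simp add: bcontfun_def)
  qed
  define T where "T Y = Bcontfun (F (apply_bcontfun Y))" for Y :: "real \<Rightarrow>\<^sub>C 'a"
  have T: "apply_bcontfun (T Y) = F (apply_bcontfun Y)" for Y
    by (simp add: T_def Bcontfun_inverse F)
  define S where "S = PiC (UNIV :: real set) (\<lambda>_. cball y0 \<rho>)"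
  have S: "Y \<in> S \<longleftrightarrow> (\<forall>t. apply_bcontfun Y t \<in> cball y0 \<rho>)" for Y
    by (auto simp: S_def mem_PiC_iff)
  have "\<exists>!Y\<in>S. T Y = Y"
  proof (rule Banach_fix)
    have "closed S" unfolding S_def by (rule closed_PiC) simp
    then show "complete S" by (rule complete_eq_closed[THEN iffD2])
    have "const_bcontfun y0 \<in> S" using \<rho> by (simp add: S const_bcontfun.rep_eq)
    then show "S \<noteq> {}" by blast
    show "0 \<le> h * (A * L)" using h A L by simp
    show "h * (A * L) < 1" by fact
    show "T ` S \<subseteq> S"
    proof (safe, unfold S, safe)
      fix Y :: "real \<Rightarrow>\<^sub>C 'a" and t assume Y: "\<forall>t. apply_bcontfun Y t \<in> cball y0 \<rho>"
      have "norm (\<Sum>l\<in>I. \<kappa> (cl t) l *\<^sub>R f (apply_bcontfun Y (c l))) \<le> A * B"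
        using A(1)[OF cl(1)] B Y by (intro norm_sum_scaleR_le) auto
      then have "h * norm (\<Sum>l\<in>I. \<kappa> (cl t) l *\<^sub>R f (apply_bcontfun Y (c l))) \<le> \<rho>"
        by (rule order.trans[OF mult_left_mono[OF _ h(1)] h(2)])
      then show "apply_bcontfun (T Y) t \<in> cball y0 \<rho>"
        using h by (simp add: T F_def dist_norm)
    qed
    fix Y Z :: "real \<Rightarrow>\<^sub>C 'a" assume Y: "Y \<in> S" and Z: "Z \<in> S"
    show "dist (T Y) (T Z) \<le> h * (A * L) * dist Y Z"
    proof (rule dist_bound)
      fix t
      have "norm (\<Sum>l\<in>I. \<kappa> (cl t) l *\<^sub>R (f (apply_bcontfun Y (c l)) - f (apply_bcontfun Z (c l))))
          \<le> A * (L * dist Y Z)"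
      proof (rule norm_sum_scaleR_le[OF _ A(1)[OF cl(1)]])
        fix l
        have "dist (f (apply_bcontfun Y (c l))) (f (apply_bcontfun Z (c l))) \<le>
            L * dist (apply_bcontfun Y (c l)) (apply_bcontfun Z (c l))"
          using Y Z S by (intro L) auto
        also have "\<dots> \<le> L * dist Y Z" using L by (intro mult_left_mono dist_bounded) auto
        finally show "norm (f (apply_bcontfun Y (c l)) - f (apply_bcontfun Z (c l))) \<le> L * dist Y Z"
          by (simp add: dist_norm)
      qed (use L in auto)
      then have "h * norm (\<Sum>l\<in>I. \<kappa> (cl t) l *\<^sub>R (f (apply_bcontfun Y (c l)) - f (apply_bcontfun Z (c l))))
          \<le> h * (A * (L * dist Y Z))"
        using h by (intro mult_left_mono) auto
      moreover have "apply_bcontfun (T Y) t - apply_bcontfun (T Z) t =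
          h *\<^sub>R (\<Sum>l\<in>I. \<kappa> (cl t) l *\<^sub>R (f (apply_bcontfun Y (c l)) - f (apply_bcontfun Z (c l))))"
        by (simp add: T F_def scaleR_diff_right sum_subtractf)
      ultimately show "dist (apply_bcontfun (T Y) t) (apply_bcontfun (T Z) t) \<le> h * (A * L) * dist Y Z"
        using h by (simp add: dist_norm mult_ac)
    qed
  qed
  then obtain Y where Y: "Y \<in> S" "T Y = Y" by blast
  have YF: "apply_bcontfun Y (c l) = F (apply_bcontfun Y) (c l)" for l
    using T[of Y] unfolding Y(2) by (rule fun_cong)
  have fixed: "apply_bcontfun Y (c l) =
      y0 + h *\<^sub>R (\<Sum>l'\<in>I. \<kappa> (c l) l' *\<^sub>R f (apply_bcontfun Y (c l')))" if "l \<in> I" for l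
    by (rule trans[OF YF]) (simp only: F_def cl(2)[OF c[OF that]])
  have ball: "apply_bcontfun Y (c l) \<in> cball y0 \<rho>" for l using Y(1) unfolding S by (rule spec)
  show ?thesis
    by (intro exI[of _ "\<lambda>l. apply_bcontfun Y (c l)"] ballI conjI ball) (rule fixed)
qed

text \<open>Uniqueness of the numerical solution is meant on the whole real line, whereas the method
  compares two solutions only on [0,h]. Agreement of polynomials on an infinite set bridges the
  gap.\<close>

lemma vector_polynomials_eq:
  fixes a b :: "nat \<Rightarrow> 'a::euclidean_space"
  assumes "infinite T" "\<And>t. t \<in> T \<Longrightarrow> (\<Sum>i\<le>n. t ^ i *\<^sub>R a i) = (\<Sum>i\<le>n. t ^ i *\<^sub>R b i)"
  shows "(\<Sum>i\<le>n. t ^ i *\<^sub>R a i) = (\<Sum>i\<le>n. (t::real) ^ i *\<^sub>R b i)"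
proof (rule euclidean_eqI)
  fix e :: 'a
  define p where "p = (\<Sum>i\<le>n. monom ((a i - b i) \<bullet> e) i)"
  have p: "poly p t = (\<Sum>i\<le>n. t ^ i *\<^sub>R a i) \<bullet> e - (\<Sum>i\<le>n. t ^ i *\<^sub>R b i) \<bullet> e" for t
    by (simp add: p_def poly_sum poly_monom inner_sum_left inner_diff_left left_diff_distrib right_diff_distrib
        sum_subtractf mult.commute)
  have "T \<subseteq> {t. poly p t = 0}" using assms(2) by (simp add: subset_iff p)
  then have "infinite {t. poly p t = 0}" using assms(1) finite_subset by blast
  then have "p = 0" using poly_roots_finite by blast
  then show "(\<Sum>i\<le>n. t ^ i *\<^sub>R a i) \<bullet> e = (\<Sum>i\<le>n. t ^ i *\<^sub>R b i) \<bullet> e" using p[of t] by simp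
qed

section \<open>Integrated form of the method; existence and uniqueness of its solution\<close>

definition legendre01_antideriv :: "nat \<Rightarrow> real poly" where
  "legendre01_antideriv j =
     (SOME q. pderiv q = legendre01 j \<and> poly q 0 = 0 \<and> degree q \<le> Suc j)"

lemma legendre01_antideriv:
  "pderiv (legendre01_antideriv j) = legendre01 j" "poly (legendre01_antideriv j) 0 = 0"
  "degree (legendre01_antideriv j) \<le> Suc j"
proof -
  obtain q where "degree q \<le> Suc (degree (legendre01 j))" "coeff q 0 = 0" "pderiv q = legendre01 j"
    by (rule poly_antiderivative[of "legendre01 j"])
  then have "pderiv q = legendre01 j \<and> poly q 0 = 0 \<and> degree q \<le> Suc j"
    by (simp add: poly_0_coeff_0)
  then have "pderiv (legendre01_antideriv j) = legendre01 j \<and> poly (legendre01_antideriv j) 0 = 0 \<and>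
      degree (legendre01_antideriv j) \<le> Suc j"
    unfolding legendre01_antideriv_def by (rule someI)
  then show "pderiv (legendre01_antideriv j) = legendre01 j" "poly (legendre01_antideriv j) 0 = 0"
    "degree (legendre01_antideriv j) \<le> Suc j" by auto
qed

definition hbvm_slope ::
  "nat \<Rightarrow> nat \<Rightarrow> (nat \<Rightarrow> 'a::euclidean_space) \<Rightarrow> real \<Rightarrow> 'a" where
  "hbvm_slope k s F c = (\<Sum>j<s. poly (legendre01 j) c *\<^sub>R
      (\<Sum>l=1..k. (gauss_weight k l * poly (legendre01 j) (gauss_node k l)) *\<^sub>R F l))"

text \<open>At \<open>c = gauss_node k i\<close> these are the entries of the Butcher matrix of
  HBVM(k,s), read as a k-stage Runge-Kutta method. For general c they give its continuous
  extension.\<close>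

definition hbvm_kernel :: "nat \<Rightarrow> nat \<Rightarrow> real \<Rightarrow> nat \<Rightarrow> real" where
  "hbvm_kernel k s c l = (\<Sum>j<s. poly (legendre01_antideriv j) c *
      (gauss_weight k l * poly (legendre01 j) (gauss_node k l)))"

lemma hbvm_kernel_sum:
  fixes F :: "nat \<Rightarrow> 'a::euclidean_space"
  shows "(\<Sum>l=1..k. hbvm_kernel k s c l *\<^sub>R F l) =
   (\<Sum>j<s. poly (legendre01_antideriv j) c *\<^sub>R
      (\<Sum>l=1..k. (gauss_weight k l * poly (legendre01 j) (gauss_node k l)) *\<^sub>R F l))"
  unfolding hbvm_kernel_def scaleR_sum_left scaleR_sum_right scaleR_scaleR by (rule sum.swap)

lemma hbvm_kernel_0: "hbvm_kernel k s 0 l = 0"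
  by (simp add: hbvm_kernel_def legendre01_antideriv)

lemma hbvm_kernel_sum_derivative:
  fixes F :: "nat \<Rightarrow> 'a::euclidean_space"
  shows "((\<lambda>c. \<Sum>l=1..k. hbvm_kernel k s c l *\<^sub>R F l) has_vector_derivative hbvm_slope k s F c) (at c)"
proof -
  have "((\<lambda>c. poly (legendre01_antideriv j) c *\<^sub>R G) has_vector_derivative poly (legendre01 j) c *\<^sub>R G) (at c)"
    for j and G :: 'a
    using has_vector_derivative_scaleR[OF poly_DERIV[of "legendre01_antideriv j" c]
        has_vector_derivative_const[of G "at c"]]
    by (simp add: legendre01_antideriv)
  then show ?thesis
    unfolding hbvm_kernel_sum hbvm_slope_def by (intro has_vector_derivative_sum) auto
qed

lemma hbvm_kernel_bound:
  "\<exists>A>0. \<forall>c\<in>{0..1}. (\<Sum>l=1..k. \<bar>hbvm_kernel k s c l\<bar>) \<le> A"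
proof -
  have "continuous_on {0..1} (\<lambda>c. \<Sum>l=1..k. \<bar>hbvm_kernel k s c l\<bar>)"
    unfolding hbvm_kernel_def by (intro continuous_intros)
  then have "bounded ((\<lambda>c. \<Sum>l=1..k. \<bar>hbvm_kernel k s c l\<bar>) ` {0..1})"
    by (intro compact_imp_bounded compact_continuous_image) auto
  then obtain A where "A > 0" "\<forall>c\<in>{0..1}. \<bar>\<Sum>l=1..k. \<bar>hbvm_kernel k s c l\<bar>\<bar> \<le> A"
    by (auto simp: bounded_pos)
  then show ?thesis by (intro exI[of _ A]) auto
qed

lemma hbvm_solution_derivative:
  assumes "hbvm_solution k s f y0 h u" "c \<in> {0..1}"
  shows "((\<lambda>c. u (c * h)) has_vector_derivative
    h *\<^sub>R hbvm_slope k s (\<lambda>l. f (u (gauss_node k l * h))) c) (at c within S)"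
proof -
  have u: "(u has_vector_derivative hbvm_slope k s (\<lambda>l. f (u (gauss_node k l * h))) c) (at (c * h))"
    using assms unfolding hbvm_solution_def hbvm_slope_def by blast
  have "((\<lambda>c. c * h) has_vector_derivative h) (at c)"
    by (auto intro!: derivative_eq_intros simp flip: has_real_derivative_iff_has_vector_derivative)
  from vector_diff_chain_at[OF this u] show ?thesis
    unfolding comp_def by (rule has_vector_derivative_at_within)
qed

lemma hbvm_solution_integral_form:
  assumes "hbvm_solution k s f y0 h u" "c \<in> {0..1}"
  shows "u (c * h) = y0 + h *\<^sub>R (\<Sum>l=1..k. hbvm_kernel k s c l *\<^sub>R f (u (gauss_node k l * h)))"
proof -
  let ?F = "\<lambda>l. f (u (gauss_node k l * h))"
  let ?\<phi> = "\<lambda>c. u (c * h) - h *\<^sub>R (\<Sum>l=1..k. hbvm_kernel k s c l *\<^sub>R ?F l)"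
  have der: "(?\<phi> has_vector_derivative 0) (at x within {0..1})" if "x \<in> {0..1}" for x
  proof -
    have "((\<lambda>c. h *\<^sub>R (\<Sum>l=1..k. hbvm_kernel k s c l *\<^sub>R ?F l)) has_vector_derivative
        h *\<^sub>R hbvm_slope k s ?F x) (at x within {0..1})"
      by (rule bounded_linear.has_vector_derivative[OF bounded_linear_scaleR_right
            has_vector_derivative_at_within[OF hbvm_kernel_sum_derivative]])
    from has_vector_derivative_diff[OF hbvm_solution_derivative[OF assms(1) that] this]
    show ?thesis by simp
  qed
  obtain z where z: "\<And>x. x \<in> {0..1} \<Longrightarrow> ?\<phi> x = z"
    using has_vector_derivative_zero_constant[OF convex_real_interval(5) der] by blast
  have "u 0 = y0" using assms(1) unfolding hbvm_solution_def by blast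
  then have "z = y0" using z[of 0] by (simp add: hbvm_kernel_0)
  then show ?thesis using z[OF assms(2)] by (simp only: diff_eq_eq)
qed

lemma hbvm_solution_of_stages:
  fixes f :: "'a::euclidean_space \<Rightarrow> 'a"
  assumes h: "h > 0"
    and Y: "\<And>l. l \<in> {1..k} \<Longrightarrow> Y l = y0 + h *\<^sub>R (\<Sum>l'=1..k. hbvm_kernel k s (gauss_node k l) l' *\<^sub>R f (Y l'))"
  defines "u \<equiv> \<lambda>t. y0 + h *\<^sub>R (\<Sum>l=1..k. hbvm_kernel k s (t / h) l *\<^sub>R f (Y l))"
  shows "hbvm_solution k s f y0 h u"
  unfolding hbvm_solution_def
proof (intro conjI ballI)
  define G where "G j = (\<Sum>l=1..k. (gauss_weight k l * poly (legendre01 j) (gauss_node k l)) *\<^sub>R f (Y l))" for j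
  \<comment> \<open>Coefficients in powers of t rather than of t / h, hence the division by
    \<open>h ^ i\<close>. The degree stays within s, as the antiderivative of P_j has degree at most
    j + 1 \<le> s.\<close>
  define a where "a i = (if i = 0 then y0 else 0) +
    (\<Sum>j<s. (h * (coeff (legendre01_antideriv j) i / h ^ i)) *\<^sub>R G j)" for i
  have "u t = (\<Sum>i\<le>s. t ^ i *\<^sub>R a i)" for t
  proof -
    have "poly (legendre01_antideriv j) (t / h) = (\<Sum>i\<le>s. t ^ i * (coeff (legendre01_antideriv j) i / h ^ i))"
      if "j < s" for j
      using that legendre01_antideriv(3)[of j]
      by (subst poly_sum_le[of _ s]) (auto simp: power_divide mult_ac)
    then have "u t = y0 + (\<Sum>j<s. \<Sum>i\<le>s. (t ^ i * (h * (coeff (legendre01_antideriv j) i / h ^ i))) *\<^sub>R G j)"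
      unfolding u_def hbvm_kernel_sum G_def[symmetric]
      by (simp add: scaleR_sum_right scaleR_sum_left sum_distrib_left mult_ac)
    also have "\<dots> = y0 + (\<Sum>i\<le>s. t ^ i *\<^sub>R (\<Sum>j<s. (h * (coeff (legendre01_antideriv j) i / h ^ i)) *\<^sub>R G j))"
      by (subst sum.swap) (simp add: scaleR_sum_right)
    also have "y0 = (\<Sum>i\<le>s. t ^ i *\<^sub>R (if i = 0 then y0 else 0))"
      by (simp add: if_distrib sum.delta cong: if_cong)
    finally show ?thesis
      by (simp add: a_def scaleR_add_right sum.distrib)
  qed
  then show "\<exists>a. \<forall>t. u t = (\<Sum>i\<le>s. t ^ i *\<^sub>R a i)" by blast
  show "u 0 = y0" by (simp add: u_def hbvm_kernel_0)
  have node: "u (gauss_node k l * h) = Y l" if "l \<in> {1..k}" for l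
    using Y[OF that] h by (simp add: u_def)
  fix c :: real assume "c \<in> {0..1}"
  have "((\<lambda>t. t / h) has_vector_derivative 1 / h) (at (c * h))"
    using h by (auto intro!: derivative_eq_intros simp flip: has_real_derivative_iff_has_vector_derivative)
  moreover have "((\<lambda>c. \<Sum>l=1..k. hbvm_kernel k s c l *\<^sub>R f (Y l)) has_vector_derivative
      hbvm_slope k s (\<lambda>l. f (Y l)) c) (at (c * h / h))"
    using hbvm_kernel_sum_derivative[of k s "\<lambda>l. f (Y l)" c] h by simp
  ultimately have "((\<lambda>t. \<Sum>l=1..k. hbvm_kernel k s (t / h) l *\<^sub>R f (Y l)) has_vector_derivative
      (1 / h) *\<^sub>R hbvm_slope k s (\<lambda>l. f (Y l)) c) (at (c * h))"
    by (rule vector_diff_chain_at[unfolded comp_def])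
  then have "(u has_vector_derivative 0 + h *\<^sub>R (1 / h) *\<^sub>R hbvm_slope k s (\<lambda>l. f (Y l)) c) (at (c * h))"
    unfolding u_def
    by (rule has_vector_derivative_add[OF has_vector_derivative_const
        bounded_linear.has_vector_derivative[OF bounded_linear_scaleR_right]])
  moreover have "hbvm_slope k s (\<lambda>l. f (Y l)) c = hbvm_slope k s (\<lambda>l. f (u (gauss_node k l * h))) c"
    unfolding hbvm_slope_def by (intro sum.cong refl arg_cong2[where f = scaleR]) (simp_all add: node)
  ultimately show "(u has_vector_derivative (\<Sum>j<s. poly (legendre01 j) c *\<^sub>R
      (\<Sum>l=1..k. (gauss_weight k l * poly (legendre01 j) (gauss_node k l)) *\<^sub>R
         f (u (gauss_node k l * h))))) (at (c * h))"
    using h by (simp add: hbvm_slope_def)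
qed

text \<open>A contraction estimate on the sum \<open>D\<close> of the distances at the k nodes gives
  D \<le> k h A L D, so D = 0. By the integrated form the stages determine the solution on [0,h],
  and being polynomial it is determined everywhere.\<close>

lemma hbvm_solution_in_ball_unique:
  fixes f :: "'a::euclidean_space \<Rightarrow> 'a"
  assumes A: "\<And>c. c \<in> {0..1} \<Longrightarrow> (\<Sum>l=1..k. \<bar>hbvm_kernel k s c l\<bar>) \<le> A"
    and L: "\<And>x y. x \<in> cball y0 r \<Longrightarrow> y \<in> cball y0 r \<Longrightarrow> dist (f x) (f y) \<le> L * dist x y" "L \<ge> 0"
    and h: "h > 0" "real k * (h * (A * L)) < 1"
    and u: "hbvm_solution_in_ball k s f y0 r h u" and v: "hbvm_solution_in_ball k s f y0 r h v"
  shows "u = v"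
proof -
  let ?n = "\<lambda>l. gauss_node k l * h"
  define D where "D = (\<Sum>l=1..k. dist (u (?n l)) (v (?n l)))"
  have D0: "D \<ge> 0" unfolding D_def by (intro sum_nonneg) auto
  have sol: "hbvm_solution k s f y0 h u" "hbvm_solution k s f y0 h v"
    and in_ball: "\<And>c. c \<in> {0..1} \<Longrightarrow> u (c * h) \<in> cball y0 r" "\<And>c. c \<in> {0..1} \<Longrightarrow> v (c * h) \<in> cball y0 r"
    using u v by (auto simp: hbvm_solution_in_ball_def less_imp_le)
  have node: "gauss_node k l \<in> {0..1}" if "l \<in> {1..k}" for l
    using gauss_node_bounds[OF that] by auto
  have le: "dist (u (c * h)) (v (c * h)) \<le> h * (A * L) * D" if c: "c \<in> {0..1}" for c
  proof -
    have "norm (\<Sum>l=1..k. hbvm_kernel k s c l *\<^sub>R (f (u (?n l)) - f (v (?n l)))) \<le> A * (L * D)"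
    proof (rule norm_sum_scaleR_le[OF _ A[OF c]])
      fix l assume l: "l \<in> {1..k}"
      have "dist (f (u (?n l))) (f (v (?n l))) \<le> L * dist (u (?n l)) (v (?n l))"
        using node[OF l] by (intro L in_ball)
      also have "dist (u (?n l)) (v (?n l)) \<le> D"
        unfolding D_def by (rule member_le_sum) (use l in auto)
      finally show "norm (f (u (?n l)) - f (v (?n l))) \<le> L * D"
        using L by (simp add: dist_norm mult_left_mono)
    qed (use L D0 in auto)
    then have "h * norm (\<Sum>l=1..k. hbvm_kernel k s c l *\<^sub>R (f (u (?n l)) - f (v (?n l)))) \<le> h * (A * (L * D))"
      using h by (intro mult_left_mono) auto
    moreover have "u (c * h) - v (c * h) =
        h *\<^sub>R (\<Sum>l=1..k. hbvm_kernel k s c l *\<^sub>R (f (u (?n l)) - f (v (?n l))))"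
      unfolding hbvm_solution_integral_form[OF sol(1) c] hbvm_solution_integral_form[OF sol(2) c]
      by (simp add: scaleR_diff_right sum_subtractf)
    ultimately show ?thesis using h by (simp add: dist_norm mult_ac)
  qed
  have "D \<le> (\<Sum>l=1..k. h * (A * L) * D)"
    unfolding D_def using le[OF node] by (intro sum_mono) (simp add: D_def)
  then have "D * (1 - real k * (h * (A * L))) \<le> 0" by (simp add: algebra_simps)
  then have "D = 0" using h(2) D0 by (simp add: mult_le_0_iff)
  then have eq: "u (c * h) = v (c * h)" if "c \<in> {0..1}" for c
    using le[OF that] by simp
  obtain a b where ab: "\<And>t. u t = (\<Sum>i\<le>s. t ^ i *\<^sub>R a i)" "\<And>t. v t = (\<Sum>i\<le>s. t ^ i *\<^sub>R b i)"
    using sol unfolding hbvm_solution_def by blast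
  have "infinite {0..h}" using h by (simp add: infinite_Icc)
  moreover have "(\<Sum>i\<le>s. t ^ i *\<^sub>R a i) = (\<Sum>i\<le>s. t ^ i *\<^sub>R b i)" if "t \<in> {0..h}" for t
    using eq[of "t / h"] that h by (simp add: ab)
  ultimately show "u = v"
    using vector_polynomials_eq[where T = "{0..h}" and n = s and a = a and b = b] ab by auto
qed

lemma hbvm_solution_in_ball_ex1:
  fixes f :: "'a::euclidean_space \<Rightarrow> 'a"
  assumes r: "r > 0"
    and L: "\<And>x y. x \<in> cball y0 r \<Longrightarrow> y \<in> cball y0 r \<Longrightarrow> dist (f x) (f y) \<le> L * dist x y" "L \<ge> 0"
  shows "\<forall>\<^sub>F h in at_right 0. \<exists>!u. hbvm_solution_in_ball k s f y0 r h u"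
proof -
  obtain A where A: "A > 0" "\<And>c. c \<in> {0..1} \<Longrightarrow> (\<Sum>l=1..k. \<bar>hbvm_kernel k s c l\<bar>) \<le> A"
    using hbvm_kernel_bound by metis
  define B where "B = norm (f y0) + L * r"
  have B: "norm (f x) \<le> B" if "x \<in> cball y0 r" for x
  proof -
    have "dist (f x) (f y0) \<le> L * dist x y0" using that r by (intro L) auto
    also have "\<dots> \<le> L * r" using that L by (intro mult_left_mono) (auto simp: dist_commute)
    finally show ?thesis unfolding B_def dist_norm using norm_triangle_sub[of "f x" "f y0"] by linarith
  qed
  have B0: "B \<ge> 0" unfolding B_def using L r by simp
  have small: "\<forall>\<^sub>F h in at_right 0. h * z < e" if "e > 0" for z e :: real
  proof -
    have "((\<lambda>h. h * z) \<longlongrightarrow> 0 * z) (at_right 0)" by (intro tendsto_intros)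
    then show ?thesis using that by (intro order_tendstoD(2)[of _ 0]) auto
  qed
  have "\<forall>\<^sub>F h in at_right 0. h * (A * B) < r / 2 \<and> h * (A * L) < 1 \<and> h * (real k * (A * L)) < 1 \<and> 0 < h \<and> h < 1"
    using r by (intro eventually_conj small eventually_small[unfolded eventually_conj_iff, THEN conjunct1]
        eventually_small[unfolded eventually_conj_iff, THEN conjunct2]) auto
  \<comment> \<open>The first smallness condition makes the stage map send the ball of radius r / 2
    into itself and keeps u inside the open ball of radius r. The second makes that map a
    contraction. The third, with its factor k for the sum over the nodes, gives uniqueness in the
    ball of radius r.\<close>
  then show ?thesis
  proof eventually_elim
    case (elim h)
    have node: "gauss_node k l \<in> {0..1}" if "l \<in> {1..k}" for l
      using gauss_node_bounds[OF that] by auto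
    have sub: "cball y0 (r / 2) \<subseteq> cball y0 r" using r by (intro subset_cball) auto
    have "\<exists>Y. \<forall>l\<in>{1..k}. Y l \<in> cball y0 (r / 2) \<and>
        Y l = y0 + h *\<^sub>R (\<Sum>l'=1..k. hbvm_kernel k s (gauss_node k l) l' *\<^sub>R f (Y l'))"
    proof (rule stage_equations_solvable[where A = A and B = B and L = L])
      show "continuous_on {0..1} (\<lambda>t. hbvm_kernel k s t l)" for l
        unfolding hbvm_kernel_def by (intro continuous_intros)
      show "gauss_node k l \<in> {0..1}" if "l \<in> {1..k}" for l
        by (rule node[OF that])
      show "(\<Sum>l=1..k. \<bar>hbvm_kernel k s t l\<bar>) \<le> A" if "t \<in> {0..1}" for t
        by (rule A(2)[OF that])
      show "dist (f x) (f y) \<le> L * dist x y" if "x \<in> cball y0 (r / 2)" "y \<in> cball y0 (r / 2)" for x y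
        using that sub by (intro L(1)) blast+
    qed (use A L B B0 sub elim in auto)
    then obtain Y where Y: "\<And>l. l \<in> {1..k} \<Longrightarrow> Y l \<in> cball y0 (r / 2)"
      "\<And>l. l \<in> {1..k} \<Longrightarrow> Y l = y0 + h *\<^sub>R (\<Sum>l'=1..k. hbvm_kernel k s (gauss_node k l) l' *\<^sub>R f (Y l'))"
      by blast
    define u where "u t = y0 + h *\<^sub>R (\<Sum>l=1..k. hbvm_kernel k s (t / h) l *\<^sub>R f (Y l))" for t
    have "hbvm_solution k s f y0 h u"
      unfolding u_def using elim Y(2) by (intro hbvm_solution_of_stages) auto
    moreover have "u (c * h) \<in> ball y0 r" if c: "c \<in> {0..1}" for c
    proof -
      have "norm (\<Sum>l=1..k. hbvm_kernel k s c l *\<^sub>R f (Y l)) \<le> A * B"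
        using Y(1) sub B B0 by (intro norm_sum_scaleR_le[OF _ A(2)[OF c]]) blast+
      then have "h * norm (\<Sum>l=1..k. hbvm_kernel k s c l *\<^sub>R f (Y l)) \<le> h * (A * B)"
        using elim by (intro mult_left_mono) auto
      then have "h * norm (\<Sum>l=1..k. hbvm_kernel k s c l *\<^sub>R f (Y l)) < r"
        using elim r by linarith
      then show ?thesis using elim by (simp add: u_def dist_norm)
    qed
    ultimately have "hbvm_solution_in_ball k s f y0 r h u"
      by (simp add: hbvm_solution_in_ball_def)
    moreover have "v = u" if "hbvm_solution_in_ball k s f y0 r h v" for v
    proof (rule hbvm_solution_in_ball_unique[OF A(2) L _ _ that \<open>hbvm_solution_in_ball k s f y0 r h u\<close>])
      show "real k * (h * (A * L)) < 1" using elim by (simp add: mult.left_commute)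
    qed (use elim in auto)
    ultimately show ?case by blast
  qed
qed

section \<open>Energy\<close>

text \<open>The parameter is c instead of t = c h, so that all step sizes share the interval [0,1]
  on which graded families live.\<close>

definition hbvm_curve ::
  "nat \<Rightarrow> nat \<Rightarrow> (real^'n \<Rightarrow> real^'n) \<Rightarrow> real \<Rightarrow> (real \<Rightarrow> real^'n) \<Rightarrow> bool" where
  "hbvm_curve k s f h X \<longleftrightarrow> (\<forall>c\<in>{0..1}. (X has_vector_derivative
     h *\<^sub>R (\<chi> i. hbvm_proj k s (\<lambda>c. f (X c) $ i) c)) (at c within {0..1}))"

lemma hbvm_solution_curve:
  assumes "hbvm_solution k s f y0 h u"
  shows "hbvm_curve k s f h (\<lambda>c. u (c * h))"
  unfolding hbvm_curve_def
proof
  fix c :: real assume c: "c \<in> {0..1}"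
  have "hbvm_slope k s (\<lambda>l. f (u (gauss_node k l * h))) c =
      (\<chi> i. hbvm_proj k s (\<lambda>c. f (u (c * h)) $ i) c)"
    by (simp add: vec_eq_iff hbvm_slope_def hbvm_proj_def gauss_quadrature_def mult.assoc)
  then show "((\<lambda>c. u (c * h)) has_vector_derivative
      h *\<^sub>R (\<chi> i. hbvm_proj k s (\<lambda>c. f (u (c * h)) $ i) c)) (at c within {0..1})"
    using hbvm_solution_derivative[OF assms c, of "{0..1}"] by simp
qed

lemma GDERIV_along_curve:
  assumes "GDERIV g (X c) :> D" "(X has_vector_derivative X') (at c within S)"
  shows "((\<lambda>c. g (X c)) has_real_derivative X' \<bullet> D) (at c within S)"
proof -
  have "((\<lambda>c. g (X c)) has_derivative (\<lambda>t. (t *\<^sub>R X') \<bullet> D)) (at c within S)"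
    using has_derivative_compose[OF assms(2)[unfolded has_vector_derivative_def] assms(1)[unfolded gderiv_def]] .
  moreover have "(\<lambda>t. (t *\<^sub>R X') \<bullet> D) = times (X' \<bullet> D)" by (simp add: fun_eq_iff mult.commute)
  ultimately show ?thesis unfolding has_field_derivative_def by simp
qed

lemma hbvm_curve_increment:
  assumes X: "hbvm_curve k s f h X" and g: "\<And>x. GDERIV g x :> grad g x" and c: "c \<in> {0..1}"
  shows "g (X c) - g (X 0) =
    h * integral {0..c} (\<lambda>c. \<Sum>i\<in>UNIV. hbvm_proj k s (\<lambda>c. f (X c) $ i) c * grad g (X c) $ i)"
proof -
  let ?D = "\<lambda>c. \<Sum>i\<in>UNIV. hbvm_proj k s (\<lambda>c. f (X c) $ i) c * grad g (X c) $ i"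
  have "((\<lambda>c. g (X c)) has_real_derivative h * ?D x) (at x within {0..1})" if "x \<in> {0..1}" for x
    using GDERIV_along_curve[OF g X[unfolded hbvm_curve_def, rule_format, OF that]]
    by (simp add: inner_vec_def sum_distrib_left mult.assoc)
  then have "((\<lambda>c. g (X c)) has_vector_derivative h * ?D x) (at x within {0..c})" if "x \<in> {0..c}" for x
    unfolding has_real_derivative_iff_has_vector_derivative[symmetric]
    by (rule DERIV_subset) (use that c in auto)
  then have "((\<lambda>x. h * ?D x) has_integral g (X c) - g (X 0)) {0..c}"
    using c by (intro fundamental_theorem_of_calculus) auto
  then have "integral {0..c} (\<lambda>x. h * ?D x) = g (X c) - g (X 0)" by (rule integral_unique)
  then show ?thesis by simp
qed

lemma skew_sum_symmetric:
  fixes J :: "real^'n^'n"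
  assumes "transpose J = - J" "\<And>i j. S i j = S j i"
  shows "(\<Sum>i\<in>UNIV. \<Sum>j\<in>UNIV. J $ i $ j * S i j) = (0::real)"
proof -
  have J: "J $ j $ i = - (J $ i $ j)" for i j
    using arg_cong[OF assms(1), of "\<lambda>A. A $ i $ j"] by (simp add: transpose_def)
  have "(\<Sum>i\<in>UNIV. \<Sum>j\<in>UNIV. J $ i $ j * S i j) = (\<Sum>j\<in>UNIV. \<Sum>i\<in>UNIV. J $ i $ j * S i j)"
    by (rule sum.swap)
  also have "\<dots> = (\<Sum>j\<in>UNIV. \<Sum>i\<in>UNIV. - (J $ j $ i * S j i))"
  proof (intro sum.cong refl)
    fix i j
    show "J $ i $ j * S i j = - (J $ j $ i * S j i)"
      using J[of j i] assms(2)[of i j] by simp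
  qed
  also have "\<dots> = - (\<Sum>i\<in>UNIV. \<Sum>j\<in>UNIV. J $ i $ j * S i j)" by (simp add: sum_negf)
  finally show ?thesis by simp
qed

lemma integral_mult_hbvm_proj:
  assumes "continuous_on {0..1} F"
  shows "integral {0..1} (\<lambda>c. hbvm_proj k s G c * F c) = energy_form k s F G +
    (\<Sum>j<s. gauss_quadrature k (\<lambda>x. poly (legendre01 j) x * F x) *
             gauss_quadrature k (\<lambda>x. poly (legendre01 j) x * G x))"
proof -
  let ?Q = "\<lambda>j F. gauss_quadrature k (\<lambda>x. poly (legendre01 j) x * F x)"
  have "integral {0..1} (\<lambda>c. hbvm_proj k s G c * F c) =
      integral {0..1} (\<lambda>c. \<Sum>j<s. ?Q j G * (poly (legendre01 j) c * F c))"
    unfolding hbvm_proj_def sum_distrib_right by (simp only: mult_ac)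
  also have "\<dots> = (\<Sum>j<s. integral {0..1} (\<lambda>c. ?Q j G * (poly (legendre01 j) c * F c)))"
    by (intro integral_sum integrable_continuous_real continuous_intros assms) auto
  also have "\<dots> = (\<Sum>j<s. ?Q j G * integral {0..1} (\<lambda>c. poly (legendre01 j) c * F c))"
    by simp
  also have "\<dots> = energy_form k s F G + (\<Sum>j<s. ?Q j F * ?Q j G)"
    unfolding energy_form_def sum.distrib[symmetric]
    by (intro sum.cong refl) (simp add: algebra_simps)
  finally show ?thesis .
qed

text \<open>The projection is linear and therefore commutes with J, so the derivative of H along the
  curve is h times the pairing of J \<Pi> grad H with grad H. Splitting each integral into its
  energy form and its symmetric quadrature part leaves only the former, by skewness of J.\<close>

lemma energy_increment:
  fixes J :: "real^'n^'n" and H :: "real^'n \<Rightarrow> real"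
  assumes J: "transpose J = - J"
    and X: "hbvm_curve k s (hamiltonian_field J H) h X"
    and H: "\<And>x. GDERIV H x :> grad H x"
    and cont: "\<And>i. continuous_on {0..1} (\<lambda>c. grad H (X c) $ i)"
  shows "H (X 1) - H (X 0) = h * (\<Sum>i\<in>UNIV. \<Sum>j\<in>UNIV.
    J $ i $ j * energy_form k s (\<lambda>c. grad H (X c) $ i) (\<lambda>c. grad H (X c) $ j))"
proof -
  let ?G = "\<lambda>i c. grad H (X c) $ i"
  let ?Q = "\<lambda>j F. gauss_quadrature k (\<lambda>x. poly (legendre01 j) x * F x)"
  have "hbvm_proj k s (\<lambda>c. hamiltonian_field J H (X c) $ i) c =
      (\<Sum>j\<in>UNIV. J $ i $ j * hbvm_proj k s (?G j) c)" for i c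
    by (simp add: hamiltonian_field_def matrix_vector_mult_def hbvm_proj_sum hbvm_proj_cmult)
  then have "H (X 1) - H (X 0) =
      h * integral {0..1} (\<lambda>c. \<Sum>i\<in>UNIV. \<Sum>j\<in>UNIV. J $ i $ j * (hbvm_proj k s (?G j) c * ?G i c))"
    using hbvm_curve_increment[OF X H, of 1] by (simp add: sum_distrib_right mult.assoc)
  also have "integral {0..1} (\<lambda>c. \<Sum>i\<in>UNIV. \<Sum>j\<in>UNIV. J $ i $ j * (hbvm_proj k s (?G j) c * ?G i c)) =
      (\<Sum>i\<in>UNIV. \<Sum>j\<in>UNIV. integral {0..1} (\<lambda>c. J $ i $ j * (hbvm_proj k s (?G j) c * ?G i c)))"
  proof -
    have int: "(\<lambda>c. J $ i $ j * (hbvm_proj k s (?G j) c * ?G i c)) integrable_on {0..1}" for i j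
      by (intro integrable_continuous_real continuous_intros continuous_on_hbvm_proj cont)
    have "integral {0..1} (\<lambda>c. \<Sum>i\<in>UNIV. \<Sum>j\<in>UNIV. J $ i $ j * (hbvm_proj k s (?G j) c * ?G i c)) =
        (\<Sum>i\<in>UNIV. integral {0..1} (\<lambda>c. \<Sum>j\<in>UNIV. J $ i $ j * (hbvm_proj k s (?G j) c * ?G i c)))"
      by (intro integral_sum integrable_sum int) simp_all
    also have "\<dots> = (\<Sum>i\<in>UNIV. \<Sum>j\<in>UNIV. integral {0..1} (\<lambda>c. J $ i $ j * (hbvm_proj k s (?G j) c * ?G i c)))"
      by (intro sum.cong refl integral_sum int) simp_all
    finally show ?thesis .
  qed
  also have "\<dots> = (\<Sum>i\<in>UNIV. \<Sum>j\<in>UNIV. J $ i $ j * energy_form k s (?G i) (?G j)) +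
      (\<Sum>i\<in>UNIV. \<Sum>j\<in>UNIV. J $ i $ j * (\<Sum>l<s. ?Q l (?G i) * ?Q l (?G j)))"
    by (simp add: integral_mult_hbvm_proj[OF cont] distrib_left sum.distrib)
  also have "(\<Sum>i\<in>UNIV. \<Sum>j\<in>UNIV. J $ i $ j * (\<Sum>l<s. ?Q l (?G i) * ?Q l (?G j))) = 0"
    by (rule skew_sum_symmetric[OF J]) (simp only: mult.commute)
  finally show ?thesis by simp
qed

section \<open>Exact conservation for polynomial Hamiltonians\<close>

lemma monomial_along_polynomial_curve:
  fixes u :: "real \<Rightarrow> real^'n"
  assumes "\<And>t. u t = (\<Sum>i\<le>s. t ^ i *\<^sub>R a i)"
  shows "\<exists>p. degree p \<le> (\<Sum>i\<in>UNIV. \<beta> i) * s \<and> (\<forall>c. monomial (u (c * h)) \<beta> = poly p c)"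
proof -
  define q where "q i = (\<Sum>j\<le>s. monom (h ^ j * a j $ i) j)" for i
  have q: "u (c * h) $ i = poly (q i) c" for c i
    by (simp add: assms q_def poly_sum poly_monom power_mult_distrib mult_ac)
  have dq: "degree (q i) \<le> s" for i
    unfolding q_def by (intro degree_sum_le order.trans[OF degree_monom_le]) auto
  have "degree (\<Prod>i\<in>UNIV. q i ^ \<beta> i) \<le> (\<Sum>i\<in>UNIV. degree (q i ^ \<beta> i))"
    using degree_prod_sum_le[of UNIV "\<lambda>i. q i ^ \<beta> i"] by (simp add: comp_def)
  also have "\<dots> \<le> (\<Sum>i\<in>UNIV. \<beta> i * s)"
    by (intro sum_mono order.trans[OF degree_power_le]) (simp add: dq mult.commute)
  finally have "degree (\<Prod>i\<in>UNIV. q i ^ \<beta> i) \<le> (\<Sum>i\<in>UNIV. \<beta> i) * s" by (simp add: sum_distrib_right)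
  moreover have "monomial (u (c * h)) \<beta> = poly (\<Prod>i\<in>UNIV. q i ^ \<beta> i) c" for c
    by (simp add: monomial_def q poly_prod)
  ultimately show ?thesis by blast
qed

lemma GDERIV_sum:
  assumes "\<And>i. i \<in> I \<Longrightarrow> GDERIV (f i) x :> D i"
  shows "GDERIV (\<lambda>x. \<Sum>i\<in>I. f i x) x :> (\<Sum>i\<in>I. D i)"
  using assms unfolding gderiv_def inner_sum_right by (intro has_derivative_sum)

text \<open>The truncated \<open>\<nu> - 1\<close> is sound: a multi-index contributing to the i-th
  partial derivative has \<open>\<alpha> i > 0\<close>, hence total degree at least 1, and for all
  others the factor \<open>real (\<alpha> i)\<close> is zero. Composition with a curve of degree s
  multiplies degrees by s.\<close>

lemma polynomial_gradient:
  fixes H :: "real^'n \<Rightarrow> real"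
  assumes "polynomial_of_degree H \<nu>"
  shows "GDERIV H x :> grad H x"
    and "(\<And>t. u t = (\<Sum>i\<le>s. t ^ i *\<^sub>R b i)) \<Longrightarrow>
      \<exists>p. degree p \<le> (\<nu> - 1) * s \<and> (\<forall>c. grad H (u (c * h)) $ i = poly p c)"
proof -
  obtain a where fin: "finite {\<alpha>. a \<alpha> \<noteq> 0}"
    and H: "\<And>x. H x = (\<Sum>\<alpha> | a \<alpha> \<noteq> 0. a \<alpha> * monomial x \<alpha>)"
    and \<nu>: "\<nu> = Max (insert 0 ((\<lambda>\<alpha>. \<Sum>i\<in>UNIV. \<alpha> i) ` {\<alpha>. a \<alpha> \<noteq> 0}))"
    using assms unfolding polynomial_of_degree_def by blast
  have deg: "(\<Sum>i\<in>UNIV. \<alpha> i) \<le> \<nu>" if "a \<alpha> \<noteq> 0" for \<alpha>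
    unfolding \<nu> using fin that by (intro Max_ge) auto
  define D where "D x = (\<Sum>\<alpha> | a \<alpha> \<noteq> 0. a \<alpha> *\<^sub>R
    (\<chi> i. real (\<alpha> i) * monomial x (\<alpha>(i := \<alpha> i - 1))))" for x :: "real^'n"
  have GD: "GDERIV H x :> D x" for x
    unfolding H[abs_def] D_def
    using GDERIV_mult[OF GDERIV_const GDERIV_monomial] by (intro GDERIV_sum) simp
  have grad: "grad H x = D x" for x by (rule grad_eqI[OF GD])
  show "GDERIV H x :> grad H x" unfolding grad by (rule GD)
  assume u: "\<And>t. u t = (\<Sum>i\<le>s. t ^ i *\<^sub>R b i)"
  have "\<exists>p. degree p \<le> (\<nu> - 1) * s \<and>
      (\<forall>c. real (\<alpha> i) * monomial (u (c * h)) (\<alpha>(i := \<alpha> i - 1)) = poly p c)" if "a \<alpha> \<noteq> 0" for \<alpha>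
  proof (cases "\<alpha> i = 0")
    case True
    then show ?thesis by (intro exI[of _ 0]) simp
  next
    case False
    obtain p where p: "degree p \<le> (\<Sum>j\<in>UNIV. (\<alpha>(i := \<alpha> i - 1)) j) * s"
      "\<And>c. monomial (u (c * h)) (\<alpha>(i := \<alpha> i - 1)) = poly p c"
      using monomial_along_polynomial_curve[where u = u and s = s and a = b and h = h
          and \<beta> = "\<alpha>(i := \<alpha> i - 1)"] u by blast
    note p(1)
    also have "(\<Sum>j\<in>UNIV. (\<alpha>(i := \<alpha> i - 1)) j) * s \<le> (\<nu> - 1) * s"
      using False deg[OF that] by (subst sum_multi_index_decrement) auto
    finally show ?thesis using p(2) degree_smult_le[of "real (\<alpha> i)" p]
      by (intro exI[of _ "smult (real (\<alpha> i)) p"]) auto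
  qed
  then obtain p where p: "\<And>\<alpha>. a \<alpha> \<noteq> 0 \<Longrightarrow> degree (p \<alpha>) \<le> (\<nu> - 1) * s"
    "\<And>\<alpha> c. a \<alpha> \<noteq> 0 \<Longrightarrow> real (\<alpha> i) * monomial (u (c * h)) (\<alpha>(i := \<alpha> i - 1)) = poly (p \<alpha>) c"
    by metis
  show "\<exists>p. degree p \<le> (\<nu> - 1) * s \<and> (\<forall>c. grad H (u (c * h)) $ i = poly p c)"
  proof (intro exI conjI allI)
    show "degree (\<Sum>\<alpha> | a \<alpha> \<noteq> 0. smult (a \<alpha>) (p \<alpha>)) \<le> (\<nu> - 1) * s"
      using p(1) by (intro degree_sum_le[OF fin] order.trans[OF degree_smult_le]) auto
    fix c
    have "grad H (u (c * h)) $ i =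
        (\<Sum>\<alpha> | a \<alpha> \<noteq> 0. a \<alpha> * (real (\<alpha> i) * monomial (u (c * h)) (\<alpha>(i := \<alpha> i - 1))))"
      by (simp add: grad D_def)
    also have "\<dots> = poly (\<Sum>\<alpha> | a \<alpha> \<noteq> 0. smult (a \<alpha>) (p \<alpha>)) c"
      unfolding poly_sum poly_smult
      by (intro sum.cong refl arg_cong2[where f = times] p(2)) simp
    finally show "grad H (u (c * h)) $ i = poly (\<Sum>\<alpha> | a \<alpha> \<noteq> 0. smult (a \<alpha>) (p \<alpha>)) c" .
  qed
qed

text \<open>Along u the gradient is a polynomial in c of degree low enough for every quadrature
  error in \<open>energy_form\<close> to be exactly zero. So conservation holds for each solution
  and each h, with no smallness or ball condition.\<close>

lemma hbvm_conserves_polynomial: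
  fixes J :: "real^'n^'n" and H :: "real^'n \<Rightarrow> real"
  assumes sk: "1 \<le> s" "s \<le> k" and J: "transpose J = - J"
    and H: "polynomial_of_degree H \<nu>" and \<nu>: "\<nu> * s \<le> 2 * k"
    and u: "hbvm_solution k s (hamiltonian_field J H) y0 h u"
  shows "H (u h) = H y0"
proof -
  obtain b where b: "\<And>t. u t = (\<Sum>i\<le>s. t ^ i *\<^sub>R b i)"
    using u unfolding hbvm_solution_def by blast
  obtain p where p: "\<And>i. degree (p i) \<le> (\<nu> - 1) * s" "\<And>i c. grad H (u (c * h)) $ i = poly (p i) c"
    using polynomial_gradient(2)[OF H b] by metis
  have "energy_form k s (\<lambda>c. grad H (u (c * h)) $ i) G = 0" for i G
    unfolding energy_form_def
  proof (intro sum.neutral ballI)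
    fix j assume j: "j \<in> {..<s}"
    \<comment> \<open>For \<nu> > 0, j < s puts the left side below \<nu> s \<le> 2k. For \<nu> = 0
      the subtraction truncates and j < s \<le> k remains.\<close>
    have "(\<nu> - 1) * s + j < 2 * k"
    proof (cases \<nu>)
      case (Suc n)
      then show ?thesis using \<nu> j by simp
    qed (use j sk in simp)
    then have "degree (p i) + j < 2 * k" using p(1)[of i] by linarith
    from gauss_quadrature_legendre01_exact[OF this]
    show "(integral {0..1} (\<lambda>x. poly (legendre01 j) x * grad H (u (x * h)) $ i) -
        gauss_quadrature k (\<lambda>x. poly (legendre01 j) x * grad H (u (x * h)) $ i)) *
        gauss_quadrature k (\<lambda>x. poly (legendre01 j) x * G x) = 0"
      by (simp add: p(2) inner01_def)
  qed
  moreover have "continuous_on {0..1} (\<lambda>c. grad H (u (c * h)) $ i)" for i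
    unfolding p(2) by (intro continuous_intros)
  ultimately have "H (u (1 * h)) - H (u (0 * h)) = 0"
    using energy_increment[OF J hbvm_solution_curve[OF u] polynomial_gradient(1)[OF H]] by simp
  moreover have "u 0 = y0" using u unfolding hbvm_solution_def by blast
  ultimately show ?thesis by simp
qed

section \<open>Order\<close>

definition lie_derivative :: "(real^'n \<Rightarrow> real^'n) \<Rightarrow> (real^'n \<Rightarrow> real) \<Rightarrow> real^'n \<Rightarrow> real" where
  "lie_derivative f g x = (\<Sum>i\<in>UNIV. f x $ i * grad g x $ i)"

lemma smooth_lie_derivative:
  assumes "\<And>i. smooth (\<lambda>x. f x $ i)" "smooth g"
  shows "smooth (lie_derivative f g)"
  unfolding lie_derivative_def[abs_def]
  by (intro smooth_sum smooth.mult assms smooth_grad)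

lemma smooth_lie_derivative_power:
  assumes "\<And>i. smooth (\<lambda>x. f x $ i)" "smooth g"
  shows "smooth ((lie_derivative f ^^ m) g)"
  by (induction m) (simp_all add: assms smooth_lie_derivative)

text \<open>The Taylor polynomial of degree M in t of t \<mapsto> g(y(t)), where y solves y' = f(y)
  with y(0) = x.\<close>

definition lie_series ::
  "(real^'n \<Rightarrow> real^'n) \<Rightarrow> (real^'n \<Rightarrow> real) \<Rightarrow> nat \<Rightarrow> real \<Rightarrow> real^'n \<Rightarrow> real" where
  "lie_series f g M t x = (\<Sum>m\<le>M. t ^ m / fact m * (lie_derivative f ^^ m) g x)"

definition lie_series_grad ::
  "(real^'n \<Rightarrow> real^'n) \<Rightarrow> (real^'n \<Rightarrow> real) \<Rightarrow> nat \<Rightarrow> real \<Rightarrow> real^'n \<Rightarrow> real^'n" where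
  "lie_series_grad f g M t x = (\<Sum>m\<le>M. (t ^ m / fact m) *\<^sub>R grad ((lie_derivative f ^^ m) g) x)"

text \<open>Along an exact solution the Lie series at the remaining time telescopes up to its last term;
  a defect \<open>d\<close> enters only through its pairing with the gradient of the series. This replaces the
  nonlinear variation-of-constants formula.\<close>

lemma lie_series_derivative:
  fixes f :: "real^'n \<Rightarrow> real^'n"
  assumes f: "\<And>i. smooth (\<lambda>x. f x $ i)" and g: "smooth g"
    and X: "(X has_vector_derivative h *\<^sub>R (f (X c) - d)) (at c within S)"
  shows "((\<lambda>c. lie_series f g M (h * (1 - c)) (X c)) has_real_derivative
    h * ((h * (1 - c)) ^ M / fact M * (lie_derivative f ^^ Suc M) g (X c)
      - lie_series_grad f g M (h * (1 - c)) (X c) \<bullet> d)) (at c within S)"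
proof -
  let ?g = "\<lambda>m. (lie_derivative f ^^ m) g"
  have der_g: "((\<lambda>c. ?g m (X c)) has_real_derivative
      h * (?g (Suc m) (X c) - grad (?g m) (X c) \<bullet> d)) (at c within S)" for m
  proof -
    have "(h *\<^sub>R (f (X c) - d)) \<bullet> grad (?g m) (X c) = h * (?g (Suc m) (X c) - grad (?g m) (X c) \<bullet> d)"
      by (simp add: inner_diff_left lie_derivative_def inner_vec_def[of "f (X c)"] inner_commute[of d])
    then show ?thesis
      by (rule DERIV_cong[OF GDERIV_along_curve[OF smooth_grad(1)[OF smooth_lie_derivative_power[OF f g]] X]])
  qed
  show ?thesis
  proof (induction M)
    case 0
    show ?case using der_g[of 0] by (simp add: lie_series_def lie_series_grad_def)
  next
    case (Suc M)
    have "((\<lambda>c. (h * (1 - c)) ^ Suc M / fact (Suc M)) has_real_derivative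
        - h * ((h * (1 - c)) ^ M / fact M)) (at c within S)"
    proof -
      have "((\<lambda>c. (h * (1 - c)) ^ Suc M / fact (Suc M)) has_real_derivative
        (real (Suc M) * (h * (1 - c)) ^ M * - h) / fact (Suc M)) (at c within S)"
        by (rule DERIV_cdivide) (auto intro!: derivative_eq_intros simp del: power_Suc)
      moreover have "(real (Suc M) * (h * (1 - c)) ^ M * - h) / fact (Suc M) = - h * ((h * (1 - c)) ^ M / fact M)"
        unfolding fact_Suc by (simp del: of_nat_Suc add: mult.assoc mult.commute[of h])
      ultimately show ?thesis by (rule DERIV_cong)
    qed
    \<comment> \<open>Differentiating the power of the remaining time yields minus the term left
      over at level M, so the two cancel and only the Lie derivative of order M + 2 survives. The
      letters in the identity below stand for the large factors.\<close>
    from DERIV_mult[OF this der_g[of "Suc M"]]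
    have "((\<lambda>c. (h * (1 - c)) ^ Suc M / fact (Suc M) * ?g (Suc M) (X c)) has_real_derivative
        h * ((h * (1 - c)) ^ Suc M / fact (Suc M) * (?g (Suc (Suc M)) (X c) - grad (?g (Suc M)) (X c) \<bullet> d)
        - (h * (1 - c)) ^ M / fact M * ?g (Suc M) (X c))) (at c within S)"
    proof (rule DERIV_cong)
      show "- h * A * G + h * E * B = h * (B * E - A * G)" for A B E G :: real
        by (simp add: algebra_simps)
    qed
    from DERIV_add[OF Suc this] show ?case
      unfolding lie_series_def lie_series_grad_def sum.atMost_Suc
      by (rule DERIV_cong) (simp add: inner_add_left right_diff_distrib distrib_left)
  qed
qed

lemma lie_series_end: "lie_series f g M 0 x = g x"
proof -
  have "lie_series f g M 0 x = (\<Sum>m\<le>M. if m = 0 then g x else 0)"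
    unfolding lie_series_def by (intro sum.cong) auto
  then show ?thesis by simp
qed

text \<open>The derivative formula is integrated from c = 0, where the remaining time is h, to c =
  1, where it is 0 and the series collapses to g.\<close>

lemma lie_series_integral:
  fixes f :: "real^'n \<Rightarrow> real^'n"
  assumes f: "\<And>i. smooth (\<lambda>x. f x $ i)" and g: "smooth g"
    and X: "\<And>c. c \<in> {0..1} \<Longrightarrow> (X has_vector_derivative h *\<^sub>R (f (X c) - d c)) (at c within {0..1})"
  shows "((\<lambda>c. h * ((h * (1 - c)) ^ M / fact M * (lie_derivative f ^^ Suc M) g (X c)
      - lie_series_grad f g M (h * (1 - c)) (X c) \<bullet> d c)) has_integral
    (g (X 1) - lie_series f g M h (X 0))) {0..1}"
proof -
  have "((\<lambda>c. h * ((h * (1 - c)) ^ M / fact M * (lie_derivative f ^^ Suc M) g (X c)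
      - lie_series_grad f g M (h * (1 - c)) (X c) \<bullet> d c)) has_integral
    (lie_series f g M (h * (1 - 1)) (X 1) - lie_series f g M (h * (1 - 0)) (X 0))) {0..1}"
    using lie_series_derivative[OF f g X]
    by (intro fundamental_theorem_of_calculus)
      (auto simp flip: has_real_derivative_iff_has_vector_derivative)
  then show ?thesis by (simp add: lie_series_end)
qed

lemma lie_series_remainder_bound:
  fixes h c z B :: real
  assumes "0 \<le> h" "c \<in> {0..1}" "\<bar>z\<bar> \<le> B"
  shows "\<bar>h * ((h * (1 - c)) ^ M / fact M * z)\<bar> \<le> B * h ^ Suc M"
proof -
  have "\<bar>(h * (1 - c)) ^ M / fact M\<bar> \<le> h ^ M / 1"
    unfolding abs_divide
  proof (intro frac_le)
    have "h * (1 - c) \<le> h" using assms by (intro mult_left_le) auto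
    then show "\<bar>(h * (1 - c)) ^ M\<bar> \<le> h ^ M"
      unfolding power_abs using assms by (intro power_mono) (auto simp: abs_mult)
  qed (use assms in \<open>auto simp: fact_ge_1\<close>)
  then have "\<bar>(h * (1 - c)) ^ M / fact M\<bar> * \<bar>z\<bar> \<le> h ^ M * B"
    using assms by (intro mult_mono) auto
  then have "h * (\<bar>(h * (1 - c)) ^ M / fact M\<bar> * \<bar>z\<bar>) \<le> h * (h ^ M * B)"
    using assms by (intro mult_left_mono) auto
  then show ?thesis using assms by (simp add: abs_mult mult_ac)
qed

text \<open>The case of zero defect, that is, Taylor's theorem with integral remainder. The constant
  comes from compactness of the trajectory over [0,T] and is thus independent of h < T.\<close>

lemma exact_solution_lie_series:
  fixes f :: "real^'n \<Rightarrow> real^'n"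
  assumes f: "\<And>i. smooth (\<lambda>x. f x $ i)" and g: "smooth g"
    and T: "0 < T" and y: "exact_solution f y0 T y"
  shows "\<exists>K. \<forall>\<^sub>F h in at_right 0. \<bar>g (y h) - lie_series f g M h y0\<bar> \<le> K * h ^ Suc M"
proof -
  let ?z = "(lie_derivative f ^^ Suc M) g"
  have y0: "y 0 = y0" and dy: "\<And>t. t \<in> {0..T} \<Longrightarrow> (y has_vector_derivative f (y t)) (at t within {0..T})"
    using y by (auto simp: exact_solution_def)
  have "continuous_on {0..T} y"
    using dy by (rule continuous_on_vector_derivative)
  then have "compact (y ` {0..T})" by (intro compact_continuous_image) auto
  then have "bounded (?z ` y ` {0..T})"
    by (intro compact_imp_bounded compact_continuous_image[OF smooth_continuous_on]
        smooth_lie_derivative_power f g)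
  then obtain B where "\<forall>t\<in>{0..T}. \<bar>?z (y t)\<bar> \<le> B" by (auto simp: bounded_iff)
  then have B: "\<bar>?z (y t)\<bar> \<le> B" if "t \<in> {0..T}" for t using that by blast
  have "\<forall>\<^sub>F h in at_right 0. 0 < h \<and> h < T"
    using T by (auto simp: eventually_at_right_field)
  then have "\<forall>\<^sub>F h in at_right 0. \<bar>g (y h) - lie_series f g M h y0\<bar> \<le> B * h ^ Suc M"
  proof eventually_elim
    case (elim h)
    have in_T: "c * h \<in> {0..T}" if "c \<in> {0..1}" for c
      using that elim mult_mono[of c 1 h T] by auto
    have "((\<lambda>c. y (c * h)) has_vector_derivative h *\<^sub>R (f (y (c * h)) - 0)) (at c within {0..1})"
      if c: "c \<in> {0..1}" for c
    proof -
      have "((\<lambda>c. c * h) has_vector_derivative h) (at c within {0..1})"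
        by (auto intro!: derivative_eq_intros simp flip: has_real_derivative_iff_has_vector_derivative)
      moreover have "(y has_vector_derivative f (y (c * h))) (at (c * h) within (\<lambda>c. c * h) ` {0..1})"
        by (rule has_vector_derivative_within_subset[OF dy[OF in_T[OF c]]]) (use in_T in blast)
      ultimately show ?thesis
        using vector_diff_chain_within[of "\<lambda>c. c * h" h c "{0..1}" y] by (simp add: comp_def)
    qed
    from lie_series_integral[OF f g this, of M]
    have int: "((\<lambda>c. h * ((h * (1 - c)) ^ M / fact M * ?z (y (c * h)))) has_integral
        (g (y h) - lie_series f g M h y0)) {0..1}"
      by (simp add: y0)
    have "0 \<le> B" using B[of 0] T by auto
    then have "0 \<le> B * h ^ Suc M" using elim by auto
    then have "norm (g (y h) - lie_series f g M h y0) \<le> B * h ^ Suc M * measure lborel {0..1::real}"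
    proof (rule has_integral_bound_real[OF _ finite.emptyI int])
      fix c :: real assume "c \<in> {0..1} - {}"
      then have c: "c \<in> {0..1}" by simp
      show "norm (h * ((h * (1 - c)) ^ M / fact M * ?z (y (c * h)))) \<le> B * h ^ Suc M"
        unfolding real_norm_def using elim
        by (intro lie_series_remainder_bound c B in_T) simp
    qed
    then show ?case by simp
  qed
  then show ?thesis by blast
qed

text \<open>\<open>U h c\<close> stands for u(c h). The ball of fixed radius r supplies the bounds
  uniform in h from which the bootstrapping starts.\<close>

locale hbvm_family =
  fixes k s :: nat and f :: "real^'n \<Rightarrow> real^'n" and y0 :: "real^'n" and r :: real
    and U :: "real \<Rightarrow> real \<Rightarrow> real^'n"
  assumes s_le_k: "s \<le> k" and smooth_field: "\<And>i. smooth (\<lambda>x. f x $ i)"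
    and family: "\<forall>\<^sub>F h in at_right 0. U h 0 = y0 \<and> (\<forall>c\<in>{0..1}. U h c \<in> cball y0 r) \<and> hbvm_curve k s f h (U h)"
begin

text \<open>Bootstrapping: if every smooth function of the curve is graded to order \<open>N\<close>, so is its
  derivative, and integration gains one order.\<close>

lemma graded_smooth:
  assumes "smooth g"
  shows "graded N (\<lambda>h c. g (U h c))"
  using assms
proof (induction N arbitrary: g)
  case 0
  have "bounded (g ` cball y0 r)"
    using 0 by (intro compact_imp_bounded compact_continuous_image smooth_continuous_on) auto
  then obtain B where B: "\<forall>x\<in>cball y0 r. \<bar>g x\<bar> \<le> B" by (auto simp: bounded_iff)
  show ?case
  proof (rule graded_0I[of _ B], use family in eventually_elim)
    case (elim h)
    have "continuous_on {0..1} (U h)"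
      using elim unfolding hbvm_curve_def by (intro continuous_on_vector_derivative) blast
    then have "continuous_on {0..1} (\<lambda>c. g (U h c))"
      by (rule continuous_on_compose2[OF smooth_continuous_on[OF 0, of UNIV]]) simp
    then show ?case using elim B by blast
  qed
next
  case (Suc N)
  \<comment> \<open>The induction hypothesis is applied to the components of f and to the partial
    derivatives of g. Hence g is kept arbitrary in the induction, and \<open>smooth\<close> must be
    closed under partial derivatives.\<close>
  have "graded (Suc N) (\<lambda>h c. g y0 + h * integral {0..c} (\<lambda>c. \<Sum>i\<in>UNIV.
      hbvm_proj k s (\<lambda>c. f (U h c) $ i) c * grad g (U h c) $ i))"
    by (intro graded_add graded_const graded_integral graded_sum graded_mult graded_hbvm_proj s_le_k
        Suc.IH smooth_field smooth_grad Suc.prems)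
  then show ?case
  proof (rule graded_cong, use family in eventually_elim)
    case (elim h)
    then show ?case
      using hbvm_curve_increment[of k s f h "U h" g] smooth_grad(1)[OF Suc.prems] by force
  qed
qed

lemma continuous_on_smooth:
  "\<forall>\<^sub>F h in at_right 0. \<forall>g. smooth g \<longrightarrow> continuous_on {0..1} (\<lambda>c. g (U h c))"
  using family
proof eventually_elim
  case (elim h)
  have "continuous_on {0..1} (U h)"
    using elim unfolding hbvm_curve_def by (intro continuous_on_vector_derivative) blast
  then show ?case
    using continuous_on_compose2[OF smooth_continuous_on[of _ UNIV]] by blast
qed

lemma graded_lie_series_grad:
  assumes "smooth g"
  shows "graded N (\<lambda>h c. lie_series_grad f g M (h * (1 - c)) (U h c) $ i)"
proof -
  have "graded N (\<lambda>h c. \<Sum>m\<le>M. (1 / fact m) * (h * (1 - c)) ^ m *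
      grad ((lie_derivative f ^^ m) g) (U h c) $ i)"
    by (intro graded_sum graded_mult graded_const graded_power graded_remaining_time graded_smooth
        smooth_grad smooth_lie_derivative_power smooth_field assms)
  then show ?thesis by (simp add: lie_series_grad_def)
qed

text \<open>The truncation index 2s balances two errors: the Lie remainder is O(h^(2s+1)), and the
  defect pairing is O(h^(2s)) with a factor h in front. The gradient of the series at the remaining
  time is itself graded, which makes the bilinear estimate applicable.\<close>

lemma curve_lie_series:
  assumes g: "smooth g"
  shows "\<exists>K. \<forall>\<^sub>F h in at_right 0. \<bar>g (U h 1) - lie_series f g (2 * s) h y0\<bar> \<le> K * h ^ Suc (2 * s)"
proof -
  let ?M = "2 * s"
  let ?z = "(lie_derivative f ^^ Suc ?M) g"
  let ?W = "\<lambda>i h c. lie_series_grad f g ?M (h * (1 - c)) (U h c) $ i"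
  let ?F = "\<lambda>i h c. f (U h c) $ i"
  let ?I = "\<lambda>i h. integral {0..1} (\<lambda>c. ?W i h c * (?F i h c - hbvm_proj k s (?F i h) c))"
  have z: "smooth ?z" by (intro smooth_lie_derivative_power smooth_field g)
  obtain B where B: "B \<ge> 0" "\<forall>\<^sub>F h in at_right 0. \<forall>c\<in>{0..1}. \<bar>?z (U h c)\<bar> \<le> B"
    using graded_bounded[OF graded_smooth[OF z]] by blast
  have "\<forall>i. \<exists>K. \<forall>\<^sub>F h in at_right 0. \<bar>?I i h\<bar> \<le> K * h ^ ?M"
    by (intro allI integral_mult_defect_graded s_le_k graded_lie_series_grad graded_smooth smooth_field g)
  then have "\<exists>K. \<forall>i. \<forall>\<^sub>F h in at_right 0. \<bar>?I i h\<bar> \<le> K i * h ^ ?M" by (rule choice)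
  then obtain K where K: "\<forall>i. \<forall>\<^sub>F h in at_right 0. \<bar>?I i h\<bar> \<le> K i * h ^ ?M" by (rule exE)
  have "\<forall>\<^sub>F h in at_right 0. \<forall>i\<in>UNIV. \<bar>?I i h\<bar> \<le> K i * h ^ ?M"
    by (intro eventually_ball_finite ballI K[rule_format]) simp
  moreover have "\<forall>\<^sub>F h in at_right 0. \<forall>i\<in>UNIV. continuous_on {0..1} (?W i h)"
  proof (intro eventually_ball_finite ballI)
    fix i
    show "\<forall>\<^sub>F h in at_right 0. continuous_on {0..1} (?W i h)"
      using graded_lie_series_grad[OF g, of 0 ?M i] unfolding graded_def
      by (elim exE) (erule eventually_mono, erule conjunct1)
  qed simp
  ultimately have "\<forall>\<^sub>F h in at_right 0. \<bar>g (U h 1) - lie_series f g ?M h y0\<bar> \<le>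
      (B + (\<Sum>i\<in>UNIV. K i)) * h ^ Suc ?M"
    using family B(2) continuous_on_smooth eventually_small
  proof eventually_elim
    case (elim h)
    have cF: "continuous_on {0..1} (?F i h)" and cz: "continuous_on {0..1} (\<lambda>c. ?z (U h c))" for i
      using elim smooth_field z by blast+
    have cW: "continuous_on {0..1} (?W i h)" for i using elim by blast
    define R where "R c = h * ((h * (1 - c)) ^ ?M / fact ?M * ?z (U h c))" for c
    have cR: "continuous_on {0..1} R"
      unfolding R_def using cz by (intro continuous_intros) auto
    have int: "(\<lambda>c. ?W i h c * (?F i h c - hbvm_proj k s (?F i h) c)) integrable_on {0..1}" for i
      by (intro integrable_continuous_real continuous_on_mult continuous_on_diff cW cF continuous_on_hbvm_proj)
    define d where "d c = f (U h c) - (\<chi> i. hbvm_proj k s (?F i h) c)" for c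
    have "(U h has_vector_derivative h *\<^sub>R (f (U h c) - d c)) (at c within {0..1})"
      if "c \<in> {0..1}" for c
      using elim that unfolding hbvm_curve_def d_def by simp
    from lie_series_integral[OF smooth_field g this, of ?M]
    have "((\<lambda>c. R c - h * (lie_series_grad f g ?M (h * (1 - c)) (U h c) \<bullet> d c)) has_integral
        (g (U h 1) - lie_series f g ?M h y0)) {0..1}"
      using elim unfolding R_def right_diff_distrib by simp
    then have "g (U h 1) - lie_series f g ?M h y0 =
        integral {0..1} (\<lambda>c. R c - h * (\<Sum>i\<in>UNIV. ?W i h c * (?F i h c - hbvm_proj k s (?F i h) c)))"
      unfolding inner_vec_def d_def by (simp add: integral_unique)
    also have "\<dots> = integral {0..1} R -
        h * integral {0..1} (\<lambda>c. \<Sum>i\<in>UNIV. ?W i h c * (?F i h c - hbvm_proj k s (?F i h) c))"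
    proof -
      have "(\<lambda>c. h * (\<Sum>i\<in>UNIV. ?W i h c * (?F i h c - hbvm_proj k s (?F i h) c))) integrable_on {0..1}"
        by (intro integrable_on_mult_right integrable_sum int) simp
      from integral_diff[OF integrable_continuous_real[OF cR] this] show ?thesis by simp
    qed
    also have "integral {0..1} (\<lambda>c. \<Sum>i\<in>UNIV. ?W i h c * (?F i h c - hbvm_proj k s (?F i h) c)) =
        (\<Sum>i\<in>UNIV. ?I i h)"
      by (intro integral_sum int) simp
    finally have eq: "g (U h 1) - lie_series f g ?M h y0 = integral {0..1} R - h * (\<Sum>i\<in>UNIV. ?I i h)" .
    have "norm (integral {0..1} R) \<le> B * h ^ Suc ?M * (1 - 0)"
    proof (rule integral_bound[OF _ cR])
      show "norm (R c) \<le> B * h ^ Suc ?M" if "c \<in> {0..1}" for c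
        unfolding R_def real_norm_def using elim that by (intro lie_series_remainder_bound) auto
    qed simp
    moreover have "\<bar>\<Sum>i\<in>UNIV. ?I i h\<bar> \<le> (\<Sum>i\<in>UNIV. K i * h ^ ?M)"
      using elim by (intro order.trans[OF sum_abs] sum_mono) blast
    then have "h * \<bar>\<Sum>i\<in>UNIV. ?I i h\<bar> \<le> h * (\<Sum>i\<in>UNIV. K i * h ^ ?M)"
      using elim by (intro mult_left_mono) auto
    then have "\<bar>h * (\<Sum>i\<in>UNIV. ?I i h)\<bar> \<le> (\<Sum>i\<in>UNIV. K i) * h ^ Suc ?M"
      using elim by (simp add: abs_mult sum_distrib_right mult_ac)
    ultimately show ?case unfolding eq by (simp add: distrib_right)
  qed
  then show ?thesis by blast
qed

end

section \<open>Analytic Hamiltonians: assembling the estimates\<close>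

lemma smooth_hamiltonian_field:
  assumes "real_analytic H"
  shows "smooth (\<lambda>x. hamiltonian_field J H x $ i)"
proof -
  have "smooth (\<lambda>x. \<Sum>j\<in>UNIV. J $ i $ j * grad H x $ j)"
    by (intro smooth_sum smooth.mult smooth.const smooth_grad smooth.analytic assms)
  then show ?thesis by (simp add: hamiltonian_field_def matrix_vector_mult_def)
qed

lemma smooth_field_lipschitz:
  fixes f :: "real^'n \<Rightarrow> real^'n"
  assumes "\<And>i. smooth (\<lambda>x. f x $ i)"
  shows "\<exists>L\<ge>0. \<forall>x\<in>cball y0 r. \<forall>y\<in>cball y0 r. dist (f x) (f y) \<le> L * dist x y"
proof -
  have "\<forall>i. \<exists>L\<ge>0. \<forall>x\<in>cball y0 r. \<forall>y\<in>cball y0 r. \<bar>f x $ i - f y $ i\<bar> \<le> L * dist x y"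
    using smooth_lipschitz_on_compact_convex[OF assms compact_cball convex_cball] by blast
  then obtain L where L: "\<And>i. L i \<ge> 0"
    "\<And>i. \<forall>x\<in>cball y0 r. \<forall>y\<in>cball y0 r. \<bar>f x $ i - f y $ i\<bar> \<le> L i * dist x y" by metis
  have "dist (f x) (f y) \<le> (\<Sum>i\<in>UNIV. L i) * dist x y" if "x \<in> cball y0 r" "y \<in> cball y0 r" for x y
  proof -
    have "dist (f x) (f y) \<le> (\<Sum>i\<in>UNIV. \<bar>f x $ i - f y $ i\<bar>)"
      using norm_le_l1_cart[of "f x - f y"] by (simp add: dist_norm)
    also have "\<dots> \<le> (\<Sum>i\<in>UNIV. L i * dist x y)"
      using L(2) that by (intro sum_mono) blast
    finally show ?thesis by (simp add: sum_distrib_right)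
  qed
  then show ?thesis using L(1) by (intro exI[of _ "\<Sum>i\<in>UNIV. L i"] conjI ballI sum_nonneg) auto
qed

lemma hbvm_family_of_solutions:
  fixes f :: "real^'n \<Rightarrow> real^'n"
  assumes s: "s \<le> k" and f: "\<And>i. smooth (\<lambda>x. f x $ i)"
    and ex1: "\<forall>\<^sub>F h in at_right 0. \<exists>!u. hbvm_solution_in_ball k s f y0 r h u"
  shows "hbvm_family k s f y0 r (\<lambda>h c. (THE u. hbvm_solution_in_ball k s f y0 r h u) (c * h))"
proof
  show "\<forall>\<^sub>F h in at_right 0. (THE u. hbvm_solution_in_ball k s f y0 r h u) (0 * h) = y0 \<and>
      (\<forall>c\<in>{0..1}. (THE u. hbvm_solution_in_ball k s f y0 r h u) (c * h) \<in> cball y0 r) \<and>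
      hbvm_curve k s f h (\<lambda>c. (THE u. hbvm_solution_in_ball k s f y0 r h u) (c * h))"
    using ex1
  proof eventually_elim
    case (elim h)
    let ?u = "THE u. hbvm_solution_in_ball k s f y0 r h u"
    have "hbvm_solution_in_ball k s f y0 r h ?u" by (rule theI'[OF elim])
    then have sol: "hbvm_solution k s f y0 h ?u" and ball: "\<forall>c\<in>{0..1}. ?u (c * h) \<in> ball y0 r"
      unfolding hbvm_solution_in_ball_def by blast+
    have "?u 0 = y0" using sol unfolding hbvm_solution_def by blast
    moreover have "\<forall>c\<in>{0..1}. ?u (c * h) \<in> cball y0 r" using ball ball_subset_cball by blast
    ultimately show ?case using hbvm_solution_curve[OF sol] by simp
  qed
qed (fact s f)+

text \<open>The exponent is the 2k of the energy form plus one for the factor h of the increment; s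
  enters only through s \<le> k. The matrix of constants is chosen entrywise, and finitely many
  entries share one threshold for h.\<close>

lemma (in hbvm_family) energy_error:
  assumes J: "transpose J = - J" and f: "f = hamiltonian_field J H" and H: "smooth H"
  shows "\<exists>K. \<forall>\<^sub>F h in at_right 0. \<bar>H (U h 1) - H y0\<bar> \<le> K * h ^ (2 * k + 1)"
proof -
  let ?E = "\<lambda>i j h. energy_form k s (\<lambda>c. grad H (U h c) $ i) (\<lambda>c. grad H (U h c) $ j)"
  have "\<forall>i. \<exists>K. \<forall>j. \<forall>\<^sub>F h in at_right 0. \<bar>?E i j h\<bar> \<le> K j * h ^ (2 * k)"
    by (rule allI, rule choice, rule allI)
      (intro energy_form_graded s_le_k graded_smooth smooth_grad H)
  then have "\<exists>K. \<forall>i j. \<forall>\<^sub>F h in at_right 0. \<bar>?E i j h\<bar> \<le> K i j * h ^ (2 * k)"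
    by (rule choice)
  then obtain K where K: "\<forall>i j. \<forall>\<^sub>F h in at_right 0. \<bar>?E i j h\<bar> \<le> K i j * h ^ (2 * k)"
    by (rule exE)
  have "\<forall>\<^sub>F h in at_right 0. \<forall>i\<in>UNIV. \<forall>j\<in>UNIV. \<bar>?E i j h\<bar> \<le> K i j * h ^ (2 * k)"
    by (intro eventually_ball_finite ballI K[rule_format]) simp_all
  then have "\<forall>\<^sub>F h in at_right 0. \<bar>H (U h 1) - H y0\<bar> \<le>
      (\<Sum>i\<in>UNIV. \<Sum>j\<in>UNIV. \<bar>J $ i $ j\<bar> * K i j) * h ^ (2 * k + 1)"
    using family continuous_on_smooth eventually_small
  proof eventually_elim
    case (elim h)
    have "hbvm_curve k s (hamiltonian_field J H) h (U h)" using elim f by blast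
    moreover have "continuous_on {0..1} (\<lambda>c. grad H (U h c) $ i)" for i
      using elim smooth_grad(2)[OF H] by blast
    ultimately have "H (U h 1) - H (U h 0) = h * (\<Sum>i\<in>UNIV. \<Sum>j\<in>UNIV. J $ i $ j * ?E i j h)"
      by (intro energy_increment J smooth_grad H)
    then have "\<bar>H (U h 1) - H y0\<bar> = h * \<bar>\<Sum>i\<in>UNIV. \<Sum>j\<in>UNIV. J $ i $ j * ?E i j h\<bar>"
      using elim by (simp only: abs_mult) simp
    also have "\<dots> \<le> h * (\<Sum>i\<in>UNIV. \<Sum>j\<in>UNIV. \<bar>J $ i $ j\<bar> * (K i j * h ^ (2 * k)))"
    proof (rule mult_left_mono, rule order.trans[OF sum_abs], rule sum_mono, rule order.trans[OF sum_abs], rule sum_mono)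
      fix i j
      show "\<bar>J $ i $ j * ?E i j h\<bar> \<le> \<bar>J $ i $ j\<bar> * (K i j * h ^ (2 * k))"
        unfolding abs_mult using elim by (intro mult_left_mono) auto
    qed (use elim in simp)
    also have "h * (\<Sum>i\<in>UNIV. \<Sum>j\<in>UNIV. \<bar>J $ i $ j\<bar> * (K i j * h ^ (2 * k))) =
        (\<Sum>i\<in>UNIV. \<Sum>j\<in>UNIV. \<bar>J $ i $ j\<bar> * K i j) * h ^ (2 * k + 1)"
      by (simp add: sum_distrib_left sum_distrib_right mult_ac)
    finally show ?case using elim by simp
  qed
  then show ?thesis by blast
qed

text \<open>Numerical and exact solution are both compared with the same Lie series at
  \<open>y0\<close>, with g a coordinate function, and the triangle inequality joins the two
  estimates.\<close>

lemma (in hbvm_family) order_error: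
  assumes T: "0 < T" and y: "exact_solution f y0 T y"
  shows "\<exists>K. \<forall>\<^sub>F h in at_right 0. norm (U h 1 - y h) \<le> K * h ^ (2 * s + 1)"
proof -
  have "\<exists>K. \<forall>\<^sub>F h in at_right 0. \<bar>U h 1 $ i - y h $ i\<bar> \<le> K * h ^ (2 * s + 1)" for i
  proof -
    obtain K1 where K1: "\<forall>\<^sub>F h in at_right 0.
        \<bar>U h 1 $ i - lie_series f (\<lambda>x. x $ i) (2 * s) h y0\<bar> \<le> K1 * h ^ Suc (2 * s)"
      using curve_lie_series[OF smooth.coordinate] by blast
    obtain K2 where K2: "\<forall>\<^sub>F h in at_right 0.
        \<bar>y h $ i - lie_series f (\<lambda>x. x $ i) (2 * s) h y0\<bar> \<le> K2 * h ^ Suc (2 * s)"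
      using exact_solution_lie_series[OF smooth_field smooth.coordinate T y] by blast
    have "\<forall>\<^sub>F h in at_right 0. \<bar>U h 1 $ i - y h $ i\<bar> \<le> (K1 + K2) * h ^ (2 * s + 1)"
      using K1 K2 by eventually_elim (simp add: distrib_right)
    then show ?thesis by blast
  qed
  then have "\<exists>K. \<forall>i. \<forall>\<^sub>F h in at_right 0. \<bar>U h 1 $ i - y h $ i\<bar> \<le> K i * h ^ (2 * s + 1)"
    by (intro choice allI)
  then obtain K where K: "\<forall>i. \<forall>\<^sub>F h in at_right 0. \<bar>U h 1 $ i - y h $ i\<bar> \<le> K i * h ^ (2 * s + 1)"
    by (rule exE)
  have "\<forall>\<^sub>F h in at_right 0. \<forall>i\<in>UNIV. \<bar>U h 1 $ i - y h $ i\<bar> \<le> K i * h ^ (2 * s + 1)"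
    by (intro eventually_ball_finite ballI K[rule_format]) simp
  then have "\<forall>\<^sub>F h in at_right 0. norm (U h 1 - y h) \<le> (\<Sum>i\<in>UNIV. K i) * h ^ (2 * s + 1)"
  proof eventually_elim
    case (elim h)
    have "norm (U h 1 - y h) \<le> (\<Sum>i\<in>UNIV. \<bar>(U h 1 - y h) $ i\<bar>)" by (rule norm_le_l1_cart)
    also have "\<dots> \<le> (\<Sum>i\<in>UNIV. K i * h ^ (2 * s + 1))"
      using elim by (intro sum_mono) simp
    finally show ?case by (simp only: sum_distrib_right)
  qed
  then show ?thesis by blast
qed

lemma bigo_at_right_powerI:
  fixes F :: "real \<Rightarrow> real"
  assumes "\<forall>\<^sub>F h in at_right 0. \<bar>F h\<bar> \<le> K * h ^ n"
  shows "F \<in> O[at_right 0](\<lambda>h. h ^ n)"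
  by (rule bigoI[of _ K], use assms eventually_small in eventually_elim) auto

theorem theorem3p5:
  fixes k s m :: nat and J :: "real^'n^'n" and H :: "real^'n \<Rightarrow> real" and y0 :: "real^'n"
  assumes "1 \<le> s" and "s \<le> k"
    and "CARD('n) = 2 * m"
    and "invertible J" and "transpose J = - J" and "- J = matrix_inv J"
  shows "(\<forall>\<nu> h u. polynomial_of_degree H \<nu> \<longrightarrow> real \<nu> \<le> 2 * real k / real s \<longrightarrow> 0 < h \<longrightarrow>
            hbvm_solution k s (hamiltonian_field J H) y0 h u \<longrightarrow> H (u h) = H y0)
    \<and> (real_analytic H \<longrightarrow> (\<forall>r>0.
          (\<forall>\<^sub>F h in at_right 0. \<exists>!u. hbvm_solution_in_ball k s (hamiltonian_field J H) y0 r h u)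
        \<and> (\<lambda>h. H (hbvm_step k s (hamiltonian_field J H) y0 r h) - H y0)
             \<in> O[at_right 0](\<lambda>h. h ^ (2 * k + 1))
        \<and> (\<forall>y T. 0 < T \<longrightarrow> exact_solution (hamiltonian_field J H) y0 T y \<longrightarrow>
             (\<lambda>h. norm (hbvm_step k s (hamiltonian_field J H) y0 r h - y h))
               \<in> O[at_right 0](\<lambda>h. h ^ (2 * s + 1)))))"
proof (intro conjI allI impI)
  fix \<nu> h u
  assume H: "polynomial_of_degree H \<nu>" and "real \<nu> \<le> 2 * real k / real s"
    and u: "hbvm_solution k s (hamiltonian_field J H) y0 h u"
  then have "real (\<nu> * s) \<le> real (2 * k)"
    using assms(1) by (simp add: pos_le_divide_eq)
  then have "\<nu> * s \<le> 2 * k" by (simp only: of_nat_le_iff)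
  then show "H (u h) = H y0"
    by (rule hbvm_conserves_polynomial[OF assms(1,2,5) H _ u])
next
  fix r :: real
  assume H: "real_analytic H" and r: "r > 0"
  let ?f = "hamiltonian_field J H"
  have f: "smooth (\<lambda>x. ?f x $ i)" for i by (rule smooth_hamiltonian_field[OF H])
  obtain L where L: "L \<ge> 0" "\<forall>x\<in>cball y0 r. \<forall>y\<in>cball y0 r. dist (?f x) (?f y) \<le> L * dist x y"
    using smooth_field_lipschitz[OF f] by blast
  show ex1: "\<forall>\<^sub>F h in at_right 0. \<exists>!u. hbvm_solution_in_ball k s ?f y0 r h u"
    by (rule hbvm_solution_in_ball_ex1[OF r _ L(1)]) (use L(2) in blast)
  \<comment> \<open>At c = 1 this family is exactly \<open>hbvm_step\<close> at h, up to rewriting 1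
    * h; this is how the estimates on \<open>U h 1\<close> become statements about the
    method.\<close>
  interpret hbvm_family k s ?f y0 r "\<lambda>h c. (THE u. hbvm_solution_in_ball k s ?f y0 r h u) (c * h)"
    by (rule hbvm_family_of_solutions[OF assms(2) f ex1])
  obtain K where "\<forall>\<^sub>F h in at_right 0. \<bar>H (hbvm_step k s ?f y0 r h) - H y0\<bar> \<le> K * h ^ (2 * k + 1)"
    using energy_error[OF assms(5) refl smooth.analytic[OF H]]
    unfolding hbvm_step_def mult_1 by blast
  then show "(\<lambda>h. H (hbvm_step k s ?f y0 r h) - H y0) \<in> O[at_right 0](\<lambda>h. h ^ (2 * k + 1))"
    by (rule bigo_at_right_powerI)
  fix y T
  assume "0 < T" "exact_solution ?f y0 T y"
  from order_error[OF this] obtain K where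
    "\<forall>\<^sub>F h in at_right 0. norm (hbvm_step k s ?f y0 r h - y h) \<le> K * h ^ (2 * s + 1)"
    unfolding hbvm_step_def mult_1 by blast
  then show "(\<lambda>h. norm (hbvm_step k s ?f y0 r h - y h)) \<in> O[at_right 0](\<lambda>h. h ^ (2 * s + 1))"
    by (intro bigo_at_right_powerI[of _ K]) simp
qed

end
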